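(* Let $m<n$ be positive integers and for $\epsilon>0$ let $S_\epsilon(z)=\epsilon S(z/\epsilon)$ and $Q_\epsilon(z)=\epsilon Q(z/\epsilon)$, where $S(z)=z+\frac1z$ and $$Q(z)=z\Big(1+\frac1z\Big)^{\frac{2(n-m)}{n}}\Big(1-\frac1z\Big)^{\frac{2m}{n}}.$$ Then the pushforward of the differential $\omega=-w^{n-1}dw$ by $S_\epsilon(Q_\epsilon^{-1})$ extends to a holomorphic differential on $\mathbb C$ with zeros of orders $n-m-1$, $1$ and $m-1$ respectively at the left, middle and right points of the slit $\{\zeta\mid-2\epsilon\le\Re\zeta\le2\epsilon,\ \Im\zeta=0\}$, where the left point is the image of the vertex of the sector of angle $2\pi(n-m)/n$, the middle point is the common image of the two slit tips, and the right point is the image of the vertex of the sector of angle $2\pi m/n$. If the construction is performed in a coordinate $w$ in a small disc on a compact Riemann surface $R$ in which an Abelian differential has the normal form $-w^{n-1}dw$, the deformation of the differential is isoperiodic (the periods are not changed), and the integral norm of the differential is not changed.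
   Context: $S$ is the Riemann mapping from $\{|z|>1\}$ to the complement of the segment $[-2,2]$. $Q$ (branch with $Q(z)\sim z$ at infinity) is the Riemann mapping from $\{|z|>1\}$ to the complement of two equal length slits from the origin, at angles $\pm\pi m/n$ with the positive real axis. The slits divide a neighborhood of the origin into a sector of angle $2\pi m/n$ (containing the positive axis) and a sector of angle $2\pi(n-m)/n$; the origin, as a boundary point of the cut-open plane, gives one vertex for each sector. $S_\epsilon,Q_\epsilon$ have domain $\{|z|>\epsilon\}$; the composition $S_\epsilon(Q_\epsilon^{-1}(w))$ maps the complement of the scaled slits $\Sigma_\epsilon$ of $Q_\epsilon$ onto the complement of $\{\zeta\mid-2\epsilon\le\Re\zeta\le2\epsilon,\ \Im\zeta=0\}$ and extends to the cut-open slit edges. Pushforward means pullback by the inverse of the (injective) map, a priori defined on the complement of the image slit. A zero of order $0$ means holomorphic and nonzero. "Left" and "right" points are the endpoints $\mp2\epsilon$ of the image slit and the "middle" point is a point between them. Construction on a surface: with $A_\epsilon=S_\epsilon\circ Q_\epsilon^{-1}$, $\epsilon$ small and $\Sigma_\epsilon$ contained in a disc $\{|w|<\rho\}$ of the coordinate, the deformed surface is obtained by cutting $R$ open along $\Sigma_\epsilon$ and regluing the slit edges via $A_\epsilon$, i.e. $\{|w|<\rho\}\setminus\Sigma_\epsilon$ is identified by $\zeta=A_\epsilon(w)$ with its image in the $\zeta$-plane and the image slit is filled in. The deformed differential is the extension of the original differential on $R\setminus\Sigma_\epsilon$. Periods are compared on cycles disjoint from the disc; the integral norm of $\omega$ is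 $\frac i2\int\omega\wedge\overline{\omega}$. *)

theory Defs
  imports "HOL-Complex_Analysis.Complex_Analysis"
begin

section \<open>The two slit maps\<close>

definition S_map :: "complex \<Rightarrow> complex" where
  "S_map z = z + 1 / z"

text \<open>For \<open>1 < cmod z\<close> both bases have positive real part, so the principal powers are
  holomorphic there, and \<open>Q_map m n z / z\<close> tends to 1 at infinity.\<close>

definition Q_map :: "nat \<Rightarrow> nat \<Rightarrow> complex \<Rightarrow> complex" where
  "Q_map m n z = z * (1 + 1 / z) powr of_real (2 * (real n - real m) / real n)
                   * (1 - 1 / z) powr of_real (2 * real m / real n)"

definition S_eps :: "real \<Rightarrow> complex \<Rightarrow> complex" where
  "S_eps \<epsilon> z = of_real \<epsilon> * S_map (z / of_real \<epsilon>)"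

definition Q_eps :: "nat \<Rightarrow> nat \<Rightarrow> real \<Rightarrow> complex \<Rightarrow> complex" where
  "Q_eps m n \<epsilon> z = of_real \<epsilon> * Q_map m n (z / of_real \<epsilon>)"

definition exterior :: "real \<Rightarrow> complex set" where
  "exterior \<epsilon> = {z. \<epsilon> < cmod z}"

definition slits :: "nat \<Rightarrow> nat \<Rightarrow> real \<Rightarrow> complex set" where
  "slits m n \<epsilon> = - (Q_eps m n \<epsilon> ` exterior \<epsilon>)"

definition image_slit :: "real \<Rightarrow> complex set" where
  "image_slit \<epsilon> = {\<zeta>. - 2 * \<epsilon> \<le> Re \<zeta> \<and> Re \<zeta> \<le> 2 * \<epsilon> \<and> Im \<zeta> = 0}"

definition regluing_map :: "nat \<Rightarrow> nat \<Rightarrow> real \<Rightarrow> complex \<Rightarrow> complex" where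
  "regluing_map m n \<epsilon> w = S_eps \<epsilon> (inv_into (exterior \<epsilon>) (Q_eps m n \<epsilon>) w)"

definition two_slits :: "real \<Rightarrow> real \<Rightarrow> complex set" where
  "two_slits \<alpha> l = {of_real t * cis \<alpha> | t. 0 \<le> t \<and> t \<le> l} \<union> {of_real t * cis (- \<alpha>) | t. 0 \<le> t \<and> t \<le> l}"

text \<open>The sectors at the origin cut out by the rays at angles \<open>\<alpha>\<close> and \<open>- \<alpha>\<close>, of opening
  \<open>2 * \<alpha>\<close> and \<open>2 * pi - 2 * \<alpha>\<close>.  A vertex of the cut-open plane is the origin approached
  through one of them.\<close>

definition right_sector :: "real \<Rightarrow> complex set" where
  "right_sector \<alpha> = {w. w \<noteq> 0 \<and> \<bar>Arg w\<bar> < \<alpha>}"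

definition left_sector :: "real \<Rightarrow> complex set" where
  "left_sector \<alpha> = {w. w \<noteq> 0 \<and> \<bar>Arg w\<bar> > \<alpha>}"


section \<open>Differentials on plane domains\<close>

text \<open>A differential \<open>a(w) dw\<close> on a plane domain is represented by its coefficient \<open>a\<close>.
  The pushforward under \<open>f\<close>, injective on \<open>D\<close>, is the pullback under the inverse of \<open>f\<close>.\<close>

definition pushforward :: "complex set \<Rightarrow> (complex \<Rightarrow> complex) \<Rightarrow> (complex \<Rightarrow> complex) \<Rightarrow> complex \<Rightarrow> complex" where
  "pushforward D f a \<zeta> = a (inv_into D f \<zeta>) * deriv (inv_into D f) \<zeta>"

text \<open>\<^const>\<open>zorder\<close> carries no information at a point near which the function vanishes
  identically, hence the second conjunct.  Order 0 means holomorphic and nonzero.\<close>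

definition has_zero_of_order :: "(complex \<Rightarrow> complex) \<Rightarrow> complex \<Rightarrow> nat \<Rightarrow> bool" where
  "has_zero_of_order F a k \<longleftrightarrow>
     F analytic_on {a} \<and> (\<exists>\<^sub>F z in at a. F z \<noteq> 0) \<and> zorder F a = int k"


section \<open>Riemann surfaces and holomorphic differentials\<close>

text \<open>A chart is a domain together with a coordinate function, whose values outside the
  domain are irrelevant.  An atlas need not be maximal, but it may be.\<close>

type_synonym 'a chart = "'a set \<times> ('a \<Rightarrow> complex)"

definition chart_on :: "'a topology \<Rightarrow> 'a chart \<Rightarrow> bool" where
  "chart_on X c \<longleftrightarrow> openin X (fst c) \<and> open (snd c ` fst c) \<and>
     homeomorphic_map (subtopology X (fst c)) (top_of_set (snd c ` fst c)) (snd c)"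

definition transition :: "'a chart \<Rightarrow> 'a chart \<Rightarrow> complex \<Rightarrow> complex" where
  "transition c d = snd d \<circ> inv_into (fst c) (snd c)"

text \<open>Second countability is not required; it is automatic for compact surfaces (and in
  general, by Rado's theorem).\<close>

definition riemann_surface :: "'a topology \<Rightarrow> 'a chart set \<Rightarrow> bool" where
  "riemann_surface X A \<longleftrightarrow>
     topspace X \<noteq> {} \<and> Hausdorff_space X \<and> connected_space X \<and>
     (\<forall>c\<in>A. chart_on X c) \<and> (\<Union>c\<in>A. fst c) = topspace X \<and>
     (\<forall>c\<in>A. \<forall>d\<in>A. transition c d holomorphic_on snd c ` (fst c \<inter> fst d))"

definition compact_riemann_surface :: "'a topology \<Rightarrow> 'a chart set \<Rightarrow> bool" where
  "compact_riemann_surface X A \<longleftrightarrow> riemann_surface X A \<and> compact_space X"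

text \<open>A differential assigns to each chart \<open>c\<close> with coordinate \<open>z\<close> the coefficient \<open>\<omega> c\<close>
  of its expression \<open>(\<omega> c)(z) dz\<close>.\<close>

type_synonym 'a differential = "'a chart \<Rightarrow> complex \<Rightarrow> complex"

definition holomorphic_differential :: "'a chart set \<Rightarrow> 'a differential \<Rightarrow> bool" where
  "holomorphic_differential A \<omega> \<longleftrightarrow>
     (\<forall>c\<in>A. \<omega> c holomorphic_on snd c ` fst c) \<and>
     (\<forall>c\<in>A. \<forall>d\<in>A. \<forall>p\<in>fst c \<inter> fst d.
        \<omega> c (snd c p) = \<omega> d (snd d p) * deriv (transition c d) (snd c p))"


section \<open>Periods\<close>

definition piecewise_C1_path :: "'a topology \<Rightarrow> 'a chart set \<Rightarrow> (real \<Rightarrow> 'a) \<Rightarrow> bool" where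
  "piecewise_C1_path X A \<gamma> \<longleftrightarrow> pathin X \<gamma> \<and>
     (\<forall>c\<in>A. \<forall>a b. 0 \<le> a \<and> a \<le> b \<and> b \<le> 1 \<and> \<gamma> ` {a..b} \<subseteq> fst c
        \<longrightarrow> (snd c \<circ> \<gamma>) piecewise_C1_differentiable_on {a..b})"

text \<open>Integration along a path: subdivide it into pieces lying in single charts and add up
  the contour integrals of the coefficients.\<close>

definition has_line_integral ::
  "'a chart set \<Rightarrow> 'a differential \<Rightarrow> (real \<Rightarrow> 'a) \<Rightarrow> complex \<Rightarrow> bool" where
  "has_line_integral A \<omega> \<gamma> I \<longleftrightarrow>
     (\<exists>(N::nat) (t :: nat \<Rightarrow> real) (c :: nat \<Rightarrow> 'a chart) (J :: nat \<Rightarrow> complex).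
        t 0 = 0 \<and> t N = 1 \<and>
        (\<forall>i<N. t i \<le> t (Suc i) \<and> c i \<in> A \<and> \<gamma> ` {t i..t (Suc i)} \<subseteq> fst (c i) \<and>
           (\<omega> (c i) has_contour_integral J i) (subpath (t i) (t (Suc i)) (snd (c i) \<circ> \<gamma>))) \<and>
        I = (\<Sum>i<N. J i))"

definition line_integral :: "'a chart set \<Rightarrow> 'a differential \<Rightarrow> (real \<Rightarrow> 'a) \<Rightarrow> complex" where
  "line_integral A \<omega> \<gamma> = (THE I. has_line_integral A \<omega> \<gamma> I)"

text \<open>A 1-chain is a formal integer combination of paths, a 1-cycle one without boundary.\<close>

definition one_cycle :: "'a topology \<Rightarrow> 'a chart set \<Rightarrow> (int \<times> (real \<Rightarrow> 'a)) list \<Rightarrow> bool" where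
  "one_cycle X A C \<longleftrightarrow>
     (\<forall>(k, \<gamma>)\<in>set C. piecewise_C1_path X A \<gamma>) \<and>
     (\<forall>p. (\<Sum>(k, \<gamma>)\<leftarrow>C. k * (of_bool (\<gamma> 1 = p) - of_bool (\<gamma> 0 = p))) = 0)"

definition period :: "'a chart set \<Rightarrow> 'a differential \<Rightarrow> (int \<times> (real \<Rightarrow> 'a)) list \<Rightarrow> complex" where
  "period A \<omega> C = (\<Sum>(k, \<gamma>)\<leftarrow>C. of_int k * line_integral A \<omega> \<gamma>)"


section \<open>The integral norm\<close>

text \<open>If \<open>\<omega> = f dz\<close> with \<open>z = x + i y\<close>, then \<open>(i/2) \<omega> \<and> cnj \<omega> = (i/2) (cmod f)\<^sup>2 dz \<and> cnj dz\<close>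
  is the nonnegative density \<open>(cmod f)\<^sup>2 dx dy\<close>.  Its integral over the surface is the supremum
  of its integrals over finite families of disjoint Borel pieces, each contained in a chart
  and integrated in that chart; it is attained when the pieces cover the surface.\<close>

definition chart_pieces :: "'a chart set \<Rightarrow> ('a chart \<times> 'a set) set \<Rightarrow> bool" where
  "chart_pieces A P \<longleftrightarrow> finite P \<and> disjoint_family_on snd P \<and>
     (\<forall>(c, E)\<in>P. c \<in> A \<and> E \<subseteq> fst c \<and> snd c ` E \<in> sets borel)"

definition integral_norm :: "'a chart set \<Rightarrow> 'a differential \<Rightarrow> ennreal" where
  "integral_norm A \<omega> = (SUP P \<in> Collect (chart_pieces A).
     \<Sum>(c, E)\<in>P. \<integral>\<^sup>+z\<in>snd c ` E. ennreal ((cmod (\<omega> c z))\<^sup>2) \<partial>lborel)"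


section \<open>Cutting and regluing\<close>

text \<open>The surface \<open>(X, A)\<close> is cut along the set \<open>\<Sigma>\<close> in the disc of radius \<open>\<rho>\<close> of the chart \<open>c\<close>,
  and the set \<open>J\<close> of the \<open>\<zeta>\<close>-plane is filled in, \<open>f\<close> being the map \<open>w \<mapsto> \<zeta>\<close>.  Each class of the
  gluing has exactly one representative either among the points of \<open>X\<close> off the cut (\<open>Inl\<close>)
  or in \<open>J\<close> (\<open>Inr\<close>).\<close>

definition coord_disc :: "'a chart \<Rightarrow> real \<Rightarrow> 'a set" where
  "coord_disc c \<rho> = {p \<in> fst c. cmod (snd c p) < \<rho>}"

definition cut :: "'a chart \<Rightarrow> complex set \<Rightarrow> 'a set" where
  "cut c \<Sigma> = {p \<in> fst c. snd c p \<in> \<Sigma>}"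

definition zeta_chart ::
  "'a chart \<Rightarrow> real \<Rightarrow> complex set \<Rightarrow> complex set \<Rightarrow> (complex \<Rightarrow> complex) \<Rightarrow> ('a + complex) chart" where
  "zeta_chart c \<rho> \<Sigma> J f =
     (Inl ` (coord_disc c \<rho> - cut c \<Sigma>) \<union> Inr ` J, case_sum (f \<circ> snd c) (\<lambda>\<zeta>. \<zeta>))"

definition cut_chart :: "'a chart \<Rightarrow> complex set \<Rightarrow> 'a chart \<Rightarrow> ('a + complex) chart" where
  "cut_chart c \<Sigma> d = (Inl ` (fst d - cut c \<Sigma>), case_sum (snd d) (\<lambda>_. 0))"

definition deformed_atlas ::
  "'a chart set \<Rightarrow> 'a chart \<Rightarrow> real \<Rightarrow> complex set \<Rightarrow> complex set \<Rightarrow> (complex \<Rightarrow> complex)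
     \<Rightarrow> ('a + complex) chart set" where
  "deformed_atlas A c \<rho> \<Sigma> J f = insert (zeta_chart c \<rho> \<Sigma> J f) (cut_chart c \<Sigma> ` A)"

text \<open>The gluing topology: a set is open iff its traces on both glued parts are.\<close>

definition deformed_topology ::
  "'a topology \<Rightarrow> 'a chart \<Rightarrow> real \<Rightarrow> complex set \<Rightarrow> complex set \<Rightarrow> (complex \<Rightarrow> complex)
     \<Rightarrow> ('a + complex) topology" where
  "deformed_topology X c \<rho> \<Sigma> J f = topology (\<lambda>V.
     V \<subseteq> Inl ` (topspace X - cut c \<Sigma>) \<union> Inr ` J \<and>
     openin X (Inl -` V) \<and>
     open (snd (zeta_chart c \<rho> \<Sigma> J f) ` (V \<inter> fst (zeta_chart c \<rho> \<Sigma> J f))))"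

definition is_deformed_differential ::
  "'a chart set \<Rightarrow> 'a differential \<Rightarrow> 'a chart \<Rightarrow> real \<Rightarrow> complex set \<Rightarrow> complex set
     \<Rightarrow> (complex \<Rightarrow> complex) \<Rightarrow> ('a + complex) differential \<Rightarrow> bool" where
  "is_deformed_differential A \<omega> c \<rho> \<Sigma> J f \<omega>' \<longleftrightarrow>
     holomorphic_differential (deformed_atlas A c \<rho> \<Sigma> J f) \<omega>' \<and>
     (\<forall>d\<in>A. \<forall>z\<in>snd d ` (fst d - cut c \<Sigma>). \<omega>' (cut_chart c \<Sigma> d) z = \<omega> d z)"

end

(* With zeta = S(z) and w = Q(z) one has w^n = P(zeta), where
   P(zeta) = (zeta + 2 epsilon)^(n-m) (zeta - 2 epsilon)^m is a polynomial.  Hence -w^(n-1) dw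
   = -dP/n, so the pushforward is -P'(zeta) dzeta / n, whose zeros can be read off: those of P and
   the remaining critical point mu of P in the slit.  In the coordinate log z the map log Q has
   derivative of positive real part, which gives injectivity of Q.  On the circle |z| = epsilon, Q
   runs through the two slits, up to the radius where |P| is maximal on [-2 epsilon, 2 epsilon],
   which happens at mu.  The boundary values are omitted by Q by openness and injectivity, and Q is
   proper, so its image is the whole complement of the slits.

   The regluing is an isometry for |omega|^2 off sets of measure zero, and cycles away from the
   disc see the same charts before and after, so neither norm nor periods change. *)
theory Submission
  imports Defs
begin

section \<open>The slit maps\<close>

text \<open>The regluing map \<open>f\<close> has no closed form: it is reached only through the
  parameter z, with \<open>w = Q z\<close> and \<open>\<zeta> = S z\<close>, and through the
  relation between \<open>w ^ n\<close> and P. Its behaviour at the slit edges is therefore read off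
  from the closed exterior: \<open>Q\<close> and \<open>S\<close> are continuous up to the circle,
  and growth estimates make their images of closed sets closed. This one fact yields the image of
  \<open>Q\<close>, the limits of \<open>f\<close> at slit points, and the openness of the refilled
  disc. At the origin two circle points, \<open>\<epsilon>\<close> and \<open>- \<epsilon>\<close>,
  have the same boundary value, so a limit of \<open>f\<close> exists only sector by sector, and
  connectedness of the sector has to select it.

  The surgery is carried out for an abstract cut, filling and gluing map with a few topological
  properties. A deformed differential is not assumed to be polynomial on the filling: compatibility
  with the old charts fixes it off the filling, and the filling is a null set, which is all that the
  norm sees.\<close>

lemma inj_on_Re_deriv_pos:
  fixes f f' :: "complex \<Rightarrow> complex"
  assumes "convex S" and der: "\<And>z. z \<in> S \<Longrightarrow> (f has_field_derivative f' z) (at z)"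
    and pos: "\<And>z. z \<in> S \<Longrightarrow> 0 < Re (f' z)"
  shows "inj_on f S"
proof (rule inj_onI, rule ccontr)
  fix x y assume xy: "x \<in> S" "y \<in> S" "f x = f y" "x \<noteq> y"
  define p where "p t = x + of_real t * (y - x)" for t :: real
  \<comment> \<open>Projection of the values on the direction \<open>y - x\<close>: its derivative
    along the segment is \<open>Re (f' (p t))\<close> times a positive factor, so equal end values
    contradict the mean value theorem (the Noshiro-Warschawski argument).\<close>
  define \<phi> where "\<phi> t = Re (f (p t) * cnj (y - x))" for t
  have pS: "p t \<in> S" if "0 \<le> t" "t \<le> 1" for t
    using convexD_alt[OF \<open>convex S\<close> xy(1,2) that]
    by (simp add: p_def algebra_simps scaleR_conv_of_real)
  have d: "(\<phi> has_real_derivative Re (f' (p t)) * (cmod (y - x))\<^sup>2) (at t)"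
    if "0 \<le> t" "t \<le> 1" for t
  proof -
    have "(p has_vector_derivative (y - x)) (at t)"
      unfolding p_def by (auto intro!: derivative_eq_intros simp: has_vector_derivative_def scaleR_conv_of_real)
    then have "((f \<circ> p) has_vector_derivative (y - x) * f' (p t)) (at t)"
      by (rule field_vector_diff_chain_at) (rule der[OF pS[OF that]])
    then have "((\<lambda>t. f (p t) * cnj (y - x)) has_vector_derivative (y - x) * f' (p t) * cnj (y - x)) (at t)"
      by (intro has_vector_derivative_mult_left) (simp add: o_def)
    then have "(\<phi> has_vector_derivative Re ((y - x) * f' (p t) * cnj (y - x))) (at t)"
      unfolding \<phi>_def by (rule bounded_linear.has_vector_derivative[OF bounded_linear_Re])
    moreover have *: "(y - x) * f' (p t) * cnj (y - x) = of_real ((cmod (y - x))\<^sup>2) * f' (p t)"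
      by (metis complex_norm_square mult.assoc mult.commute)
    moreover have "Re ((y - x) * f' (p t) * cnj (y - x)) = Re (f' (p t)) * (cmod (y - x))\<^sup>2"
      unfolding * by (simp del: of_real_power)
    ultimately show ?thesis
      by (simp only: has_real_derivative_iff_has_vector_derivative)
  qed
  have "\<exists>t. 0 < t \<and> t < 1 \<and> \<phi> 1 - \<phi> 0 = (1 - 0) * (Re (f' (p t)) * (cmod (y - x))\<^sup>2)"
    by (rule MVT2) (use d in auto)
  then obtain t where t: "0 < t" "t < 1" "\<phi> 1 - \<phi> 0 = Re (f' (p t)) * (cmod (y - x))\<^sup>2"
    by auto
  have "\<phi> 1 = \<phi> 0" using xy(3) by (simp add: \<phi>_def p_def)
  moreover have "0 < Re (f' (p t)) * (cmod (y - x))\<^sup>2"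
    using pos[OF pS, of t] t xy(4) by simp
  ultimately show False using t(3) by simp
qed

lemma inv_into_holomorphic:
  assumes "f holomorphic_on U" "open U" "bij_betw f U V"
  shows "inv_into U f holomorphic_on V"
proof -
  obtain g where g: "g holomorphic_on V" "\<And>w. w \<in> U \<Longrightarrow> g (f w) = w"
    using holomorphic_has_inverse[OF assms(1,2)] assms(3) unfolding bij_betw_def by metis
  show ?thesis
  proof (rule holomorphic_transform[OF g(1)])
    fix z assume "z \<in> V"
    then have "inv_into U f z \<in> U" "f (inv_into U f z) = z"
      using assms(3) by (auto simp: bij_betw_def inv_into_into f_inv_into_f)
    then show "g z = inv_into U f z" using g(2) by metis
  qed
qed

lemma powr_of_real_polar:
  assumes "w \<noteq> 0"
  shows "w powr of_real a = of_real (cmod w powr a) * cis (a * Arg w)"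
proof -
  have "Ln w = of_real (ln (cmod w)) + \<i> * of_real (Arg w)"
    using assms by (intro complex_eqI) (simp_all add: Arg_eq_Im_Ln)
  then have "w powr of_real a = exp (of_real (a * ln (cmod w)) + \<i> * of_real (a * Arg w))"
    using assms by (simp add: powr_def ring_distribs mult_ac)
  then show ?thesis
    using assms by (simp add: exp_add exp_of_real cis_conv_exp powr_def del: of_real_mult)
qed

text \<open>The growth bound keeps preimages of a convergent sequence bounded, so a subsequence
  converges inside \<open>T\<close>, and continuity identifies the limit. Below this serves as
  properness of \<open>Q\<close> and \<open>S\<close>.\<close>

lemma closed_image_coercive:
  fixes h :: "complex \<Rightarrow> complex"
  assumes "continuous_on T h" "closed T" "\<And>z. z \<in> T \<Longrightarrow> cmod z \<le> cmod (h z) + K"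
  shows "closed (h ` T)"
  unfolding closed_sequential_limits
proof (intro allI impI, elim conjE)
  fix y l assume y: "\<forall>k::nat. y k \<in> h ` T" and lim: "y \<longlonglongrightarrow> l"
  then obtain z where z: "\<And>k. z k \<in> T" "\<And>k. y k = h (z k)"
    using y unfolding image_iff by metis
  obtain B where B: "\<And>k. cmod (y k) \<le> B"
    using convergent_imp_bounded[OF lim] by (auto simp: bounded_iff)
  have "bounded (range z)"
    unfolding bounded_iff
  proof (intro exI ballI)
    fix x assume "x \<in> range z"
    then obtain k where k: "x = z k" by blast
    have "cmod (z k) \<le> cmod (h (z k)) + K" using assms(3) z(1) by simp
    also have "h (z k) = y k" using z(2) by simp
    finally show "cmod x \<le> B + K" using B[of k] k by simp
  qed
  then obtain z0 r where r: "strict_mono (r :: nat \<Rightarrow> nat)" "(z \<circ> r) \<longlonglongrightarrow> z0"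
    using bounded_imp_convergent_subsequence by blast
  have z0: "z0 \<in> T"
    using assms(2) r(2) z(1) unfolding closed_sequential_limits by (metis comp_apply)
  have "(h \<circ> (z \<circ> r)) \<longlonglongrightarrow> h z0"
    using assms(1) z0 r(2) z(1) unfolding continuous_on_sequentially by (simp add: o_def)
  moreover have "(h \<circ> (z \<circ> r)) = y \<circ> r" using z(2) by auto
  ultimately have "h z0 = l"
    using LIMSEQ_subseq_LIMSEQ[OF lim r(1)] LIMSEQ_unique by fastforce
  with z0 show "l \<in> h ` T" by blast
qed

lemma connected_if_connected_to:
  assumes "connected C" "C \<noteq> {}" "C \<subseteq> U"
    and "\<And>w. w \<in> U \<Longrightarrow> \<exists>T. connected T \<and> w \<in> T \<and> T \<subseteq> U \<and> T \<inter> C \<noteq> {}"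
  shows "connected U"
proof -
  obtain T where T: "\<And>w. w \<in> U \<Longrightarrow> connected (T w) \<and> w \<in> T w \<and> T w \<subseteq> U \<and> T w \<inter> C \<noteq> {}"
    using assms(4) by metis
  have eq: "U = (\<Union>w\<in>U. T w \<union> C)" using T assms(3) by fast
  have "connected (\<Union>w\<in>U. T w \<union> C)"
  proof (rule connected_Union)
    fix S assume "S \<in> (\<lambda>w. T w \<union> C) ` U"
    then show "connected S" using T assms(1) by (auto intro!: connected_Un)
  next
    show "\<Inter> ((\<lambda>w. T w \<union> C) ` U) \<noteq> {}" using assms(2) by blast
  qed
  with eq show ?thesis by simp
qed

section \<open>Growth, continuity and injectivity of Q\<close>

locale slit_map =
  fixes m n :: nat and \<epsilon> :: real
  assumes m_pos: "0 < m" and m_less: "m < n" and eps_pos: "0 < \<epsilon>"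
begin

abbreviation "\<alpha> \<equiv> pi * real m / real n"
abbreviation "Q \<equiv> Q_eps m n \<epsilon>"
abbreviation "S \<equiv> S_eps \<epsilon>"

definition "a = 2 * (real n - real m) / real n"
definition "b = 2 * real m / real n"

text \<open>The relation \<open>a + b = 2\<close> acts twice: it splits the constant 1 in the
  logarithmic derivative of \<open>Q\<close>, and it makes the argument of \<open>Q\<close> constant
  on a half circle.\<close>

lemma a_pos: "0 < a" and b_pos: "0 < b" and a_add_b: "a + b = 2"
  using m_pos m_less by (auto simp: a_def b_def field_simps)

lemma alpha_bounds: "0 < \<alpha>" "\<alpha> < pi"
  using m_pos m_less by (auto simp: field_simps)

text \<open>The formula for \<open>Q\<close> still makes sense on the circle, so its values there
  serve as boundary values without any limit construction.\<close>

definition "cext = {z. \<epsilon> \<le> cmod z}"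

lemma Q_eq: fixes z :: complex shows "Q z = z * (1 + \<epsilon> / z) powr of_real a * (1 - \<epsilon> / z) powr of_real b"
  using eps_pos by (simp add: Q_eps_def Q_map_def a_def b_def)

lemma S_eq: fixes z :: complex shows "z \<noteq> 0 \<Longrightarrow> S z = z + \<epsilon>\<^sup>2 / z"
  using eps_pos by (simp add: S_eps_def S_map_def field_simps power2_eq_square)

definition "P \<zeta> = (\<zeta> + 2 * of_real \<epsilon>) ^ (n - m) * (\<zeta> - 2 * of_real \<epsilon>) ^ m"  for \<zeta> :: complex

lemma Re_quot_le: fixes z :: complex shows "z \<in> cext \<Longrightarrow> \<bar>Re (\<epsilon> / z)\<bar> \<le> 1"
  by (rule order_trans[OF abs_Re_le_cmod]) (use eps_pos in \<open>auto simp: cext_def norm_divide divide_le_eq_1\<close>)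

lemma Re_quot_less: fixes z :: complex shows "z \<in> exterior \<epsilon> \<Longrightarrow> \<bar>Re (\<epsilon> / z)\<bar> < 1"
  by (rule le_less_trans[OF abs_Re_le_cmod]) (use eps_pos in \<open>auto simp: exterior_def norm_divide divide_less_eq_1\<close>)

text \<open>On the closed exterior both bases have nonnegative real part and so stay off the open
  negative axis. At \<open>z = \<plusminus> \<epsilon>\<close> one base vanishes, and there the
  positive exponent gives continuity.\<close>

lemma continuous_Q: "continuous_on cext Q"
  unfolding Q_eq
proof (intro continuous_intros)
  show "cext \<subseteq> {z. 0 \<le> Re (1 + \<epsilon> / z) \<or> Im (1 + \<epsilon> / z) \<noteq> 0}"
    "cext \<subseteq> {z. 0 \<le> Re (1 - \<epsilon> / z) \<or> Im (1 - \<epsilon> / z) \<noteq> 0}"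
    using Re_quot_le by (force simp: abs_le_iff)+
qed (use eps_pos a_pos b_pos in \<open>auto simp: cext_def\<close>)

lemma holomorphic_Q: "Q holomorphic_on exterior \<epsilon>"
  unfolding Q_eq
proof (intro holomorphic_intros)
  fix z assume z: "z \<in> exterior \<epsilon>"
  show "1 + \<epsilon> / z \<notin> \<real>\<^sub>\<le>\<^sub>0" "1 - \<epsilon> / z \<notin> \<real>\<^sub>\<le>\<^sub>0"
    using Re_quot_less[OF z] by (auto simp: complex_nonpos_Reals_iff)
qed (use eps_pos in \<open>auto simp: exterior_def\<close>)

lemma holomorphic_S: "S holomorphic_on exterior \<epsilon>"
  unfolding S_eps_def S_map_def
  by (intro holomorphic_intros) (use eps_pos in \<open>auto simp: exterior_def\<close>)

lemma continuous_S: "continuous_on cext S"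
  unfolding S_eps_def S_map_def
  by (intro continuous_intros) (use eps_pos in \<open>auto simp: cext_def\<close>)

text \<open>Raising to the k-th power removes the choice of branch. At \<open>w = 0\<close>
  positivity of \<open>k\<close> and \<open>j\<close> makes both sides 0.\<close>

lemma powr_real_power:
  assumes "real k * x = real j" "0 < k" "0 < j"
  shows "((w::complex) powr of_real x) ^ k = w ^ j"
proof (cases "w = 0")
  case False
  have "(w powr of_real x) ^ k = w powr (of_nat k * of_real x)"
    using assms False by (simp add: powr_def exp_of_nat_mult mult.assoc)
  also have "of_nat k * of_real x = (of_nat j :: complex)"
    using assms(1) by (metis of_real_mult of_real_of_nat_eq)
  finally show ?thesis using False by (simp add: powr_nat')
qed (use assms in \<open>simp add: power_0_left\<close>)

lemma Q_power:
  assumes "z \<noteq> 0"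
  shows "Q z ^ n = P (S z)"
proof -
  have n0: "0 < n" "0 < n - m" using m_pos m_less by auto
  have e1: "((1 + \<epsilon> / z) powr of_real a) ^ n = (1 + \<epsilon> / z) ^ (2 * (n - m))"
    "((1 - \<epsilon> / z) powr of_real b) ^ n = (1 - \<epsilon> / z) ^ (2 * m)"
    using n0 m_pos m_less by (intro powr_real_power; simp add: a_def b_def of_nat_diff)+
  \<comment> \<open>Both squares become affine in \<open>S z\<close> once multiplied by z; splitting
    \<open>z ^ n\<close> as \<open>z ^ (n - m) * z ^ m\<close> supplies one z for each
    square.\<close>
  have e2: "z * (1 + \<epsilon> / z)\<^sup>2 = S z + 2 * \<epsilon>" "z * (1 - \<epsilon> / z)\<^sup>2 = S z - 2 * \<epsilon>"
    using assms by (simp_all add: S_eq power2_eq_square field_simps)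
  have "Q z ^ n = z ^ n * ((1 + \<epsilon> / z) ^ (2 * (n - m)) * (1 - \<epsilon> / z) ^ (2 * m))"
    by (simp add: Q_eq power_mult_distrib e1)
  also have "z ^ n = z ^ (n - m) * z ^ m"
    using m_less by (simp flip: power_add)
  finally have "Q z ^ n = (z * (1 + \<epsilon> / z)\<^sup>2) ^ (n - m) * (z * (1 - \<epsilon> / z)\<^sup>2) ^ m"
    by (simp add: power_mult_distrib power_mult)
  then show ?thesis unfolding e2 P_def by simp
qed

lemma norm_S_ge: assumes "z \<in> cext" shows "cmod z \<le> cmod (S z) + \<epsilon>"
  and "cmod (S z) \<le> cmod z + \<epsilon>"
proof -
  have z: "z \<noteq> 0" "\<epsilon> \<le> cmod z" using assms eps_pos by (auto simp: cext_def)
  have "cmod (\<epsilon>\<^sup>2 / z) = \<epsilon>\<^sup>2 / cmod z" by (simp add: norm_divide norm_power)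
  also have "\<dots> \<le> \<epsilon>" using z eps_pos by (simp add: field_simps power2_eq_square)
  finally have le: "cmod (\<epsilon>\<^sup>2 / z) \<le> \<epsilon>" .
  have "cmod (S z - \<epsilon>\<^sup>2 / z) \<le> cmod (S z) + cmod (\<epsilon>\<^sup>2 / z)" by (rule norm_triangle_ineq4)
  with le show "cmod z \<le> cmod (S z) + \<epsilon>" using z by (simp add: S_eq)
  show "cmod (S z) \<le> cmod z + \<epsilon>"
    using z le norm_triangle_ineq[of z "\<epsilon>\<^sup>2 / z"] by (simp add: S_eq)
qed

text \<open>If \<open>cmod (S z) > 2 * \<epsilon>\<close>, both linear factors of \<open>P\<close>
  have modulus at least \<open>cmod (S z) - 2 * \<epsilon>\<close>, hence so has the n-th root
  \<open>cmod (Q z)\<close>. The constant is this \<open>2 * \<epsilon>\<close> plus the \<epsilon>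
  lost between z and \<open>S z\<close>.\<close>

lemma norm_Q_ge: assumes "z \<in> cext" shows "cmod z \<le> cmod (Q z) + 3 * \<epsilon>"
proof (cases "cmod (S z) \<le> 2 * \<epsilon>")
  case True
  then show ?thesis using norm_S_ge(1)[OF assms] norm_ge_zero[of "Q z"] by linarith
next
  case False
  have z: "z \<noteq> 0" using assms eps_pos by (auto simp: cext_def)
  let ?r = "cmod (S z) - 2 * \<epsilon>"
  have r: "?r \<le> cmod (S z + 2 * \<epsilon>)" "?r \<le> cmod (S z - 2 * \<epsilon>)"
    using norm_triangle_ineq2[of "S z" "2 * \<epsilon>"] norm_diff_ineq[of "S z" "2 * \<epsilon>"] eps_pos
    by (simp_all add: norm_mult)
  have "?r ^ n = ?r ^ (n - m) * ?r ^ m" using m_less by (simp flip: power_add)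
  also have "\<dots> \<le> cmod (S z + 2 * \<epsilon>) ^ (n - m) * cmod (S z - 2 * \<epsilon>) ^ m"
    using r False by (intro mult_mono power_mono) auto
  also have "\<dots> = cmod (Q z) ^ n"
    unfolding norm_power[symmetric] Q_power[OF z] by (simp add: P_def norm_mult norm_power)
  finally have "?r \<le> cmod (Q z)"
    using m_less by (subst (asm) power_mono_iff) (use False in auto)
  then show ?thesis using norm_S_ge(1)[OF assms] by linarith
qed

lemma Q_zero_iff: "z \<in> cext \<Longrightarrow> Q z = 0 \<longleftrightarrow> z = \<epsilon> \<or> z = - of_real \<epsilon>"
proof -
  assume "z \<in> cext"
  then have z: "z \<noteq> 0" using eps_pos by (auto simp: cext_def)
  then have "1 + \<epsilon> / z = 0 \<longleftrightarrow> z = - of_real \<epsilon>" "1 - \<epsilon> / z = 0 \<longleftrightarrow> z = of_real \<epsilon>"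
    by (auto simp: field_simps eq_neg_iff_add_eq_0)
  then show ?thesis using z by (auto simp: Q_eq)
qed

lemma exterior_cext: "exterior \<epsilon> \<subseteq> cext" and open_exterior: "open (exterior \<epsilon>)"
  and closed_cext: "closed cext"
  unfolding exterior_def cext_def
  by (auto intro!: open_Collect_less closed_Collect_le continuous_intros)

lemma exterior_nz: "z \<in> exterior \<epsilon> \<Longrightarrow> z \<noteq> 0" using eps_pos by (auto simp: exterior_def)


lemma inj_Q: "inj_on Q (exterior \<epsilon>)"
proof (rule inj_onI)
  \<comment> \<open>A single-valued logarithm of \<open>Q (\<epsilon> * exp s) / \<epsilon>\<close>.
    Passing to s replaces the exterior by a half plane, which is convex, as the derivative criterion
    demands.\<close>
  define h where "h s = s + of_real a * Ln (1 + exp (- s)) + of_real b * Ln (1 - exp (- s))" for s :: complex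
  define h' where "h' s = of_real (a / 2) * ((1 - exp (- s)) / (1 + exp (- s)))
      + of_real (b / 2) * ((1 + exp (- s)) / (1 - exp (- s)))" for s :: complex
  define H where "H = {s::complex. 0 < Re s}"
  have small: "cmod (exp (- s)) < 1" if "s \<in> H" for s
    using that by (simp add: H_def)
  have nonneg: "1 + exp (- s) \<notin> \<real>\<^sub>\<le>\<^sub>0" "1 - exp (- s) \<notin> \<real>\<^sub>\<le>\<^sub>0" if "s \<in> H" for s
  proof -
    have "\<bar>Re (exp (- s))\<bar> < 1" using small[OF that] abs_Re_le_cmod le_less_trans by blast
    then show "1 + exp (- s) \<notin> \<real>\<^sub>\<le>\<^sub>0" "1 - exp (- s) \<notin> \<real>\<^sub>\<le>\<^sub>0"
      unfolding complex_nonpos_Reals_iff plus_complex.sel minus_complex.sel one_complex.sel by linarith+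
  qed
  have nz: "1 + exp (- s) \<noteq> 0" "1 - exp (- s) \<noteq> 0" if "s \<in> H" for s
    using nonneg[OF that] by auto
  have "inj_on h H"
  proof (rule inj_on_Re_deriv_pos)
    show "convex H" unfolding H_def by (rule convex_halfspace_Re_gt)
  next
    fix s assume s: "s \<in> H"
    let ?u = "exp (- s)"
    have "(h has_field_derivative 1 + of_real a * (- ?u / (1 + ?u)) + of_real b * (?u / (1 - ?u))) (at s)"
    proof -
      have "((\<lambda>s. Ln (1 + exp (- s))) has_field_derivative - ?u / (1 + ?u)) (at s)"
        "((\<lambda>s. Ln (1 - exp (- s))) has_field_derivative ?u / (1 - ?u)) (at s)"
        using nonneg[OF s] by (auto intro!: derivative_eq_intros simp: divide_inverse)
      then show ?thesis unfolding h_def by (intro DERIV_add DERIV_cmult DERIV_ident)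
    qed
    moreover have "1 + of_real a * (- ?u / (1 + ?u)) + of_real b * (?u / (1 - ?u)) = h' s"
    proof -
      \<comment> \<open>Sharing out the summand 1 as \<open>a / 2 + b / 2\<close> turns each term
        into a Cayley transform of \<open>exp (- s)\<close>, which has positive real part on the
        unit disc.\<close>
      have one: "1 = of_real (a / 2) + (of_real (b / 2) :: complex)"
        using a_add_b by (simp flip: of_real_add add_divide_distrib)
      have "1 + X + Y = (of_real (a / 2) + X) + (of_real (b / 2) + Y)" for X Y :: complex
        by (subst one) (simp only: ac_simps)
      moreover have "of_real (a / 2) + of_real a * (- ?u / (1 + ?u)) = of_real (a / 2) * ((1 - ?u) / (1 + ?u))"
        "of_real (b / 2) + of_real b * (?u / (1 - ?u)) = of_real (b / 2) * ((1 + ?u) / (1 - ?u))"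
        using nz[OF s] by (simp_all add: field_simps)
      ultimately show ?thesis unfolding h'_def by presburger
    qed
    ultimately show "(h has_field_derivative h' s) (at s)" by simp
    have Re_pos: "0 < Re ((1 + v) / (1 - v))" if "cmod v < 1" for v
    proof -
      have "1 - v \<noteq> 0" using that by auto
      moreover have "(Re v)\<^sup>2 + (Im v)\<^sup>2 < 1"
        using that cmod_power2[of v] power_strict_mono[of "cmod v" 1 2] by simp
      ultimately show ?thesis
        by (simp add: Re_divide' power2_eq_square algebra_simps)
    qed
    have "0 < Re ((1 + ?u) / (1 - ?u))" "0 < Re ((1 - ?u) / (1 + ?u))"
      using Re_pos[of ?u] Re_pos[of "- ?u"] small[OF s] by simp_all
    then show "0 < Re (h' s)"
      using a_pos b_pos unfolding h'_def plus_complex.sel times_complex.sel Re_complex_of_real Im_complex_of_real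
      by (simp only: mult_zero_left diff_zero) (intro add_pos_pos mult_pos_pos; simp)
  qed
  have eq: "Q (\<epsilon> * exp s) = \<epsilon> * exp (h s)" if "s \<in> H" for s :: complex
  proof -
    have "\<epsilon> / (\<epsilon> * exp s) = exp (- s)" using eps_pos by (simp add: exp_minus field_simps)
    then show ?thesis using nz[OF that] by (simp add: Q_eq h_def exp_add powr_def)
  qed
  fix z1 z2 assume z: "z1 \<in> exterior \<epsilon>" "z2 \<in> exterior \<epsilon>" "Q z1 = Q z2"
  define s where "s z = Ln (z / \<epsilon>)" for z :: complex
  have s: "s z \<in> H" "\<epsilon> * exp (s z) = z" if "z \<in> exterior \<epsilon>" for z
  proof -
    have z: "z \<noteq> 0" "\<epsilon> < cmod z" using exterior_nz[OF that] that by (auto simp: exterior_def)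
    then show "s z \<in> H" "\<epsilon> * exp (s z) = z" using eps_pos by (auto simp: s_def H_def norm_divide)
  qed
  have "exp (h (s z1)) = exp (h (s z2))"
    using z eq[OF s(1)] s(2) eps_pos by (metis mult_cancel_left of_real_eq_0_iff less_irrefl)
  then obtain k :: int where k: "h (s z1) = h (s z2) + of_int (2 * k) * pi * \<i>"
    unfolding exp_eq by auto
  \<comment> \<open>Equal values of \<open>Q\<close> determine \<open>h\<close> only modulo the
    period of \<open>exp\<close>. Since \<open>exp (- s)\<close> is periodic, shifting the second
    argument by the same amount absorbs the difference and stays in \<open>H\<close>.\<close>
  let ?t = "s z2 + of_int (2 * k) * pi * \<i>"
  have e: "exp (- ?t) = exp (- s z2)" "exp ?t = exp (s z2)"
    unfolding exp_eq by (rule exI[of _ "- k"], simp) (rule exI[of _ k], simp)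
  then have "h ?t = h (s z2) + of_int (2 * k) * pi * \<i>"
    unfolding h_def by (simp only: e) simp
  moreover have "?t \<in> H" using s(1)[OF z(2)] by (simp add: H_def)
  ultimately have "s z1 = ?t"
    using \<open>inj_on h H\<close> s(1)[OF z(1)] k by (metis inj_onD)
  then show "z1 = z2" using s(2)[OF z(1)] s(2)[OF z(2)] e(2) by metis
qed

section \<open>The map S and the image slit\<close>

lemma image_slit_eq_segment: "image_slit \<epsilon> = closed_segment (- 2 * of_real \<epsilon>) (2 * of_real \<epsilon>)"
  using eps_pos by (auto simp: image_slit_def closed_segment_same_Im closed_segment_eq_real_ivl)

lemma S_circle: "S (\<epsilon> * cis \<theta>) = of_real (2 * \<epsilon> * cos \<theta>)"
proof -
  have "1 / cis \<theta> = cis (- \<theta>)" by (simp add: divide_inverse del: cis_cnj)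
  then have "S (\<epsilon> * cis \<theta>) = \<epsilon> * (cis \<theta> + cis (- \<theta>))"
    using eps_pos by (simp add: S_eps_def S_map_def del: cis_cnj)
  then show ?thesis by (simp add: complex_eq_iff)
qed

text \<open>With \<open>cnj_S\<close> and \<open>cnj_Q\<close> this reduces all boundary
  computations to the closed upper half circle.\<close>

lemma circle_polar:
  assumes "cmod z = \<epsilon>" obtains \<theta> where "0 \<le> \<theta>" "\<theta> \<le> pi" "z = \<epsilon> * cis \<theta> \<or> z = cnj (\<epsilon> * cis \<theta>)"
proof -
  have z: "z = \<epsilon> * cis (Arg z)" using rcis_cmod_Arg[of z] assms by (simp add: rcis_def)
  show ?thesis
  proof (cases "0 \<le> Arg z")
    case True then show ?thesis using that[of "Arg z"] z Arg_le_pi[of z] by auto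
  next
    case False
    have "z = cnj (\<epsilon> * cis (- Arg z))" using z by (simp add: cis_cnj)
    then show ?thesis using that[of "- Arg z"] False mpi_less_Arg[of z] by auto
  qed
qed

lemma cnj_S: "S (cnj z) = cnj (S z)"
  by (simp add: S_eps_def S_map_def)

lemma cnj_Q: assumes "z \<in> cext" shows "Q (cnj z) = cnj (Q z)"
proof -
  have "cnj ((1 + \<epsilon> / z) powr of_real a) = cnj (1 + \<epsilon> / z) powr cnj (of_real a)"
    "cnj ((1 - \<epsilon> / z) powr of_real b) = cnj (1 - \<epsilon> / z) powr cnj (of_real b)"
    using Re_quot_le[OF assms] by (intro cnj_powr; force simp: abs_le_iff)+
  then show ?thesis by (simp add: Q_eq)
qed

lemma S_real_on_circle:
  assumes "z \<noteq> 0" "S z \<in> image_slit \<epsilon>" shows "cmod z = \<epsilon>"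
proof -
  obtain x where x: "S z = of_real x" "\<bar>x\<bar> \<le> 2 * \<epsilon>"
    using assms(2) by (auto simp: image_slit_def complex_eq_iff intro!: that[of "Re (S z)"])
  have "\<bar>x / (2 * \<epsilon>)\<bar> \<le> 1" using x eps_pos by simp
  then obtain \<theta> where "x / (2 * \<epsilon>) = cos \<theta>" by (metis abs_le_iff cos_arccos minus_le_iff)
  then have th: "x = 2 * \<epsilon> * cos \<theta>" using eps_pos by (simp add: field_simps)
  have "z + \<epsilon>\<^sup>2 / z = \<epsilon> * (cis \<theta> + cis (- \<theta>))"
    using x(1) unfolding th S_eq[OF assms(1)] by (simp add: complex_eq_iff)
  then have "z * z + \<epsilon>\<^sup>2 * (cis \<theta> * cis (- \<theta>)) = z * (\<epsilon> * (cis \<theta> + cis (- \<theta>)))"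
    using assms(1) by (simp add: cis_mult field_simps power2_eq_square)
  \<comment> \<open>The quadratic equation for z has a conjugate pair on the circle as its roots:
    their sum is the given real value and their product \<open>\<epsilon> ^ 2\<close>.\<close>
  then have "(z - \<epsilon> * cis \<theta>) * (z - \<epsilon> * cis (- \<theta>)) = 0"
    by (simp add: algebra_simps power2_eq_square)
  then have "z = \<epsilon> * cis \<theta> \<or> z = \<epsilon> * cis (- \<theta>)" by simp
  then show ?thesis using eps_pos by (auto simp: norm_mult simp del: cis_cnj)
qed

lemma S_circle_slit: "cmod z = \<epsilon> \<Longrightarrow> S z \<in> image_slit \<epsilon>"
proof (erule circle_polar)
  fix \<theta> assume "z = \<epsilon> * cis \<theta> \<or> z = cnj (\<epsilon> * cis \<theta>)"
  then have "S z = of_real (2 * \<epsilon> * cos \<theta>)"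
    using S_circle[of \<theta>] cnj_S[of "\<epsilon> * cis \<theta>"] by (metis complex_cnj_complex_of_real)
  moreover have "\<bar>2 * \<epsilon> * cos \<theta>\<bar> \<le> 2 * \<epsilon> * 1"
    unfolding abs_mult by (intro mult_mono) (use eps_pos in auto)
  ultimately show "S z \<in> image_slit \<epsilon>" by (auto simp: image_slit_def)
qed

lemma bij_S: "bij_betw S (exterior \<epsilon>) (- image_slit \<epsilon>)"
proof (rule bij_betw_imageI)
  show "inj_on S (exterior \<epsilon>)"
  proof (rule inj_onI)
    fix z w assume *: "z \<in> exterior \<epsilon>" "w \<in> exterior \<epsilon>" "S z = S w"
    then have nz: "z \<noteq> 0" "w \<noteq> 0" using exterior_nz by auto
    \<comment> \<open>Two points with the same value coincide or have product
      \<open>\<epsilon> ^ 2\<close>; the latter is impossible for two exterior points.\<close>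
    have "(z - w) * (z * w - \<epsilon>\<^sup>2) = 0"
      using *(3) nz by (simp add: S_eq field_simps power2_eq_square)
    moreover have "z * w \<noteq> \<epsilon>\<^sup>2"
    proof
      assume "z * w = \<epsilon>\<^sup>2"
      then have "cmod z * cmod w = \<epsilon>\<^sup>2" by (metis norm_mult norm_of_real abs_of_nonneg zero_le_power2 of_real_power)
      moreover have "\<epsilon> * \<epsilon> < cmod z * cmod w"
        using * eps_pos by (intro mult_strict_mono) (auto simp: exterior_def)
      ultimately show False by (simp add: power2_eq_square)
    qed
    ultimately show "z = w" by simp
  qed
  show "S ` exterior \<epsilon> = - image_slit \<epsilon>"
  proof (intro equalityI subsetI)
    fix \<zeta> assume "\<zeta> \<in> S ` exterior \<epsilon>"
    then show "\<zeta> \<in> - image_slit \<epsilon>"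
      using S_real_on_circle exterior_nz by (force simp: exterior_def)
  next
    fix \<zeta> assume \<zeta>: "\<zeta> \<in> - image_slit \<epsilon>"
    \<comment> \<open>\<open>z\<close> and \<open>z'\<close> are the roots of the quadratic equation
      for a preimage. Their moduli multiply to \<open>\<epsilon> ^ 2\<close> and neither lies on the
      circle, so one of them is exterior, whichever square root was chosen.\<close>
    define r where "r = csqrt (\<zeta>\<^sup>2 - 4 * \<epsilon>\<^sup>2)"
    define z where "z = (\<zeta> + r) / 2"
    define z' where "z' = (\<zeta> - r) / 2"
    have "z * z' = (\<zeta>\<^sup>2 - r\<^sup>2) / 4"
      by (simp add: z_def z'_def power2_eq_square field_simps)
    then have prod: "z * z' = \<epsilon>\<^sup>2" by (simp add: r_def)
    have sum: "z + z' = \<zeta>" by (simp add: z_def z'_def field_simps)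
    have nz: "z \<noteq> 0" "z' \<noteq> 0" using prod eps_pos by auto
    have div: "\<epsilon>\<^sup>2 / z = z'" "\<epsilon>\<^sup>2 / z' = z"
      using prod nz by (simp_all add: nonzero_divide_eq_eq mult.commute)
    have S: "S z = \<zeta>" "S z' = \<zeta>"
      using nz sum div by (simp_all add: S_eq add.commute)
    have "cmod z \<noteq> \<epsilon>" using S_circle_slit S(1) \<zeta> by auto
    moreover have "cmod z * cmod z' = \<epsilon> * \<epsilon>"
      using arg_cong[OF prod, of cmod] eps_pos by (simp add: norm_mult norm_power power2_eq_square)
    ultimately have "\<epsilon> < cmod z \<or> \<epsilon> < cmod z'"
      using mult_mono[of "cmod z" \<epsilon> "cmod z'" \<epsilon>] mult_strict_mono[of "cmod z" \<epsilon> "cmod z'" \<epsilon>]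
        mult_less_le_imp_less[of "cmod z" \<epsilon> "cmod z'" \<epsilon>] nz eps_pos by fastforce
    then show "\<zeta> \<in> S ` exterior \<epsilon>" using S unfolding exterior_def by (metis (mono_tags, lifting) image_eqI mem_Collect_eq)
  qed
qed


section \<open>The critical point and the slit length\<close>

definition "\<mu> = 2 * \<epsilon> * (real n - 2 * real m) / real n"

lemma mu_bounds: "- 2 * \<epsilon> < \<mu>" "\<mu> < 2 * \<epsilon>"
proof -
  have "- real n < real n - 2 * real m" "real n - 2 * real m < real n"
    using m_pos m_less by auto
  then have "2 * \<epsilon> * (- real n) < 2 * \<epsilon> * (real n - 2 * real m)"
    "2 * \<epsilon> * (real n - 2 * real m) < 2 * \<epsilon> * real n"
    using eps_pos by (intro mult_strict_left_mono; simp)+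
  then show "- 2 * \<epsilon> < \<mu>" "\<mu> < 2 * \<epsilon>"
    using m_less by (simp_all add: \<mu>_def field_simps)
qed

text \<open>This is \<open>- P' / n\<close> in factored form. If \<open>n - m\<close> or
  \<open>m\<close> equals 1, the corresponding power is 1 and that endpoint is not a zero.\<close>

definition "F \<zeta> = - ((\<zeta> + 2 * of_real \<epsilon>) ^ (n - m - 1) * (\<zeta> - of_real \<mu>) * (\<zeta> - 2 * of_real \<epsilon>) ^ (m - 1))"
  for \<zeta> :: complex

lemma power_pred: "0 < k \<Longrightarrow> x ^ k = x * x ^ (k - 1)"
  for x :: "'b::monoid_mult"
  by (cases k) auto

lemma P_deriv: "(P has_field_derivative - of_nat n * F \<zeta>) (at \<zeta>)"
proof -
  let ?u = "\<zeta> + 2 * complex_of_real \<epsilon>" and ?v = "\<zeta> - 2 * complex_of_real \<epsilon>"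
  have "(P has_field_derivative
      of_nat (n - m) * ?u ^ (n - m - 1) * ?v ^ m + ?u ^ (n - m) * (of_nat m * ?v ^ (m - 1))) (at \<zeta>)"
    unfolding P_def by (auto intro!: derivative_eq_intros)
  also have "?v ^ m = ?v * ?v ^ (m - 1)" by (rule power_pred[OF m_pos])
  also have "?u ^ (n - m) = ?u * ?u ^ (n - m - 1)" by (rule power_pred) (use m_less in simp)
  also have "of_nat (n - m) * ?u ^ (n - m - 1) * (?v * ?v ^ (m - 1))
      + ?u * ?u ^ (n - m - 1) * (of_nat m * ?v ^ (m - 1))
    = ?u ^ (n - m - 1) * ?v ^ (m - 1) * (of_nat (n - m) * ?v + of_nat m * ?u)"
    by (simp add: algebra_simps)
  \<comment> \<open>The linear factor common to both terms of the product rule. Its root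
    \<open>2 * \<epsilon> * (n - 2 * m) / n\<close> is the origin of \<open>\<mu>\<close>, and its
    leading coefficient n is the one that \<open>F\<close> divides out.\<close>
  also have "of_nat (n - m) * ?v + of_nat m * ?u = of_nat n * (\<zeta> - of_real \<mu>)"
    using m_less by (simp add: \<mu>_def of_nat_diff field_simps)
  also have "?u ^ (n - m - 1) * ?v ^ (m - 1) * (of_nat n * (\<zeta> - of_real \<mu>)) = - of_nat n * F \<zeta>"
    by (simp add: F_def)
  finally show ?thesis .
qed

text \<open>The modulus of \<open>P\<close> on the image slit, with the second factor reversed so
  that both are nonnegative there; maxima can then be found by real calculus.\<close>

definition "p x = (2 * \<epsilon> + x) ^ (n - m) * (2 * \<epsilon> - x) ^ m" for x :: real

lemma norm_P: "\<bar>x\<bar> \<le> 2 * \<epsilon> \<Longrightarrow> cmod (P (of_real x)) = p x"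
proof -
  assume x: "\<bar>x\<bar> \<le> 2 * \<epsilon>"
  have "cmod (of_real x + 2 * of_real \<epsilon>) = \<bar>x + 2 * \<epsilon>\<bar>" "cmod (of_real x - 2 * of_real \<epsilon>) = \<bar>x - 2 * \<epsilon>\<bar>"
    by (metis norm_of_real of_real_add of_real_diff of_real_mult of_real_numeral)+
  then show ?thesis using x by (simp add: P_def p_def norm_mult norm_power add.commute)
qed

lemma p_ends: "p (- 2 * \<epsilon>) = 0" "p (2 * \<epsilon>) = 0" and continuous_p: "continuous_on T p"
  using m_pos m_less by (auto simp: p_def intro!: continuous_intros)

lemma p_pos: "- 2 * \<epsilon> < x \<Longrightarrow> x < 2 * \<epsilon> \<Longrightarrow> 0 < p x"
  by (simp add: p_def)

lemma p_deriv_zero: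
  assumes "(p has_real_derivative 0) (at x)" "\<bar>x\<bar> < 2 * \<epsilon>" shows "x = \<mu>"
proof -
  let ?u = "2 * \<epsilon> + x" and ?v = "2 * \<epsilon> - x"
  have "(p has_real_derivative
      of_nat (n - m) * ?u ^ (n - m - 1) * ?v ^ m - ?u ^ (n - m) * (of_nat m * ?v ^ (m - 1))) (at x)"
    unfolding p_def by (auto intro!: derivative_eq_intros)
  with assms(1) have "of_nat (n - m) * ?u ^ (n - m - 1) * ?v ^ m - ?u ^ (n - m) * (of_nat m * ?v ^ (m - 1)) = 0"
    using DERIV_unique by blast
  also have "?v ^ m = ?v * ?v ^ (m - 1)" by (rule power_pred[OF m_pos])
  also have "?u ^ (n - m) = ?u * ?u ^ (n - m - 1)" by (rule power_pred) (use m_less in simp)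
  also have "of_nat (n - m) * ?u ^ (n - m - 1) * (?v * ?v ^ (m - 1))
      - ?u * ?u ^ (n - m - 1) * (of_nat m * ?v ^ (m - 1))
    = ?u ^ (n - m - 1) * ?v ^ (m - 1) * (of_nat (n - m) * ?v - of_nat m * ?u)"
    by (simp add: algebra_simps)
  finally have "of_nat (n - m) * ?v - of_nat m * ?u = 0" using assms(2) by auto
  then show ?thesis using m_less by (simp add: \<mu>_def of_nat_diff field_simps)
qed

text \<open>A maximum over the closed interval is positive, hence not at an end, where
  \<open>p\<close> vanishes; an interior maximum is critical, and \<open>\<mu>\<close> is the only
  critical point. Uniqueness is what puts both tips over the same point.\<close>

lemma p_less: assumes "\<bar>x\<bar> \<le> 2 * \<epsilon>" "x \<noteq> \<mu>" shows "p x < p \<mu>"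
proof -
  have "\<exists>y\<in>{- 2 * \<epsilon>..2 * \<epsilon>}. \<forall>x\<in>{- 2 * \<epsilon>..2 * \<epsilon>}. p x \<le> p y"
    by (rule continuous_attains_sup) (use eps_pos continuous_p in auto)
  then obtain y where "y \<in> {- 2 * \<epsilon>..2 * \<epsilon>}" "\<And>x. x \<in> {- 2 * \<epsilon>..2 * \<epsilon>} \<Longrightarrow> p x \<le> p y"
    by blast
  then have y: "\<bar>y\<bar> \<le> 2 * \<epsilon>" "\<And>x. \<bar>x\<bar> \<le> 2 * \<epsilon> \<Longrightarrow> p x \<le> p y"
    by (simp_all add: abs_le_iff minus_le_iff)
  have max: "z = \<mu>" if z: "\<bar>z\<bar> \<le> 2 * \<epsilon>" "p z = p y" for z
  proof -
    have "0 < p z" using p_pos[of 0] y(2)[of 0] z eps_pos by simp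
    then have "\<bar>z\<bar> < 2 * \<epsilon>"
      using z(1) p_ends by (smt (verit) mult_minus_left)
    moreover have "(p has_real_derivative 0) (at z)"
    proof -
      have d: "\<exists>D. (p has_real_derivative D) (at z)"
        unfolding p_def by (rule exI) (rule derivative_eq_intros refl)+
      then obtain D where D: "(p has_real_derivative D) (at z)" ..
      have "D = 0"
        by (rule DERIV_local_max[OF D, of "2 * \<epsilon> - \<bar>z\<bar>"])
          (use \<open>\<bar>z\<bar> < 2 * \<epsilon>\<close> y(2) z(2) in auto)
      with D show ?thesis by simp
    qed
    ultimately show ?thesis using p_deriv_zero by blast
  qed
  have "y = \<mu>" using max y(1) by blast
  then show ?thesis using max[OF assms(1)] y(2)[OF assms(1)] assms(2) by fastforce
qed

text \<open>On the circle \<open>cmod (Q z) ^ n\<close> equals \<open>p (Re (S z))\<close>, so the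
  largest radius that \<open>Q\<close> reaches is the n-th root of the maximum of
  \<open>p\<close>.\<close>

definition "l = root n (p \<mu>)"

lemma l_pos: "0 < l" and l_power: "l ^ n = p \<mu>"
  using m_less p_pos[OF mu_bounds] by (auto simp: l_def)

section \<open>Boundary values of Q on the circle\<close>

lemma Q_upper_direction:
  assumes "0 \<le> \<theta>" "\<theta> \<le> pi"
  shows "Q (\<epsilon> * cis \<theta>) = of_real (cmod (Q (\<epsilon> * cis \<theta>))) * cis \<alpha>"
proof (cases "\<theta> = 0 \<or> \<theta> = pi")
  case True
  then have "Q (\<epsilon> * cis \<theta>) = 0"
    by (subst Q_zero_iff) (use eps_pos in \<open>auto simp: cext_def norm_mult\<close>)
  then show ?thesis by simp
next
  case False
  with assms have th: "0 < \<theta>" "\<theta> < pi" by auto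
  let ?c = "2 * cos (\<theta> / 2)" and ?s = "2 * sin (\<theta> / 2)"
  have cs: "0 < ?c" "0 < ?s" using th by (auto intro!: cos_gt_zero sin_gt_zero)
  have inv: "\<epsilon> / (\<epsilon> * cis \<theta>) = cis (- \<theta>)"
    using eps_pos by (simp add: divide_inverse del: cis_cnj)
  \<comment> \<open>Half-angle factorisation: the bases become \<open>2 * cos (\<theta> / 2)\<close>
    and \<open>2 * sin (\<theta> / 2)\<close> times unit factors of angles
    \<open>- (\<theta> / 2)\<close> and \<open>(pi - \<theta>) / 2\<close>, both inside the
    principal range.\<close>
  have half: "cis (- \<theta>) = cis (- (\<theta> / 2)) * cis (- (\<theta> / 2))" "1 = cis (\<theta> / 2) * cis (- (\<theta> / 2))"
    by (simp_all add: cis_mult del: cis_cnj)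
  have "1 + cis (- \<theta>) = (cis (\<theta> / 2) + cis (- (\<theta> / 2))) * cis (- (\<theta> / 2))"
    by (simp only: half ring_distribs)
  also have "cis (\<theta> / 2) + cis (- (\<theta> / 2)) = of_real ?c" by (simp add: complex_eq_iff)
  finally have e1: "1 + cis (- \<theta>) = rcis ?c (- (\<theta> / 2))" by (simp only: rcis_def)
  have "1 - cis (- \<theta>) = (cis (\<theta> / 2) - cis (- (\<theta> / 2))) * cis (- (\<theta> / 2))"
    by (simp only: half ring_distribs left_diff_distrib)
  also have "cis (\<theta> / 2) - cis (- (\<theta> / 2)) = of_real ?s * cis (pi / 2)" by (simp add: complex_eq_iff)
  finally have e2: "1 - cis (- \<theta>) = rcis ?s ((pi - \<theta>) / 2)"
    by (simp add: rcis_def cis_mult mult.assoc diff_divide_distrib del: cis_cnj cis_pi_half)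
  have A: "Arg (1 + cis (- \<theta>)) = - (\<theta> / 2)" "Arg (1 - cis (- \<theta>)) = (pi - \<theta>) / 2"
    using th by (intro Arg_unique'[OF cs(1) _ e1] Arg_unique'[OF cs(2) _ e2]; simp)+
  have nz: "1 + cis (- \<theta>) \<noteq> 0" "1 - cis (- \<theta>) \<noteq> 0"
    unfolding e1 e2 using cs by (auto simp: rcis_def simp del: cis_cnj)
  define R where "R = \<epsilon> * (cmod (1 + cis (- \<theta>)) powr a) * (cmod (1 - cis (- \<theta>)) powr b)"
  have "Q (\<epsilon> * cis \<theta>) = of_real R * (cis \<theta> * cis (a * - (\<theta> / 2)) * cis (b * ((pi - \<theta>) / 2)))"
    unfolding Q_eq inv powr_of_real_polar[OF nz(1)] powr_of_real_polar[OF nz(2)] A R_def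
    by (simp del: cis_cnj)
  also have "cis \<theta> * cis (a * - (\<theta> / 2)) * cis (b * ((pi - \<theta>) / 2)) = cis \<alpha>"
  proof -
    \<comment> \<open>The angle \<theta> cancels because \<open>a + b = 2\<close>, leaving
      \<open>b * pi / 2\<close>, which is the slit angle.\<close>
    have "\<theta> + a * - (\<theta> / 2) + b * ((pi - \<theta>) / 2) = \<theta> - (a + b) * (\<theta> / 2) + b * pi / 2"
      by (simp add: field_simps)
    also have "\<dots> = \<alpha>" unfolding a_add_b by (simp add: b_def)
    finally show ?thesis by (simp add: cis_mult del: cis_cnj)
  qed
  finally have eq: "Q (\<epsilon> * cis \<theta>) = of_real R * cis \<alpha>" .
  moreover have "0 \<le> R" using eps_pos by (simp add: R_def)
  ultimately have "cmod (Q (\<epsilon> * cis \<theta>)) = R" by (simp add: norm_mult)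
  then show ?thesis using eq by simp
qed

lemma norm_Q_circle:
  assumes "cmod z = \<epsilon>" shows "cmod (Q z) ^ n = p (Re (S z))"
proof -
  have "z \<noteq> 0" using assms eps_pos by auto
  have S: "S z = of_real (Re (S z))" "\<bar>Re (S z)\<bar> \<le> 2 * \<epsilon>"
    using S_circle_slit[OF assms] by (auto simp: image_slit_def complex_eq_iff)
  have "cmod (Q z) ^ n = cmod (P (S z))"
    using Q_power[OF \<open>z \<noteq> 0\<close>] by (simp flip: norm_power)
  then show ?thesis using norm_P[OF S(2)] S(1) by simp
qed

lemma norm_Q_le: assumes "cmod z = \<epsilon>" shows "cmod (Q z) \<le> l"
  and "cmod (Q z) = l \<Longrightarrow> S z = of_real \<mu>"
proof -
  have S: "S z = of_real (Re (S z))" "\<bar>Re (S z)\<bar> \<le> 2 * \<epsilon>"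
    using S_circle_slit[OF assms] by (auto simp: image_slit_def complex_eq_iff)
  have "cmod (Q z) ^ n \<le> l ^ n"
    unfolding norm_Q_circle[OF assms] l_power using p_less[OF S(2)] by fastforce
  then show "cmod (Q z) \<le> l"
    using l_pos m_less by (subst (asm) power_mono_iff) auto
  assume "cmod (Q z) = l"
  then have "p (Re (S z)) = p \<mu>" using norm_Q_circle[OF assms] l_power by simp
  then have "Re (S z) = \<mu>" using p_less[OF S(2)] by fastforce
  then show "S z = of_real \<mu>" using S(1) by simp
qed

lemma circle_cext: "cmod z = \<epsilon> \<Longrightarrow> z \<in> cext" by (simp add: cext_def)

lemma cext_eq: "cext = exterior \<epsilon> \<union> {z. cmod z = \<epsilon>}" by (auto simp: cext_def exterior_def)

lemma cnj_two_slits: "w \<in> two_slits \<alpha> l \<Longrightarrow> cnj w \<in> two_slits \<alpha> l"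
  unfolding two_slits_def by (auto simp: cis_cnj)

lemma Q_circle: "Q ` {z. cmod z = \<epsilon>} = two_slits \<alpha> l"
proof (intro equalityI subsetI)
  fix w assume "w \<in> Q ` {z. cmod z = \<epsilon>}"
  then obtain z where z: "cmod z = \<epsilon>" "w = Q z" by auto
  obtain \<theta> where th: "0 \<le> \<theta>" "\<theta> \<le> pi" "z = \<epsilon> * cis \<theta> \<or> z = cnj (\<epsilon> * cis \<theta>)"
    using circle_polar[OF z(1)] by blast
  have c: "cmod (\<epsilon> * cis \<theta>) = \<epsilon>" using eps_pos by (simp add: norm_mult)
  have "Q (\<epsilon> * cis \<theta>) \<in> two_slits \<alpha> l"
    unfolding two_slits_def using Q_upper_direction[OF th(1,2)] norm_Q_le(1)[OF c] norm_ge_zero by blast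
  then show "w \<in> two_slits \<alpha> l"
    using th(3) z(2) cnj_Q[OF circle_cext[OF c]] cnj_two_slits by metis
next
  fix w assume "w \<in> two_slits \<alpha> l"
  then obtain t where t: "0 \<le> t" "t \<le> l" "w = of_real t * cis \<alpha> \<or> w = cnj (of_real t * cis \<alpha>)"
    by (auto simp: two_slits_def cis_cnj)
  \<comment> \<open>All radii up to \<open>l\<close> already occur over the stretch from the left
    end, where \<open>p\<close> is 0, to \<open>\<mu>\<close>, where it is \<open>l ^ n\<close>. The
    point x found here is the \<open>S\<close>-value of a circle point.\<close>
  have "\<exists>x\<ge>- 2 * \<epsilon>. x \<le> \<mu> \<and> p x = t ^ n"
    by (rule IVT') (use t l_power power_mono[OF t(2) t(1), of n] mu_bounds p_ends continuous_p in auto)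
  then obtain x where x: "- 2 * \<epsilon> \<le> x" "x \<le> \<mu>" "p x = t ^ n" by blast
  define \<theta> where "\<theta> = arccos (x / (2 * \<epsilon>))"
  have "- 1 \<le> x / (2 * \<epsilon>)" "x / (2 * \<epsilon>) \<le> 1"
    using x(1,2) mu_bounds eps_pos by (auto simp: field_simps)
  then have th: "0 \<le> \<theta>" "\<theta> \<le> pi" "cos \<theta> = x / (2 * \<epsilon>)"
    by (auto simp: \<theta>_def arccos_lbound arccos_ubound)
  have c: "cmod (\<epsilon> * cis \<theta>) = \<epsilon>" using eps_pos by (simp add: norm_mult)
  have "cmod (Q (\<epsilon> * cis \<theta>)) ^ n = t ^ n"
    using norm_Q_circle[OF c] x(3) th(3) eps_pos by (simp add: S_circle)
  then have "cmod (Q (\<epsilon> * cis \<theta>)) = t"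
    using t(1) m_less by (metis norm_ge_zero power_eq_imp_eq_base gr_implies_not0 not_gr0)
  then have "Q (\<epsilon> * cis \<theta>) = of_real t * cis \<alpha>" using Q_upper_direction[OF th(1,2)] by simp
  then have "w = Q (\<epsilon> * cis \<theta>) \<or> w = Q (cnj (\<epsilon> * cis \<theta>))"
    using t(3) cnj_Q[OF circle_cext[OF c]] by metis
  moreover have "cmod (cnj (\<epsilon> * cis \<theta>)) = \<epsilon>" using c by (simp only: complex_mod_cnj)
  ultimately show "w \<in> Q ` {z. cmod z = \<epsilon>}" using c by blast
qed

end

section \<open>Topology of slits and sectors\<close>

lemma zero_in_two_slits: "0 \<le> l \<Longrightarrow> 0 \<in> two_slits \<alpha> l"
  by (auto simp: two_slits_def intro!: exI[of _ 0])

lemma two_slits_eq_segments: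
  assumes "0 \<le> l"
  shows "two_slits \<alpha> l = closed_segment 0 (of_real l * cis \<alpha>) \<union> closed_segment 0 (of_real l * cis (- \<alpha>))"
proof -
  have "{complex_of_real t * cis \<beta> | t. 0 \<le> t \<and> t \<le> l} = closed_segment 0 (of_real l * cis \<beta>)" for \<beta>
  proof (intro equalityI subsetI)
    fix w assume "w \<in> {of_real t * cis \<beta> | t. 0 \<le> t \<and> t \<le> l}"
    then obtain t where t: "0 \<le> t" "t \<le> l" "w = of_real t * cis \<beta>" by auto
    show "w \<in> closed_segment 0 (of_real l * cis \<beta>)"
    proof (cases "l = 0")
      case False
      then show ?thesis using t assms
        by (auto simp: in_segment scaleR_conv_of_real intro!: exI[of _ "t / l"])
    qed (use t in auto)
  next
    fix w assume "w \<in> closed_segment 0 (of_real l * cis \<beta>)"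
    then obtain u where u: "0 \<le> u" "u \<le> 1" "w = of_real (u * l) * cis \<beta>"
      by (auto simp: in_segment scaleR_conv_of_real)
    then show "w \<in> {of_real t * cis \<beta> | t. 0 \<le> t \<and> t \<le> l}"
      using assms mult_left_le_one_le[of l u] by (intro CollectI exI[of _ "u * l"]) simp
  qed
  then show ?thesis unfolding two_slits_def by blast
qed

lemma negligible_closed_segment: "negligible (closed_segment a (b :: complex))"
  by (subst negligible_convex_interior) (auto simp: interior_closed_segment_ge2)

lemma compact_two_slits: "0 \<le> l \<Longrightarrow> compact (two_slits \<alpha> l)"
  and negligible_two_slits: "0 \<le> l \<Longrightarrow> negligible (two_slits \<alpha> l)"
  by (simp_all add: two_slits_eq_segments compact_Un negligible_Un negligible_closed_segment)

lemma norm_two_slits: "w \<in> two_slits \<alpha> l \<Longrightarrow> cmod w \<le> l"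
  by (auto simp: two_slits_def norm_mult simp del: cis_cnj)

text \<open>The slits are star-shaped about the origin, so moving outward along a ray never enters
  them. This makes radial motion a connecting path in the complement.\<close>

lemma two_slits_ray:
  assumes "of_real s * w \<in> two_slits \<alpha> l" "1 \<le> s" shows "w \<in> two_slits \<alpha> l"
proof -
  obtain t \<beta> where t: "0 \<le> t" "t \<le> l" "of_real s * w = of_real t * cis \<beta>" "\<beta> = \<alpha> \<or> \<beta> = - \<alpha>"
    using assms(1) unfolding two_slits_def by blast
  then have "w = of_real (t / s) * cis \<beta>" using assms(2) by (simp add: field_simps)
  moreover have "t / s \<le> t / 1" by (rule divide_left_mono) (use assms(2) t in auto)
  ultimately show ?thesis using t assms(2) unfolding two_slits_def
    by (smt (verit, best) Un_iff divide_nonneg_nonneg div_by_1 mem_Collect_eq)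
qed

lemma connected_ball_minus_two_slits:
  assumes "0 \<le> l" "l < R"
  shows "connected (ball 0 R - two_slits \<alpha> l)"
proof (rule connected_if_connected_to)
  \<comment> \<open>An annulus beyond the slits serves as the connected core, to which every other
    point is joined radially.\<close>
  define C where "C = {x :: complex. l < norm (x - 0) \<and> norm (x - 0) < R}"
  show "connected C" unfolding C_def by (rule connected_annulus) simp
  have "cmod (of_real ((l + R) / 2)) = (l + R) / 2" using assms by (simp only: norm_of_real) simp
  then have "of_real ((l + R) / 2) \<in> C" unfolding C_def using assms by simp
  then show "C \<noteq> {}" by blast
  show "C \<subseteq> ball 0 R - two_slits \<alpha> l" using norm_two_slits by (fastforce simp: C_def)
  fix w assume w: "w \<in> ball 0 R - two_slits \<alpha> l"
  then have w0: "w \<noteq> 0" using zero_in_two_slits[OF assms(1)] by auto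
  \<comment> \<open>Stretching factor that takes w out to the mean radius
    \<open>(l + R) / 2\<close>, or leaves it in place if it is already at least that far
    out.\<close>
  define s where "s = max 1 ((l + R) / 2 / cmod w)"
  have s: "1 \<le> s" "l < s * cmod w" "s * cmod w < R"
    using assms w w0 by (auto simp: s_def field_simps max_def)
  let ?T = "(\<lambda>t. of_real t * w) ` {1..s}"
  have "connected ?T" by (intro connected_continuous_image continuous_intros) auto
  moreover have "w \<in> ?T" using s(1) by (auto intro!: image_eqI[of _ _ 1])
  moreover have "?T \<subseteq> ball 0 R - two_slits \<alpha> l"
  proof
    fix x assume "x \<in> ?T"
    then obtain t where t: "1 \<le> t" "t \<le> s" "x = of_real t * w" by auto
    have "t * cmod w \<le> s * cmod w" using t by (intro mult_right_mono) auto
    then have "x \<in> ball 0 R" using s(3) t by (simp add: norm_mult)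
    then show "x \<in> ball 0 R - two_slits \<alpha> l" using two_slits_ray[of t w] t w by auto
  qed
  moreover have "of_real s * w \<in> ?T \<inter> C" using s by (auto simp: C_def norm_mult)
  ultimately show "\<exists>T. connected T \<and> w \<in> T \<and> T \<subseteq> ball 0 R - two_slits \<alpha> l \<and> T \<inter> C \<noteq> {}" by blast
qed

lemma connected_Compl_two_slits: assumes "0 \<le> l" shows "connected (- two_slits \<alpha> l)"
proof -
  have "- two_slits \<alpha> l = (\<Union>R\<in>{l+1..}. ball 0 R - two_slits \<alpha> l)"
  proof (intro equalityI subsetI)
    fix x assume "x \<in> - two_slits \<alpha> l"
    then show "x \<in> (\<Union>R\<in>{l+1..}. ball 0 R - two_slits \<alpha> l)"
      by (intro UN_I[of "max (l + 1) (cmod x + 1)"]) auto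
  qed auto
  moreover have "connected (\<Union>R\<in>{l+1..}. ball 0 R - two_slits \<alpha> l)"
  proof (rule connected_Union)
    fix T assume "T \<in> (\<lambda>R. ball 0 R - two_slits \<alpha> l) ` {l+1..}"
    then show "connected T" using connected_ball_minus_two_slits assms by auto
  next
    \<comment> \<open>A point just beyond the slits that all balls of radius at least
      \<open>l + 1\<close> share.\<close>
    have "cmod (of_real (l + 1/2)) = l + 1/2" using assms by (simp only: norm_of_real)
    then have "of_real (l + 1/2) \<in> ball 0 R - two_slits \<alpha> l" if "R \<in> {l+1..}" for R
      using that norm_two_slits[of "of_real (l + 1/2)" \<alpha> l] by auto
    then show "(\<Inter>R\<in>{l+1..}. ball 0 R - two_slits \<alpha> l) \<noteq> {}" by blast
  qed
  ultimately show ?thesis by simp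
qed

lemma connected_sector:
  assumes "\<And>w. w \<in> T \<longleftrightarrow> (\<exists>r \<theta>. 0 < r \<and> r < \<eta> \<and> \<theta> \<in> I \<and> w = rcis r \<theta>)" "connected I"
  shows "connected T"
proof -
  have "T = (\<lambda>(r, \<theta>). rcis r \<theta>) ` ({0<..<\<eta>} \<times> I)"
    by (rule set_eqI, subst assms(1)) (force simp: image_iff)
  moreover have "connected ((\<lambda>(r, \<theta>). rcis r \<theta>) ` ({0<..<\<eta>} \<times> I))"
    unfolding case_prod_unfold rcis_def cis_conv_exp
    by (intro connected_continuous_image continuous_intros connected_Times assms(2)) auto
  ultimately show ?thesis by simp
qed

lemma connected_right_sector:
  assumes "\<alpha> < pi" shows "connected (right_sector \<alpha> \<inter> ball 0 \<eta>)"
proof (rule connected_sector[where I = "{- \<alpha><..<\<alpha>}"])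
  fix w
  show "w \<in> right_sector \<alpha> \<inter> ball 0 \<eta> \<longleftrightarrow>
      (\<exists>r \<theta>. 0 < r \<and> r < \<eta> \<and> \<theta> \<in> {- \<alpha><..<\<alpha>} \<and> w = rcis r \<theta>)"
  proof
    assume "w \<in> right_sector \<alpha> \<inter> ball 0 \<eta>"
    then show "\<exists>r \<theta>. 0 < r \<and> r < \<eta> \<and> \<theta> \<in> {- \<alpha><..<\<alpha>} \<and> w = rcis r \<theta>"
      by (intro exI[of _ "cmod w"] exI[of _ "Arg w"]) (auto simp: right_sector_def rcis_cmod_Arg)
  next
    assume "\<exists>r \<theta>. 0 < r \<and> r < \<eta> \<and> \<theta> \<in> {- \<alpha><..<\<alpha>} \<and> w = rcis r \<theta>"
    then obtain r \<theta> where w: "0 < r" "r < \<eta>" "- \<alpha> < \<theta>" "\<theta> < \<alpha>" "w = rcis r \<theta>" by auto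
    then have "Arg w = \<theta>" using assms by (intro Arg_unique'[of r]) auto
    then show "w \<in> right_sector \<alpha> \<inter> ball 0 \<eta>" using w by (auto simp: right_sector_def)
  qed
qed auto

text \<open>The sector crosses the negative axis, where \<open>Arg\<close> jumps. Taking angles up
  to \<open>2 * pi - \<alpha>\<close> instead makes it the polar image of a product of
  intervals.\<close>

lemma connected_left_sector:
  assumes "0 < \<alpha>" shows "connected (left_sector \<alpha> \<inter> ball 0 \<eta>)"
proof (rule connected_sector[where I = "{\<alpha><..<2 * pi - \<alpha>}"])
  fix w
  show "w \<in> left_sector \<alpha> \<inter> ball 0 \<eta> \<longleftrightarrow>
      (\<exists>r \<theta>. 0 < r \<and> r < \<eta> \<and> \<theta> \<in> {\<alpha><..<2 * pi - \<alpha>} \<and> w = rcis r \<theta>)"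
  proof
    assume w: "w \<in> left_sector \<alpha> \<inter> ball 0 \<eta>"
    show "\<exists>r \<theta>. 0 < r \<and> r < \<eta> \<and> \<theta> \<in> {\<alpha><..<2 * pi - \<alpha>} \<and> w = rcis r \<theta>"
    proof (cases "0 < Arg w")
      case True
      then show ?thesis using w assms Arg_le_pi[of w] mpi_less_Arg[of w]
        by (intro exI[of _ "cmod w"] exI[of _ "Arg w"]) (auto simp: left_sector_def rcis_cmod_Arg)
    next
      case False
      have "rcis (cmod w) (Arg w + 2 * pi) = w"
        using rcis_cmod_Arg[of w] by (simp add: rcis_def flip: cis_mult)
      then show ?thesis using w False assms mpi_less_Arg[of w]
        by (intro exI[of _ "cmod w"] exI[of _ "Arg w + 2 * pi"]) (auto simp: left_sector_def)
    qed
  next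
    assume "\<exists>r \<theta>. 0 < r \<and> r < \<eta> \<and> \<theta> \<in> {\<alpha><..<2 * pi - \<alpha>} \<and> w = rcis r \<theta>"
    then obtain r \<theta> where w: "0 < r" "r < \<eta>" "\<alpha> < \<theta>" "\<theta> < 2 * pi - \<alpha>" "w = rcis r \<theta>" by auto
    have "Arg w = (if \<theta> \<le> pi then \<theta> else \<theta> - 2 * pi)"
    proof (rule Arg_unique'[OF w(1)])
      show "w = rcis r (if \<theta> \<le> pi then \<theta> else \<theta> - 2 * pi)"
        using w(5) by (simp add: rcis_def flip: cis_divide)
    qed (use w assms in auto)
    then show "w \<in> left_sector \<alpha> \<inter> ball 0 \<eta>" using w assms by (auto simp: left_sector_def)
  qed
qed auto

lemma sectors_disjoint_two_slits:
  assumes "0 < \<alpha>" "\<alpha> < pi"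
  shows "left_sector \<alpha> \<inter> two_slits \<alpha> l = {}" "right_sector \<alpha> \<inter> two_slits \<alpha> l = {}"
proof -
  have "\<bar>Arg w\<bar> = \<alpha>" if w: "w \<in> two_slits \<alpha> l" "w \<noteq> 0" for w
  proof -
    obtain t \<beta> where t: "0 \<le> t" "w = rcis t \<beta>" "\<beta> = \<alpha> \<or> \<beta> = - \<alpha>"
      using w(1) unfolding two_slits_def rcis_def by blast
    then have "0 < t" using w(2) by (cases "t = 0") auto
    then have "Arg w = \<beta>" by (rule Arg_unique') (use t assms in auto)
    then show ?thesis using t(3) assms by auto
  qed
  then show "left_sector \<alpha> \<inter> two_slits \<alpha> l = {}" "right_sector \<alpha> \<inter> two_slits \<alpha> l = {}"
    by (auto simp: left_sector_def right_sector_def)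
qed

section \<open>The regluing map: range, boundary limits and pushforward\<close>

context slit_map
begin

text \<open>A slit point is a boundary value of \<open>Q\<close> on the circle.  Were it also attained at an
  interior point, then, \<open>Q\<close> being open, values near it would be attained twice.\<close>

lemma Q_notin_two_slits:
  assumes "z \<in> exterior \<epsilon>" shows "Q z \<notin> two_slits \<alpha> l"
proof
  assume "Q z \<in> two_slits \<alpha> l"
  then obtain z0 where z0: "cmod z0 = \<epsilon>" "Q z0 = Q z" using Q_circle by (metis (mono_tags, lifting) imageE mem_Collect_eq)
  \<comment> \<open>Half the distance from z to the circle: the ball about z stays exterior and is
    disjoint from the ball of the same radius about z0.\<close>
  define r where "r = (cmod z - \<epsilon>) / 2"
  have r: "0 < r" "ball z r \<subseteq> exterior \<epsilon>"
  proof -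
    show "0 < r" using assms by (simp add: r_def exterior_def)
    show "ball z r \<subseteq> exterior \<epsilon>"
    proof
      fix y assume "y \<in> ball z r"
      then have "cmod z - cmod y < r"
        using norm_triangle_ineq2[of z y] by (simp add: dist_norm)
      then show "y \<in> exterior \<epsilon>" using \<open>0 < r\<close> by (simp add: r_def exterior_def)
    qed
  qed
  have "open (Q ` ball z r)"
    by (rule open_mapping_thm3) (use holomorphic_on_subset[OF holomorphic_Q r(2)] inj_on_subset[OF inj_Q r(2)] in auto)
  moreover have "Q z0 \<in> Q ` ball z r" using z0 r by auto
  moreover have "continuous (at z0 within cext) Q"
    using continuous_Q circle_cext[OF z0(1)] by (simp add: continuous_on_eq_continuous_within)
  ultimately have "\<forall>\<^sub>F y in at z0 within cext. Q y \<in> Q ` ball z r"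
    unfolding continuous_within using topological_tendstoD by blast
  moreover have "\<forall>\<^sub>F y in at z0 within cext. y \<in> ball z0 r"
    using eventually_at_ball[OF r(1)] by (rule eventually_mono) simp
  ultimately have "\<forall>\<^sub>F y in at z0 within cext. Q y \<in> Q ` ball z r \<and> y \<in> ball z0 r"
    by (rule eventually_conj)
  then obtain d where d: "0 < d" "\<And>y. y \<in> cext \<Longrightarrow> y \<noteq> z0 \<Longrightarrow> dist y z0 < d \<Longrightarrow> Q y \<in> Q ` ball z r \<and> y \<in> ball z0 r"
    unfolding eventually_at by blast
  \<comment> \<open>A radial step outward from the circle gives an exterior point close to z0. Its
    value is also taken in the ball about z, so injectivity places it in both of the disjoint
    balls.\<close>
  define y where "y = z0 + of_real (d / 2 / \<epsilon>) * z0"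
  have y1: "dist y z0 = d / 2" 
    unfolding y_def dist_norm add_diff_cancel_left' norm_mult norm_of_real z0(1)
    using eps_pos d(1) by simp
  have "y = of_real (1 + d / 2 / \<epsilon>) * z0" by (simp add: y_def algebra_simps)
  then have "cmod y = \<bar>1 + d / 2 / \<epsilon>\<bar> * \<epsilon>" using z0(1) by (simp only: norm_mult norm_of_real)
  moreover have "0 < 1 + d / 2 / \<epsilon>" using eps_pos d(1) by (simp add: add_pos_pos)
  ultimately have y2: "cmod y = \<epsilon> + d / 2" using eps_pos by (simp add: distrib_right)
  then have ye: "y \<in> exterior \<epsilon>" using d(1) by (simp add: exterior_def)
  have "y \<noteq> z0" using y1 d(1) by auto
  then have Qy: "Q y \<in> Q ` ball z r" "y \<in> ball z0 r"
    using d(2)[of y] ye exterior_cext y1 d(1) by auto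
  then obtain y' where "y' \<in> ball z r" "Q y = Q y'" by blast
  then have "y \<in> ball z r" using inj_onD[OF inj_Q _ ye] r(2) by (metis subsetD)
  then have "dist z z0 < r + r" using Qy(2) dist_triangle[of z z0 y] by (simp add: dist_commute)
  moreover have "cmod z - \<epsilon> \<le> dist z z0" using norm_triangle_ineq2[of z z0] z0(1) by (simp add: dist_norm)
  ultimately show False by (simp add: r_def)
qed

lemma closed_Q_image: "closed T \<Longrightarrow> T \<subseteq> cext \<Longrightarrow> closed (Q ` T)"
  by (rule closed_image_coercive[where K = "3 * \<epsilon>"]) (use continuous_on_subset[OF continuous_Q] norm_Q_ge in auto)

lemma closed_S_image: "closed T \<Longrightarrow> T \<subseteq> cext \<Longrightarrow> closed (S ` T)"
  by (rule closed_image_coercive[where K = "\<epsilon>"]) (use continuous_on_subset[OF continuous_S] norm_S_ge in auto)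

lemma Q_exterior: "Q ` exterior \<epsilon> = - two_slits \<alpha> l"
proof -
  let ?U = "- two_slits \<alpha> l"
  have sub: "Q ` exterior \<epsilon> \<subseteq> ?U" using Q_notin_two_slits by auto
  have "open (Q ` exterior \<epsilon>)" by (rule open_mapping_thm3[OF holomorphic_Q open_exterior inj_Q])
  then have "openin (top_of_set ?U) (Q ` exterior \<epsilon>)" using sub by (simp add: open_subset)
  \<comment> \<open>The circle adds only slit points, so inside the complement of the slits the open
    and the closed exterior have the same image; this gives relative closedness.\<close>
  moreover have "Q ` exterior \<epsilon> = Q ` cext \<inter> ?U"
    using sub Q_circle by (auto simp: cext_eq image_Un)
  then have "closedin (top_of_set ?U) (Q ` exterior \<epsilon>)"
    using closed_Q_image[OF closed_cext] by (metis closedin_closed Int_commute subset_refl)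
  moreover have "of_real (2 * \<epsilon>) \<in> exterior \<epsilon>" using eps_pos by (simp add: exterior_def)
  moreover have "connected ?U" by (rule connected_Compl_two_slits) (use l_pos in simp)
  ultimately show ?thesis unfolding connected_clopen by (metis empty_iff image_eqI)
qed

lemma slits_eq: "slits m n \<epsilon> = two_slits \<alpha> l"
  by (simp add: slits_def Q_exterior)

abbreviation "\<Sigma> \<equiv> slits m n \<epsilon>"
abbreviation "f \<equiv> regluing_map m n \<epsilon>"
abbreviation "Qi \<equiv> inv_into (exterior \<epsilon>) Q"

lemma f_Q: "z \<in> exterior \<epsilon> \<Longrightarrow> f (Q z) = S z"
  by (simp add: regluing_map_def inv_into_f_f[OF inj_Q])

lemma Qi: "w \<notin> \<Sigma> \<Longrightarrow> Qi w \<in> exterior \<epsilon>" "w \<notin> \<Sigma> \<Longrightarrow> Q (Qi w) = w"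
  unfolding slits_def by (auto intro: inv_into_into f_inv_into_f)

lemma bij_Q: "bij_betw Q (exterior \<epsilon>) (- \<Sigma>)"
  by (simp add: bij_betw_def inj_Q slits_def)

lemma bij_f: "bij_betw f (- \<Sigma>) (- image_slit \<epsilon>)"
proof -
  have "bij_betw (S \<circ> Qi) (- \<Sigma>) (- image_slit \<epsilon>)"
    by (rule bij_betw_trans[OF bij_betw_inv_into[OF bij_Q] bij_S])
  then show ?thesis by (simp add: o_def regluing_map_def[abs_def])
qed

lemma holomorphic_f: "f holomorphic_on - \<Sigma>"
proof -
  have "Qi holomorphic_on - \<Sigma>"
    by (rule inv_into_holomorphic[OF holomorphic_Q open_exterior bij_Q])
  then have "(S \<circ> Qi) holomorphic_on - \<Sigma>"
    by (rule holomorphic_on_compose_gen[OF _ holomorphic_S]) (use Qi in auto)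
  then show ?thesis by (simp add: o_def regluing_map_def[abs_def])
qed

lemma f_power: assumes "w \<notin> \<Sigma>" shows "w ^ n = P (f w)"
  using Q_power[OF exterior_nz[OF Qi(1)[OF assms]]] Qi(2)[OF assms] by (simp add: regluing_map_def)

text \<open>The points of the closed exterior that \<open>S\<close> sends outside V form a closed
  set, so their \<open>Q\<close>-image is closed. It misses w0, since slit points have preimages
  only on the circle, and hence misses a whole ball. This replaces an explicit extension of
  \<open>f\<close> to the slit edges.\<close>

lemma eventually_f:
  assumes "open V" "\<And>z. cmod z = \<epsilon> \<Longrightarrow> Q z = w0 \<Longrightarrow> S z \<in> V" "w0 \<in> \<Sigma>"
  obtains \<eta> where "0 < \<eta>" "\<And>w. w \<in> ball w0 \<eta> \<Longrightarrow> w \<notin> \<Sigma> \<Longrightarrow> f w \<in> V"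
proof -
  define B where "B = {z \<in> cext. S z \<in> - V}"
  have "closed B" unfolding B_def
    using continuous_closed_preimage[OF continuous_S closed_cext, of "- V"] assms(1) by (auto simp: vimage_def Int_def)
  then have "closed (Q ` B)" by (rule closed_Q_image) (auto simp: B_def)
  moreover have "w0 \<notin> Q ` B"
    using assms(2,3) Q_notin_two_slits unfolding B_def cext_eq slits_eq by fastforce
  ultimately obtain \<eta> where "0 < \<eta>" "ball w0 \<eta> \<subseteq> - Q ` B"
    using open_contains_ball[of "- Q ` B"] by (meson ComplI open_Compl)
  moreover have "f w \<in> V" if "w \<in> ball w0 \<eta>" "w \<notin> \<Sigma>" "ball w0 \<eta> \<subseteq> - Q ` B" for w
  proof -
    have "Qi w \<notin> B" using that Qi(2)[OF that(2)] by (metis ComplD image_eqI subsetD)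
    then show ?thesis using Qi(1)[OF that(2)] exterior_cext by (auto simp: B_def regluing_map_def)
  qed
  ultimately show ?thesis using that by blast
qed

text \<open>Every circle point over a tip maximises \<open>cmod (Q z)\<close>, and the maximum is
  attained only over \<open>\<mu>\<close>.\<close>

lemma f_tip:
  assumes "w0 \<in> two_slits \<alpha> l" "cmod w0 = l"
  shows "(f \<longlongrightarrow> of_real \<mu>) (at w0 within - \<Sigma>)"
proof (rule topological_tendstoI)
  fix V assume V: "open V" "complex_of_real \<mu> \<in> V"
  obtain \<eta> where "0 < \<eta>" "\<And>w. w \<in> ball w0 \<eta> \<Longrightarrow> w \<notin> \<Sigma> \<Longrightarrow> f w \<in> V"
    using eventually_f[OF V(1), of w0] norm_Q_le(2) assms V(2) slits_eq by metis
  then show "\<forall>\<^sub>F w in at w0 within - \<Sigma>. f w \<in> V"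
    unfolding eventually_at by (intro exI[of _ \<eta>]) (auto simp: dist_commute)
qed

text \<open>Near the origin \<open>f\<close> takes values near the two zeros \<open>\<plusminus> 2 \<epsilon>\<close> of \<open>P\<close>; which of them is
  decided on the connected sector by a single real point.\<close>

lemma f_vertex:
  assumes Sec: "Sec \<inter> \<Sigma> = {}" "\<And>\<eta>. connected (Sec \<inter> ball 0 \<eta>)"
    and s: "s = 1 \<or> s = - 1"
    and near: "\<And>x. \<epsilon> < x \<Longrightarrow> Q (of_real (s * x)) \<in> Sec"
  shows "(f \<longlongrightarrow> of_real (s * (2 * \<epsilon>))) (at 0 within Sec)"
proof (rule tendstoI)
  fix e' :: real assume "0 < e'"
  \<comment> \<open>Capping the radius at \<epsilon> keeps the balls about
    \<open>2 * \<epsilon>\<close> and \<open>- 2 * \<epsilon>\<close> disjoint, so that a connected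
    set inside their union lies in one of them.\<close>
  define e where "e = min e' \<epsilon>"
  have e: "0 < e" "e \<le> e'" "e \<le> \<epsilon>" using \<open>0 < e'\<close> eps_pos by (auto simp: e_def)
  let ?v = "complex_of_real (s * (2 * \<epsilon>))"
  let ?V = "ball ?v e" and ?V' = "ball (- ?v) e"
  have disj: "?V \<inter> ?V' = {}"
  proof -
    have "dist ?v (- ?v) = 4 * \<epsilon>" using s eps_pos by (auto simp: dist_norm norm_mult)
    then show ?thesis using e eps_pos by (intro disjoint_ballI) linarith
  qed
  have S0: "S (of_real (s * \<epsilon>)) = ?v" "S (- of_real (s * \<epsilon>)) = - ?v"
    using s eps_pos by (auto simp: S_eps_def S_map_def)
  obtain \<eta> where \<eta>: "0 < \<eta>" "\<And>w. w \<in> ball 0 \<eta> \<Longrightarrow> w \<notin> \<Sigma> \<Longrightarrow> f w \<in> ?V \<union> ?V'"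
  proof (rule eventually_f[of "?V \<union> ?V'" 0])
    fix z assume z: "cmod z = \<epsilon>" "Q z = 0"
    then have "z = of_real (s * \<epsilon>) \<or> z = - of_real (s * \<epsilon>)"
      using Q_zero_iff[OF circle_cext[OF z(1)]] s by auto
    then show "S z \<in> ?V \<union> ?V'" using S0 e(1) by auto
  qed (use zero_in_two_slits l_pos slits_eq in auto)
  let ?C = "f ` (Sec \<inter> ball 0 \<eta>)"
  have "continuous_on (Sec \<inter> ball 0 \<eta>) f"
    using Sec(1) by (intro continuous_on_subset[OF holomorphic_on_imp_continuous_on[OF holomorphic_f]]) auto
  then have "connected ?C" by (intro connected_continuous_image Sec(2))
  moreover have "?C \<subseteq> ?V \<union> ?V'"
  proof (rule image_subsetI)
    fix w assume "w \<in> Sec \<inter> ball 0 \<eta>"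
    then show "f w \<in> ?V \<union> ?V'" using \<eta>(2) Sec(1) by blast
  qed
  \<comment> \<open>A real parameter just outside \<open>s * \<epsilon>\<close> has
    \<open>Q\<close>-value in the sector and \<open>S\<close>-value near the intended endpoint; it
    decides between the two balls.\<close>
  moreover obtain x where x: "\<epsilon> < x" "Q (of_real (s * x)) \<in> ball 0 \<eta>" "S (of_real (s * x)) \<in> ?V"
  proof -
    have in_c: "of_real (s * x) \<in> cext" if "\<epsilon> \<le> x" for x
      using that s eps_pos by (auto simp: cext_def)
    have Q0: "Q (of_real (s * \<epsilon>)) = 0" using Q_zero_iff[OF in_c] s by auto
    have "continuous_on {\<epsilon>..} (\<lambda>x. Q (of_real (s * x)))" "continuous_on {\<epsilon>..} (\<lambda>x. S (of_real (s * x)))"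
      by (rule continuous_on_compose2[OF continuous_Q] continuous_on_compose2[OF continuous_S];
          use in_c in \<open>auto intro!: continuous_intros\<close>)+
    then have "((\<lambda>x. Q (of_real (s * x))) \<longlongrightarrow> 0) (at \<epsilon> within {\<epsilon>..})"
      "((\<lambda>x. S (of_real (s * x))) \<longlongrightarrow> ?v) (at \<epsilon> within {\<epsilon>..})"
      unfolding continuous_on using Q0 S0(1) by force+
    then have "\<forall>\<^sub>F x in at \<epsilon> within {\<epsilon>..}. dist (Q (of_real (s * x))) 0 < \<eta>"
      "\<forall>\<^sub>F x in at \<epsilon> within {\<epsilon>..}. dist (S (of_real (s * x))) ?v < e"
      using \<eta>(1) e(1) by (auto dest: tendstoD)
    then have "\<forall>\<^sub>F x in at \<epsilon> within {\<epsilon>..}. dist (Q (of_real (s * x))) 0 < \<eta> \<and> dist (S (of_real (s * x))) ?v < e"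
      by (rule eventually_conj)
    then obtain d where d: "0 < d" "\<And>x. \<epsilon> \<le> x \<Longrightarrow> x \<noteq> \<epsilon> \<Longrightarrow> dist x \<epsilon> < d \<Longrightarrow>
        dist (Q (of_real (s * x))) 0 < \<eta> \<and> dist (S (of_real (s * x))) ?v < e"
      unfolding eventually_at by auto
    have "dist (\<epsilon> + d / 2) \<epsilon> < d" using d(1) by (simp add: dist_real_def)
    then show thesis using d(2)[of "\<epsilon> + d / 2"] d(1) that[of "\<epsilon> + d / 2"] by (auto simp: dist_commute)
  qed
  moreover have "of_real (s * x) \<in> exterior \<epsilon>" using x(1) s eps_pos by (auto simp: exterior_def)
  then have "S (of_real (s * x)) \<in> ?C" using f_Q near[OF x(1)] x(2) by (metis IntI image_eqI)
  ultimately have "?V' \<inter> ?C = {}"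
    using connectedD[of ?C ?V ?V'] disj x(3) by blast
  then have in_V: "f w \<in> ?V" if "w \<in> Sec \<inter> ball 0 \<eta>" for w using \<open>?C \<subseteq> ?V \<union> ?V'\<close> that by blast
  show "\<forall>\<^sub>F w in at 0 within Sec. dist (f w) ?v < e'"
    unfolding eventually_at
  proof (intro exI[of _ \<eta>] conjI ballI impI)
    fix w assume w: "w \<in> Sec" "w \<noteq> 0 \<and> dist w 0 < \<eta>"
    then have "f w \<in> ?V" by (intro in_V) auto
    then show "dist (f w) ?v < e'" using e(2) by (simp add: dist_commute)
  qed (rule \<eta>(1))
qed

text \<open>Supplies the sample points for the two sectors, whose bisectors are the positive and the
  negative half-axis.\<close>

lemma Q_real:
  assumes "\<epsilon> < x"
  shows "\<exists>r>0. Q (of_real x) = of_real r" "\<exists>r>0. Q (of_real (- x)) = - of_real r"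
proof -
  have q: "0 < 1 + \<epsilon> / x" "0 < 1 - \<epsilon> / x" using assms eps_pos by (auto intro!: add_pos_pos)
  have c: "1 + complex_of_real \<epsilon> / of_real x = of_real (1 + \<epsilon> / x)"
    "1 - complex_of_real \<epsilon> / of_real x = of_real (1 - \<epsilon> / x)" by simp_all
  have pr: "complex_of_real y powr of_real k = of_real (y powr k)" if "0 < y" for y k
    using that by (simp add: powr_of_real)
  have "Q (of_real x) = of_real (x * (1 + \<epsilon> / x) powr a * (1 - \<epsilon> / x) powr b)"
    unfolding Q_eq c pr[OF q(1)] pr[OF q(2)] by simp
  moreover have "Q (of_real (- x)) = - of_real (x * (1 - \<epsilon> / x) powr a * (1 + \<epsilon> / x) powr b)"
    unfolding Q_eq of_real_minus minus_divide_right[symmetric] diff_minus_eq_add add_uminus_conv_diff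
      c pr[OF q(1)] pr[OF q(2)] by simp
  moreover have "0 < x" using assms eps_pos by simp
  ultimately show "\<exists>r>0. Q (of_real x) = of_real r" "\<exists>r>0. Q (of_real (- x)) = - of_real r"
    using q by (metis mult_pos_pos powr_gt_zero less_irrefl)+
qed

lemma f_right_vertex: "(f \<longlongrightarrow> of_real (2 * \<epsilon>)) (at 0 within right_sector \<alpha>)"
  using f_vertex[of "right_sector \<alpha>" 1] sectors_disjoint_two_slits[OF alpha_bounds] connected_right_sector
    Q_real(1) alpha_bounds slits_eq by (fastforce simp: right_sector_def)

lemma f_left_vertex: "(f \<longlongrightarrow> of_real (- 2 * \<epsilon>)) (at 0 within left_sector \<alpha>)"
proof -
  have "Q (of_real (- 1 * x)) \<in> left_sector \<alpha>" if x: "\<epsilon> < x" for x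
  proof -
    obtain r where r: "0 < r" "Q (of_real (- x)) = - of_real r" using Q_real(2)[OF x] by blast
    then have "Arg (Q (of_real (- x))) = pi" by (intro Arg_unique'[of r]) (auto simp: rcis_def)
    then show ?thesis using r alpha_bounds by (auto simp: left_sector_def)
  qed
  then show ?thesis
    using f_vertex[of "left_sector \<alpha>" "- 1"] sectors_disjoint_two_slits(1)[OF alpha_bounds]
      connected_left_sector[OF alpha_bounds(1)] slits_eq by simp
qed


lemma pushforward_eq:
  assumes "\<zeta> \<notin> image_slit \<epsilon>"
  shows "F \<zeta> = pushforward (- \<Sigma>) f (\<lambda>w. - (w ^ (n - 1))) \<zeta>"
proof -
  let ?g = "inv_into (- \<Sigma>) f"
  have op: "open (- \<Sigma>)" "open (- image_slit \<epsilon>)"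
    unfolding slits_eq image_slit_eq_segment
    using compact_two_slits[THEN compact_imp_closed] l_pos by (simp_all add: open_Compl)
  have fg: "f (?g z) = z" "?g z \<notin> \<Sigma>" if "z \<notin> image_slit \<epsilon>" for z
    using that bij_f by (metis ComplI bij_betw_def f_inv_into_f, metis ComplD ComplI bij_betw_def inv_into_into)
  have "?g holomorphic_on - image_slit \<epsilon>"
    by (rule inv_into_holomorphic[OF holomorphic_f op(1) bij_f])
  then have g': "(?g has_field_derivative deriv ?g \<zeta>) (at \<zeta>)"
    using holomorphic_derivI[OF _ op(2)] assms by blast
  \<comment> \<open>Differentiating \<open>?g z ^ n\<close> in two ways, by the power rule and as
    \<open>P\<close>, avoids any formula for the inverse map.\<close>
  have "((\<lambda>z. ?g z ^ n) has_field_derivative of_nat n * ?g \<zeta> ^ (n - 1) * deriv ?g \<zeta>) (at \<zeta>)"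
    using DERIV_power[OF g', of n] by (simp add: mult_ac)
  moreover have "((\<lambda>z. ?g z ^ n) has_field_derivative - of_nat n * F \<zeta>) (at \<zeta>)"
    by (rule has_field_derivative_transform_within_open[OF P_deriv op(2)]) (use assms f_power fg in auto)
  ultimately have "of_nat n * ?g \<zeta> ^ (n - 1) * deriv ?g \<zeta> = - of_nat n * F \<zeta>"
    using DERIV_unique by blast
  then have "of_nat n * (?g \<zeta> ^ (n - 1) * deriv ?g \<zeta>) = of_nat n * (- F \<zeta>)" by (simp add: mult.assoc)
  then have "?g \<zeta> ^ (n - 1) * deriv ?g \<zeta> = - F \<zeta>"
    using m_less by (subst (asm) mult_left_cancel) auto
  then show ?thesis by (simp add: pushforward_def)
qed

text \<open>The same identity read in the w coordinate. In this form it is the compatibility of the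
  two coefficients across the regluing.\<close>

lemma F_pullback:
  assumes "w \<notin> \<Sigma>" shows "- (w ^ (n - 1)) = F (f w) * deriv f w"
proof -
  have op: "open (- \<Sigma>)"
    unfolding slits_eq using compact_two_slits[THEN compact_imp_closed] l_pos by (simp add: open_Compl)
  have "(f has_field_derivative deriv f w) (at w)"
    using holomorphic_derivI[OF holomorphic_f op] assms by blast
  then have "((\<lambda>v. P (f v)) has_field_derivative - of_nat n * F (f w) * deriv f w) (at w)"
    by (rule DERIV_chain2[OF P_deriv])
  moreover have "((\<lambda>v. P (f v)) has_field_derivative of_nat n * w ^ (n - 1)) (at w)"
  proof (rule has_field_derivative_transform_within_open[OF _ op])
    show "((\<lambda>v. v ^ n) has_field_derivative of_nat n * w ^ (n - 1)) (at w)"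
      by (auto intro!: derivative_eq_intros)
  qed (use assms f_power in auto)
  ultimately have "- of_nat n * F (f w) * deriv f w = of_nat n * w ^ (n - 1)"
    using DERIV_unique by blast
  then have "of_nat n * (- (w ^ (n - 1))) = of_nat n * (F (f w) * deriv f w)"
    by (metis mult.assoc mult_minus_left mult_minus_right minus_minus)
  then show ?thesis using m_less by (subst (asm) mult_left_cancel) auto
qed

lemma holomorphic_F: "F holomorphic_on UNIV"
  unfolding F_def by (intro holomorphic_intros)

lemma F_zeros:
  shows "has_zero_of_order F (of_real (- 2 * \<epsilon>)) (n - m - 1)"
    and "has_zero_of_order F (of_real \<mu>) 1"
    and "has_zero_of_order F (of_real (2 * \<epsilon>)) (m - 1)"
proof -
  \<comment> \<open>One factorisation argument serves all three points. The value
    \<open>k = 0\<close> is included and then says that \<open>F\<close> does not vanish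
    there.\<close>
  have order: "has_zero_of_order F z0 k"
    if F: "\<And>z. F z = g z * (z - z0) ^ k" and g: "g holomorphic_on UNIV" "g z0 \<noteq> 0" for g z0 k
  proof -
    have "\<forall>\<^sub>F z in at z0. g z \<noteq> 0"
      using holomorphic_on_imp_continuous_on[OF g(1)] g(2)
      by (metis UNIV_I continuous_on_def tendsto_imp_eventually_ne)
    then have "\<forall>\<^sub>F z in at z0. F z \<noteq> 0"
      using eventually_neq_at_within[of z0] by eventually_elim (simp add: F)
    then have "\<exists>\<^sub>F z in at z0. F z \<noteq> 0" by (rule eventually_frequently[rotated]) simp
    moreover have "zorder F z0 = int k"
      by (rule zorder_eqI[of UNIV z0 g]) (use g F in auto)
    moreover have "F analytic_on {z0}"
      using holomorphic_F analytic_on_holomorphic by blast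
    ultimately show ?thesis by (simp add: has_zero_of_order_def)
  qed
  have ne: "complex_of_real \<mu> \<noteq> 2 * of_real \<epsilon>" "- 2 * complex_of_real \<epsilon> \<noteq> of_real \<mu>"
    using mu_bounds by (auto simp: complex_eq_iff)
  show "has_zero_of_order F (of_real (- 2 * \<epsilon>)) (n - m - 1)"
    by (rule order[where g = "\<lambda>\<zeta>. - ((\<zeta> - of_real \<mu>) * (\<zeta> - 2 * of_real \<epsilon>) ^ (m - 1))"])
      (use eps_pos ne in \<open>auto simp: F_def intro!: holomorphic_intros\<close>)
  show "has_zero_of_order F (of_real \<mu>) 1"
    by (rule order[where g = "\<lambda>\<zeta>. - ((\<zeta> + 2 * of_real \<epsilon>) ^ (n - m - 1) * (\<zeta> - 2 * of_real \<epsilon>) ^ (m - 1))"])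
      (use eps_pos ne in \<open>auto simp: F_def add_eq_0_iff intro!: holomorphic_intros\<close>)
  show "has_zero_of_order F (of_real (2 * \<epsilon>)) (m - 1)"
    by (rule order[where g = "\<lambda>\<zeta>. - ((\<zeta> + 2 * of_real \<epsilon>) ^ (n - m - 1) * (\<zeta> - of_real \<mu>))"])
      (use eps_pos ne in \<open>auto simp: F_def intro!: holomorphic_intros\<close>)
qed

text \<open>The filled set is the complement of the image of the outside of the disc. In the
  parameter z that image is \<open>S\<close> of a closed set, which avoids the circle because the
  slits lie inside the disc.\<close>

lemma f_fills_disc:
  assumes "\<Sigma> \<subseteq> ball 0 r"
  shows "open (f ` (ball 0 r - \<Sigma>) \<union> image_slit \<epsilon>)"
proof -
  define T where "T = {z \<in> cext. Q z \<in> - ball 0 r}"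
  have "closed T" unfolding T_def
    using continuous_closed_preimage[OF continuous_Q closed_cext, of "- ball 0 r"] by (auto simp: vimage_def Int_def)
  then have cl: "closed (S ` T)" by (rule closed_S_image) (auto simp: T_def)
  have T_ext: "T \<subseteq> exterior \<epsilon>" using assms Q_circle unfolding T_def cext_eq slits_eq by blast
  have "S ` T = f ` (- ball 0 r)"
  proof (intro equalityI subsetI)
    fix x assume "x \<in> S ` T"
    then obtain z where "z \<in> T" "x = S z" by blast
    then show "x \<in> f ` (- ball 0 r)" using f_Q T_ext by (auto simp: T_def intro!: image_eqI[of _ _ "Q z"])
  next
    fix x assume "x \<in> f ` (- ball 0 r)"
    then obtain w where w: "w \<in> - ball 0 r" "x = f w" by blast
    then have "w \<notin> \<Sigma>" using assms by blast
    then have "Qi w \<in> T" using Qi w(1) exterior_cext by (auto simp: T_def)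
    then show "x \<in> S ` T" using w(2) by (auto simp: regluing_map_def)
  qed
  moreover have "f ` (ball 0 r - \<Sigma>) \<union> image_slit \<epsilon> = - f ` (- ball 0 r)"
  proof -
    have "f ` (- \<Sigma>) = f ` (ball 0 r - \<Sigma>) \<union> f ` (- ball 0 r)" using assms by blast
    moreover have "f ` (ball 0 r - \<Sigma>) \<inter> f ` (- ball 0 r) = {}"
      using assms inj_on_image_Int[OF bij_betw_imp_inj_on[OF bij_f], of "ball 0 r - \<Sigma>" "- ball 0 r"]
      by auto
    moreover have "f ` (- \<Sigma>) = - image_slit \<epsilon>" using bij_f by (simp add: bij_betw_def)
    moreover have "A \<union> C = - B" if "A \<union> B = - C" "A \<inter> B = {}" for A B C :: "complex set"
      using that by blast
    ultimately show ?thesis by metis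
  qed
  ultimately show ?thesis using cl by (simp add: open_Compl)
qed

lemma bounded_f: "bounded (f ` (ball 0 r - \<Sigma>))"
proof (rule boundedI)
  fix x assume "x \<in> f ` (ball 0 r - \<Sigma>)"
  then obtain w where w: "cmod w < r" "w \<notin> \<Sigma>" "x = S (Qi w)" by (auto simp: regluing_map_def)
  have q: "Qi w \<in> cext" using Qi(1)[OF w(2)] exterior_cext by blast
  \<comment> \<open>The constant is \<open>3 * \<epsilon>\<close> from \<open>norm_Q_ge\<close> plus
    \<epsilon> from \<open>norm_S_ge\<close>.\<close>
  show "cmod x \<le> r + 4 * \<epsilon>"
    using norm_S_ge(2)[OF q] norm_Q_ge[OF q] w Qi(2)[OF w(2)] by simp
qed

end

section \<open>Change of variables for holomorphic maps\<close>

text \<open>The change of variables theorem is stated on \<open>real ^ 'n\<close>;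
  \<open>vec_of\<close> and \<open>complex_of\<close> carry it over to the complex plane.\<close>

definition vec_of :: "complex \<Rightarrow> real ^ 2" where "vec_of z = (\<chi> i. if i = 1 then Re z else Im z)"

definition complex_of :: "real ^ 2 \<Rightarrow> complex" where "complex_of v = Complex (v $ 1) (v $ 2)"

lemma vec_of_complex_of [simp]: "vec_of (complex_of v) = v" "complex_of (vec_of z) = z"
  by (simp_all add: vec_of_def complex_of_def vec_eq_iff forall_2)

lemma linear_vec_of: "linear vec_of" and linear_complex_of: "linear complex_of"
  by (auto intro!: linearI simp: vec_of_def complex_of_def vec_eq_iff complex_eq_iff)

lemma borel_vec_of [measurable]: "vec_of \<in> borel_measurable borel"
  and borel_complex_of [measurable]: "complex_of \<in> borel_measurable borel"
  using linear_continuous_on linear_vec_of linear_complex_of linear_conv_bounded_linear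
  by (auto intro!: borel_measurable_continuous_onI)

text \<open>Boxes correspond to boxes with the same side lengths, and their volumes determine
  Lebesgue measure.\<close>

lemma distr_vec_of: "distr lborel borel vec_of = lborel"
proof (rule lborel_eqI[symmetric])
  fix l u :: "real ^ 2"
  assume *: "\<And>b. b \<in> Basis \<Longrightarrow> l \<bullet> b \<le> u \<bullet> b"
  have le: "l $ 1 \<le> u $ 1" "l $ 2 \<le> u $ 2"
    using *[of "axis 1 1"] *[of "axis 2 1"] by (auto simp: axis_in_Basis_iff inner_axis)
  have "vec_of -` box l u = box (complex_of l) (complex_of u)"
    by (rule set_eqI) (simp add: mem_box_cart forall_2 in_box_complex_iff vec_of_def complex_of_def conj_ac)
  then have "emeasure (distr lborel borel vec_of) (box l u) = emeasure lborel (box (complex_of l) (complex_of u))"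
    by (subst emeasure_distr) auto
  also have "\<dots> = ennreal ((u $ 1 - l $ 1) * (u $ 2 - l $ 2))"
    using le by (subst emeasure_lborel_box) (auto simp: Basis_complex_def complex_of_def algebra_simps)
  also have "(u $ 1 - l $ 1) * (u $ 2 - l $ 2) = (\<Prod>b\<in>Basis. (u - l) \<bullet> b)"
  proof -
    have "(\<Prod>b\<in>Basis. (u - l) \<bullet> b) = (\<Prod>i\<in>UNIV. (u - l) \<bullet> axis i (1::real))"
      by (subst Basis_vec_def) (auto simp: UNION_singleton_eq_range axis_eq_axis inj_on_def intro!: prod.reindex_cong[of "\<lambda>i. axis i 1"])
    then show ?thesis by (simp add: UNIV_2 cart_eq_inner_axis[symmetric])
  qed
  finally show "emeasure (distr lborel borel vec_of) (box l u) = (\<Prod>b\<in>Basis. (u - l) \<bullet> b)" .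
qed simp

lemma nn_integral_vec_of:
  assumes "F \<in> borel_measurable borel"
  shows "(\<integral>\<^sup>+ v. F v \<partial>lborel) = (\<integral>\<^sup>+ z. F (vec_of z) \<partial>lborel)"
proof -
  have "(\<integral>\<^sup>+ v. F v \<partial>lborel) = (\<integral>\<^sup>+ v. F v \<partial>(distr lborel borel vec_of))"
    by (simp add: distr_vec_of)
  also have "\<dots> = (\<integral>\<^sup>+ z. F (vec_of z) \<partial>lborel)"
    by (rule nn_integral_distr) (use assms in auto)
  finally show ?thesis .
qed

lemma nn_set_integral_eq_integral:
  fixes h :: "'a::euclidean_space \<Rightarrow> real"
  assumes "\<And>x. 0 \<le> h x" and "h absolutely_integrable_on S"
  shows "(\<integral>\<^sup>+x\<in>S. ennreal (h x) \<partial>lborel) = ennreal (integral S h)"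
  by (rule nn_integral_has_integral_lebesgue'[OF assms(1)
        integrable_integral[OF set_lebesgue_integral_eq_integral(1)[OF assms(2)]]])

text \<open>The real Jacobian of a holomorphic map is the squared modulus of its derivative.
  Continuity of \<open>h\<close> and boundedness of the image make \<open>h\<close> absolutely
  integrable there, so the nonnegative integrals can be read as absolutely convergent ones.\<close>

lemma nn_integral_change_of_variables_holomorphic:
  fixes g :: "complex \<Rightarrow> complex" and h :: "complex \<Rightarrow> real"
  assumes S: "S \<in> sets borel" "S \<subseteq> U" and U: "open U" "g holomorphic_on U" "inj_on g U"
    and h: "continuous_on UNIV h" "\<And>z. 0 \<le> h z" and bdd: "bounded (g ` S)"
  shows "(\<integral>\<^sup>+z\<in>g ` S. ennreal (h z) \<partial>lborel) = (\<integral>\<^sup>+z\<in>S. ennreal ((cmod (deriv g z))\<^sup>2 * h (g z)) \<partial>lborel)"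
proof -
  have gS: "g ` S \<in> sets borel"
  proof -
    obtain k where k: "k holomorphic_on g ` U" "\<And>z. z \<in> U \<Longrightarrow> k (g z) = z"
      using holomorphic_has_inverse[OF U(2,1,3)] by metis
    have "open (g ` U)" by (rule open_mapping_thm3[OF U(2,1,3)])
    \<comment> \<open>The image is Borel because it is the preimage of S under the holomorphic
      inverse.\<close>
    moreover have "g ` S = g ` U \<inter> k -` S" using k(2) S(2) by auto
    moreover have "k \<in> borel_measurable (restrict_space borel (g ` U))"
      by (intro borel_measurable_continuous_on_restrict holomorphic_on_imp_continuous_on k(1))
    ultimately show ?thesis
      using measurable_sets[of k "restrict_space borel (g ` U)" borel S] S(1)
      by (simp add: space_restrict_space sets_restrict_space_iff Int_commute)
  qed
  define S' where "S' = vec_of ` S"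
  define G where "G = vec_of \<circ> g \<circ> complex_of"
  define D where "D v = (\<lambda>x. vec_of (deriv g (complex_of v) * complex_of x))" for v
  define h' where "h' = h \<circ> complex_of"
  have S'_eq: "S' = complex_of -` S" unfolding S'_def by (auto simp: image_iff) (metis vec_of_complex_of(1))
  have GS'_eq: "G ` S' = complex_of -` (g ` S)"
    unfolding S'_def G_def by (auto simp: image_iff o_def) (metis vec_of_complex_of)
  have S': "S' \<in> sets borel" unfolding S'_eq
    using measurable_sets[OF borel_complex_of S(1)] by simp
  have GS': "G ` S' \<in> sets borel" unfolding GS'_eq
    using measurable_sets[OF borel_complex_of gS] by simp
  have der: "(G has_derivative D v) (at v within S')" if "v \<in> S'" for v
  proof -
    have "complex_of v \<in> U" using that S(2) S'_eq by auto
    then have "(g has_derivative (\<lambda>x. deriv g (complex_of v) * x)) (at (complex_of v))"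
      using holomorphic_derivI[OF U(2,1)] by (simp add: has_field_derivative_def)
    moreover have lin: "(vec_of has_derivative vec_of) F" "(complex_of has_derivative complex_of) F'" for F F'
      using linear_vec_of linear_complex_of by (auto intro!: bounded_linear_imp_has_derivative simp: linear_conv_bounded_linear)
    ultimately have "(G has_derivative (vec_of \<circ> ((\<lambda>x. deriv g (complex_of v) * x) \<circ> complex_of))) (at v)"
      unfolding G_def comp_assoc by (intro diff_chain_at lin) auto
    then show ?thesis by (simp add: D_def o_def has_derivative_at_withinI)
  qed
  \<comment> \<open>Multiplication by \<open>u + \<i> * v\<close> has the real matrix with rows
    \<open>(u, - v)\<close> and \<open>(v, u)\<close>.\<close>
  have det: "det (matrix (D v)) = (cmod (deriv g (complex_of v)))\<^sup>2" for v
    unfolding cmod_power2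
    by (simp add: det_2 matrix_def D_def vec_of_def complex_of_def axis_def power2_eq_square)
  have inj: "inj_on G S'"
  proof (rule inj_onI)
    fix x y assume "x \<in> S'" "y \<in> S'" "G x = G y"
    then have "g (complex_of x) = g (complex_of y)" by (metis G_def comp_apply vec_of_complex_of(2))
    then have "complex_of x = complex_of y"
      using U(3) S(2) \<open>x \<in> S'\<close> \<open>y \<in> S'\<close> S'_eq by (auto simp: inj_on_def)
    then show "x = y" by (metis vec_of_complex_of(1))
  qed
  have "continuous_on UNIV complex_of"
    using linear_complex_of by (simp add: linear_continuous_on linear_conv_bounded_linear)
  then have h': "continuous_on UNIV h'" "\<And>v. 0 \<le> h' v"
    using h(2) continuous_on_compose2[OF h(1)] by (auto simp: h'_def o_def)
  have int: "h' absolutely_integrable_on G ` S'"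
  proof -
    have "bounded (G ` S')"
    proof -
      have "G ` S' = vec_of ` (g ` S)" by (auto simp: G_def S'_def image_iff)
      then show ?thesis using bdd linear_vec_of by (simp add: bounded_linear_image linear_conv_bounded_linear)
    qed
    then obtain a b where ab: "G ` S' \<subseteq> cbox a b" using bounded_subset_cbox_symmetric by metis
    have "h' absolutely_integrable_on cbox a b"
      using h'(1) by (intro absolutely_integrable_continuous) (auto intro: continuous_on_subset)
    then show ?thesis
      by (rule set_integrable_subset) (use GS' ab in auto)
  qed
  \<comment> \<open>The theorem concerns vector-valued integrands, so the real function enters as a
    vector with a single component.\<close>
  have "((\<lambda>v. \<bar>det (matrix (D v))\<bar> *\<^sub>R (\<chi> i::1. h' (G v))) absolutely_integrable_on S' \<and>
      integral S' (\<lambda>v. \<bar>det (matrix (D v))\<bar> *\<^sub>R (\<chi> i::1. h' (G v))) = (\<chi> i. integral (G ` S') h'))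
    \<longleftrightarrow> ((\<lambda>v. (\<chi> i::1. h' v)) absolutely_integrable_on G ` S' \<and>
      integral (G ` S') (\<lambda>v. (\<chi> i::1. h' v)) = (\<chi> i. integral (G ` S') h'))"
    by (rule has_absolute_integral_change_of_variables[OF _ der inj]) (use S' in auto)
  moreover have "(\<lambda>v. (\<chi> i::1. h' v)) absolutely_integrable_on G ` S'"
    "integral (G ` S') (\<lambda>v. (\<chi> i::1. h' v)) = (\<chi> i. integral (G ` S') h')"
    using int by (simp_all add: absolutely_integrable_on_1_iff integral_on_1_eq vec_eq_iff)
  ultimately have *: "(\<lambda>v. \<bar>det (matrix (D v))\<bar> * h' (G v)) absolutely_integrable_on S'"
    "integral S' (\<lambda>v. \<bar>det (matrix (D v))\<bar> * h' (G v)) = integral (G ` S') h'"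
    by (simp_all add: absolutely_integrable_on_1_iff integral_on_1_eq vec_eq_iff)
  define K where "K v = \<bar>det (matrix (D v))\<bar> * h' (G v)" for v
  have Kc: "K (vec_of z) = (cmod (deriv g z))\<^sup>2 * h (g z)" for z by (simp add: K_def det h'_def G_def)
  have meas2: "(\<lambda>v. K v * indicator S' v) \<in> borel_measurable borel"
  proof -
    have "continuous_on U (\<lambda>z. (cmod (deriv g z))\<^sup>2 * h (g z))"
      using holomorphic_on_imp_continuous_on[OF holomorphic_deriv[OF U(2,1)]]
        holomorphic_on_imp_continuous_on[OF U(2)] continuous_on_compose2[OF h(1)]
      by (intro continuous_intros) auto
    then have c: "continuous_on S (\<lambda>z. (cmod (deriv g z))\<^sup>2 * h (g z))" using S(2) continuous_on_subset by blast
    have "(\<lambda>z. indicator S z *\<^sub>R ((cmod (deriv g z))\<^sup>2 * h (g z))) \<in> borel_measurable borel"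
      by (rule borel_measurable_continuous_on_indicator[OF S(1) c])
    then have "(\<lambda>v. indicator S (complex_of v) *\<^sub>R ((cmod (deriv g (complex_of v)))\<^sup>2 * h (g (complex_of v)))) \<in> borel_measurable borel"
      by measurable
    moreover have "(\<lambda>v. indicator S (complex_of v) *\<^sub>R ((cmod (deriv g (complex_of v)))\<^sup>2 * h (g (complex_of v)))) = (\<lambda>v. K v * indicator S' v)"
      by (auto simp: fun_eq_iff S'_eq indicator_def Kc[of "complex_of v" for v, simplified])
    ultimately show ?thesis by simp
  qed
  have "(\<integral>\<^sup>+z\<in>g ` S. ennreal (h z) \<partial>lborel) = (\<integral>\<^sup>+v\<in>G ` S'. ennreal (h' v) \<partial>lborel)"
  proof (subst nn_integral_vec_of)
    show "(\<lambda>v. ennreal (h' v) * indicator (G ` S') v) \<in> borel_measurable borel"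
      using GS' borel_measurable_continuous_onI[OF h'(1)] by simp
  qed (auto simp: GS'_eq h'_def indicator_def intro!: nn_integral_cong)
  also have "\<dots> = ennreal (integral (G ` S') h')"
    by (rule nn_set_integral_eq_integral[OF h'(2) int])
  also have "\<dots> = ennreal (integral S' K)" using *(2) by (simp add: K_def[abs_def])
  also have "\<dots> = (\<integral>\<^sup>+v\<in>S'. ennreal (K v) \<partial>lborel)"
    by (rule nn_set_integral_eq_integral[symmetric]) (use h'(2) *(1) in \<open>auto simp: K_def[abs_def]\<close>)
  also have "\<dots> = (\<integral>\<^sup>+z\<in>S. ennreal ((cmod (deriv g z))\<^sup>2 * h (g z)) \<partial>lborel)"
  proof (subst nn_integral_vec_of)
    have "(\<lambda>v. ennreal (K v * indicator S' v)) \<in> borel_measurable borel" using meas2 by measurable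
    moreover have "(\<lambda>v. ennreal (K v * indicator S' v)) = (\<lambda>v. ennreal (K v) * indicator S' v)"
      by (auto simp: indicator_def)
    ultimately show "(\<lambda>v. ennreal (K v) * indicator S' v) \<in> borel_measurable borel" by simp
  qed (auto simp: S'_eq Kc indicator_def intro!: nn_integral_cong)
  finally show ?thesis .
qed

section \<open>Regluing a Riemann surface\<close>

text \<open>A negligible set has empty interior, so removing it from an open set leaves a dense
  part; connectedness passes to any set between a connected set and its closure.\<close>

lemma open_connected_if_dense_part:
  fixes W :: "complex set"
  assumes "open W" "negligible J" "connected (W - J)" shows "connected W"
proof (rule connected_intermediate_closure[OF assms(3)])
  show "W \<subseteq> closure (W - J)"
  proof
    fix x assume x: "x \<in> W"
    show "x \<in> closure (W - J)"
    proof (rule ccontr)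
      assume "x \<notin> closure (W - J)"
      then have "x \<in> W - closure (W - J)" using x by blast
      moreover have "W - closure (W - J) \<subseteq> J" using closure_subset[of "W - J"] by blast
      moreover have "open (W - closure (W - J))" using assms(1) by (simp add: open_Diff)
      ultimately show False
        using negligible_subset[OF assms(2)] open_not_negligible[of "W - closure (W - J)"] by auto
    qed
  qed
qed auto

subsection \<open>Charts\<close>

context
  fixes X :: "'a topology" and d :: "'a chart"
  assumes chart: "chart_on X d"
begin

lemma chart_openin: "openin X (fst d)" and chart_open: "open (snd d ` fst d)"
  and chart_inj: "inj_on (snd d) (fst d)"
proof -
  show "openin X (fst d)" "open (snd d ` fst d)" using chart by (auto simp: chart_on_def)
  then have "topspace (subtopology X (fst d)) = fst d" using openin_subset by force
  then show "inj_on (snd d) (fst d)"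
    using chart homeomorphic_imp_injective_map unfolding chart_on_def by metis
qed

lemma chart_subset: "fst d \<subseteq> topspace X" using chart_openin by (rule openin_subset)

lemma chart_open_image: assumes "openin X U" "U \<subseteq> fst d" shows "open (snd d ` U)"
proof -
  have "open_map (subtopology X (fst d)) (top_of_set (snd d ` fst d)) (snd d)"
    using chart homeomorphic_imp_open_map unfolding chart_on_def by blast
  then have "openin (top_of_set (snd d ` fst d)) (snd d ` U)"
    using assms openin_open_subtopology[OF chart_openin] unfolding open_map_def by blast
  then show ?thesis using openin_open_eq[OF chart_open] by blast
qed

lemma chart_openin_preimage: assumes "open V" shows "openin X {p \<in> fst d. snd d p \<in> V}"
proof -
  have "continuous_map (subtopology X (fst d)) (top_of_set (snd d ` fst d)) (snd d)"
    using chart homeomorphic_imp_continuous_map unfolding chart_on_def by blast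
  then have c: "continuous_map (subtopology X (fst d)) euclidean (snd d)"
    using continuous_map_in_subtopology by blast
  have t: "topspace (subtopology X (fst d)) = fst d" using chart_subset by auto
  have "openin (subtopology X (fst d)) {p \<in> fst d. snd d p \<in> V}"
    using openin_continuous_map_preimage[OF c, of V] assms unfolding t by simp
  then show ?thesis using openin_open_subtopology[OF chart_openin] by blast
qed

lemma chart_compactin_preimage:
  assumes "compact C" "C \<subseteq> snd d ` fst d" shows "compactin X {p \<in> fst d. snd d p \<in> C}"
proof -
  let ?K = "{p \<in> fst d. snd d p \<in> C}"
  have h: "homeomorphic_map (subtopology X (fst d)) (top_of_set (snd d ` fst d)) (snd d)"
    using chart unfolding chart_on_def by blast
  have "snd d ` ?K = C" using assms(2) by blast
  moreover have "compactin (top_of_set (snd d ` fst d)) C"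
    using assms by (simp add: compactin_subtopology)
  moreover have "?K \<subseteq> topspace (subtopology X (fst d))" using chart_subset by auto
  ultimately have "compactin (subtopology X (fst d)) ?K"
    using homeomorphic_map_compactness[OF h, of ?K] by metis
  then show ?thesis by (simp add: compactin_subtopology)
qed

lemma chart_inverse: "p \<in> fst d \<Longrightarrow> inv_into (fst d) (snd d) (snd d p) = p"
  using chart_inj by simp

end

lemma chart_onI:
  assumes "openin X (fst d)" "inj_on (snd d) (fst d)"
    and im: "\<And>U. openin X U \<Longrightarrow> U \<subseteq> fst d \<Longrightarrow> open (snd d ` U)"
    and pre: "\<And>V. open V \<Longrightarrow> V \<subseteq> snd d ` fst d \<Longrightarrow> openin X {p \<in> fst d. snd d p \<in> V}"
  shows "chart_on X d"
proof -
  have o: "open (snd d ` fst d)" using im assms(1) by blast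
  have t: "topspace (subtopology X (fst d)) = fst d" using openin_subset[OF assms(1)] by auto
  have "homeomorphic_map (subtopology X (fst d)) (top_of_set (snd d ` fst d)) (snd d)"
  proof (rule bijective_open_imp_homeomorphic_map)
    show "continuous_map (subtopology X (fst d)) (top_of_set (snd d ` fst d)) (snd d)"
      unfolding continuous_map_def t
    proof (intro conjI allI impI)
      fix V assume "openin (top_of_set (snd d ` fst d)) V"
      then have "open V" "V \<subseteq> snd d ` fst d" using openin_open_eq[OF o] by auto
      then show "openin (subtopology X (fst d)) {x \<in> fst d. snd d x \<in> V}"
        using pre openin_open_subtopology[OF assms(1)] by auto
    qed auto
    show "open_map (subtopology X (fst d)) (top_of_set (snd d ` fst d)) (snd d)"
      unfolding open_map_def openin_open_subtopology[OF assms(1)]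
      using im openin_open_eq[OF o] by auto
  qed (use t assms(2) in auto)
  then show ?thesis using assms(1) o by (simp add: chart_on_def)
qed

section \<open>Regluing along an abstract cut gives a compact Riemann surface\<close>

text \<open>\<open>fill_open\<close> expresses that the filling closes up the cut: it makes the
  range of the \<zeta> chart open and, for smaller radii, provides neighbourhoods of
  \<open>J\<close>. \<open>fill_bounded\<close> goes into the compactness of the refilled
  part.\<close>

locale surgery =
  fixes X :: "'a topology" and A :: "'a chart set" and c :: "'a chart" and \<rho> :: real
    and \<Sigma> J :: "complex set" and f :: "complex \<Rightarrow> complex"
  assumes surface: "compact_riemann_surface X A" and c_in: "c \<in> A"
    and disc: "ball 0 \<rho> \<subseteq> snd c ` fst c" and Sig_ball: "\<Sigma> \<subseteq> ball 0 \<rho>"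
    and Sig_compact: "compact \<Sigma>" and Sig_connected: "connected (ball 0 \<rho> - \<Sigma>)"
    and Sig_negligible: "negligible \<Sigma>" and Sig_ne: "\<Sigma> \<noteq> {}"
    and J_compact: "compact J" and J_ne: "J \<noteq> {}" and J_negligible: "negligible J"
    and f_hol: "f holomorphic_on - \<Sigma>" and f_bij: "bij_betw f (- \<Sigma>) (- J)"
    and fill_open: "\<And>r. \<Sigma> \<subseteq> ball 0 r \<Longrightarrow> open (f ` (ball 0 r - \<Sigma>) \<union> J)"
    and fill_bounded: "\<And>r. bounded (f ` (ball 0 r - \<Sigma>))"
begin

abbreviation "D \<equiv> coord_disc c \<rho>"
abbreviation "K \<equiv> cut c \<Sigma>"
abbreviation "Z \<equiv> zeta_chart c \<rho> \<Sigma> J f"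
abbreviation "X' \<equiv> deformed_topology X c \<rho> \<Sigma> J f"
abbreviation "A' \<equiv> deformed_atlas A c \<rho> \<Sigma> J f"
abbreviation "cc \<equiv> cut_chart c \<Sigma>"
text \<open>The range of the \<zeta> chart (see \<open>Z_img\<close>).\<close>

definition "W = f ` (ball 0 \<rho> - \<Sigma>) \<union> J"
definition "space' = Inl ` (topspace X - K) \<union> Inr ` J"

lemma rs: "riemann_surface X A" and X_compact: "compact_space X"
  using surface by (auto simp: compact_riemann_surface_def)

lemma charts: "d \<in> A \<Longrightarrow> chart_on X d" and X_Hausdorff: "Hausdorff_space X"
  and X_connected: "connected_space X" and X_cover: "(\<Union>d\<in>A. fst d) = topspace X"
  and trans_hol: "d \<in> A \<Longrightarrow> e \<in> A \<Longrightarrow> transition d e holomorphic_on snd d ` (fst d \<inter> fst e)"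
  using rs by (auto simp: riemann_surface_def)

lemmas c_chart = charts[OF c_in]

lemma f_inj: "inj_on f (- \<Sigma>)" and f_img: "f ` (- \<Sigma>) = - J"
  using f_bij by (auto simp: bij_betw_def)

lemma f_notin: "w \<notin> \<Sigma> \<Longrightarrow> f w \<notin> J" using f_img by blast

lemma Sig_open: "open (- \<Sigma>)" using Sig_compact compact_imp_closed by blast
lemma J_open: "open (- J)" using J_compact compact_imp_closed by blast

lemma f_open_map: "open U \<Longrightarrow> U \<subseteq> - \<Sigma> \<Longrightarrow> open (f ` U)"
  by (rule open_mapping_thm3) (use holomorphic_on_subset[OF f_hol] inj_on_subset[OF f_inj] in auto)

lemma D_sub: "D \<subseteq> fst c" and K_sub_D: "K \<subseteq> D"
  using Sig_ball by (auto simp: coord_disc_def cut_def)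

lemma c_D: "snd c ` D = ball 0 \<rho>"
  using disc by (force simp: coord_disc_def)

lemma c_D_K: "snd c ` (D - K) = ball 0 \<rho> - \<Sigma>"
proof -
  have "snd c ` (D - K) = snd c ` D - \<Sigma>"
    by (auto simp: coord_disc_def cut_def)
  then show ?thesis using c_D by simp
qed

lemma D_open: "openin X D"
proof -
  have "D = {p \<in> fst c. snd c p \<in> ball 0 \<rho>}" by (auto simp: coord_disc_def)
  then show ?thesis using chart_openin_preimage[OF c_chart open_ball] by metis
qed

lemma K_closed: "closedin X K"
proof -
  have "compactin X {p \<in> fst c. snd c p \<in> \<Sigma>}"
    by (rule chart_compactin_preimage[OF c_chart Sig_compact]) (use Sig_ball disc in auto)
  then show ?thesis using compactin_imp_closedin[OF X_Hausdorff] by (simp add: cut_def)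
qed

lemma openin_minus_K: "openin X U \<Longrightarrow> openin X (U - K)"
  using K_closed by (simp add: openin_diff)

lemma fst_Z: "fst Z = Inl ` (D - K) \<union> Inr ` J" by (simp add: zeta_chart_def)
lemma snd_Z [simp]: "snd Z (Inl p) = f (snd c p)" "snd Z (Inr \<zeta>) = \<zeta>"
  by (simp_all add: zeta_chart_def)
lemma fst_cc: "fst (cc d) = Inl ` (fst d - K)" by (simp add: cut_chart_def)
lemma snd_cc [simp]: "snd (cc d) (Inl p) = snd d p" by (simp add: cut_chart_def)

lemma D_K_Sig: "p \<in> fst c - K \<Longrightarrow> snd c p \<notin> \<Sigma>" by (auto simp: cut_def)

lemma Z_inj: "inj_on (snd Z) (fst Z)"
proof (rule inj_onI)
  fix x y assume xy: "x \<in> fst Z" "y \<in> fst Z" "snd Z x = snd Z y"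
  have "p = q" if "p \<in> D - K" "q \<in> D - K" "f (snd c p) = f (snd c q)" for p q
    using that inj_onD[OF f_inj that(3)] inj_onD[OF chart_inj[OF c_chart], of p q] D_sub D_K_Sig by blast
  moreover have "f (snd c p) \<notin> J" if "p \<in> D - K" for p
    using that D_sub D_K_Sig f_notin by blast
  ultimately show "x = y" using xy unfolding fst_Z by (auto; metis)
qed

lemma Z_img: "snd Z ` fst Z = W"
proof -
  have "snd Z ` fst Z = f ` snd c ` (D - K) \<union> J" unfolding fst_Z image_Un by (auto simp: image_image)
  then show ?thesis unfolding c_D_K W_def .
qed

lemma W_open: "open W" unfolding W_def by (rule fill_open[OF Sig_ball])

lemma istopology_X': "istopology (\<lambda>V. V \<subseteq> space' \<and> openin X (Inl -` V) \<and> open (snd Z ` (V \<inter> fst Z)))"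
  unfolding istopology_def
proof (intro conjI allI impI)
  fix S T assume "S \<subseteq> space' \<and> openin X (Inl -` S) \<and> open (snd Z ` (S \<inter> fst Z))"
    "T \<subseteq> space' \<and> openin X (Inl -` T) \<and> open (snd Z ` (T \<inter> fst Z))"
  \<comment> \<open>Injectivity of the \<zeta> chart makes its traces commute with
    intersections.\<close>
  moreover have "snd Z ` (S \<inter> T \<inter> fst Z) = snd Z ` (S \<inter> fst Z) \<inter> snd Z ` (T \<inter> fst Z)"
    using inj_on_image_Int[OF Z_inj, of "S \<inter> fst Z" "T \<inter> fst Z"] by (simp add: Int_ac)
  ultimately show "S \<inter> T \<subseteq> space'" "openin X (Inl -` (S \<inter> T))" "open (snd Z ` (S \<inter> T \<inter> fst Z))"
    by (auto simp: openin_Int open_Int)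
next
  fix \<K> assume K: "\<forall>V\<in>\<K>. V \<subseteq> space' \<and> openin X (Inl -` V) \<and> open (snd Z ` (V \<inter> fst Z))"
  have "Inl -` \<Union> \<K> = (\<Union>V\<in>\<K>. Inl -` V)" "snd Z ` (\<Union> \<K> \<inter> fst Z) = (\<Union>V\<in>\<K>. snd Z ` (V \<inter> fst Z))"
    by blast+
  then show "\<Union> \<K> \<subseteq> space'" "openin X (Inl -` \<Union> \<K>)" "open (snd Z ` (\<Union> \<K> \<inter> fst Z))"
    using K by (auto intro!: openin_Union)
qed

lemma openin_X': "openin X' V \<longleftrightarrow> V \<subseteq> space' \<and> openin X (Inl -` V) \<and> open (snd Z ` (V \<inter> fst Z))"
  using topology_inverse'[OF istopology_X'] unfolding deformed_topology_def space'_def by simp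

lemma openin_Inl: assumes "openin X U" "U \<inter> K = {}" shows "openin X' (Inl ` U)"
proof -
  have "snd Z ` (Inl ` U \<inter> fst Z) = f ` snd c ` (U \<inter> D)"
    using assms(2) unfolding fst_Z by (force simp: image_iff)
  moreover have "open (snd c ` (U \<inter> D))"
    by (rule chart_open_image[OF c_chart openin_Int[OF assms(1) D_open]]) (use D_sub in blast)
  then have "open (f ` snd c ` (U \<inter> D))"
    by (rule f_open_map) (use assms(2) D_sub D_K_Sig in blast)
  moreover have "Inl -` Inl ` U = U" by auto
  ultimately show ?thesis
    unfolding openin_X' space'_def using assms openin_subset[OF assms(1)] by (metis Diff_eq Int_commute
        disjoint_eq_subset_Compl image_mono inf.bounded_iff le_supI1)
qed

lemma openin_zeta: assumes "open V" shows "openin X' {x \<in> fst Z. snd Z x \<in> V}"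
proof -
  let ?V = "{x \<in> fst Z. snd Z x \<in> V}"
  have "Inl -` ?V = {p \<in> fst c. snd c p \<in> f -` V \<inter> (ball 0 \<rho> - \<Sigma>)}"
    unfolding fst_Z using D_sub by (auto simp: coord_disc_def cut_def)
  moreover have "open (f -` V \<inter> (ball 0 \<rho> - \<Sigma>))"
  proof -
    have "open (ball 0 \<rho> - \<Sigma>)" using Sig_compact by (simp add: compact_imp_closed open_Diff)
    moreover have "continuous_on (ball 0 \<rho> - \<Sigma>) f"
      by (rule continuous_on_subset[OF holomorphic_on_imp_continuous_on[OF f_hol]]) auto
    ultimately show ?thesis using assms by (metis continuous_on_open_vimage)
  qed
  ultimately have "openin X (Inl -` ?V)" using chart_openin_preimage[OF c_chart] by metis
  moreover have "snd Z ` (?V \<inter> fst Z) = V \<inter> W" unfolding Z_img[symmetric] by auto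
  moreover have "?V \<subseteq> space'"
    unfolding fst_Z space'_def using D_sub chart_subset[OF c_chart] by auto
  ultimately show ?thesis unfolding openin_X' using assms W_open by auto
qed

lemma topspace_X': "topspace X' = space'"
proof
  show "topspace X' \<subseteq> space'" using openin_X' openin_topspace by blast
  have "openin X' (Inl ` (topspace X - K))"
    by (rule openin_Inl) (auto intro: openin_minus_K)
  moreover have "openin X' (fst Z)" using openin_zeta[of UNIV] by simp
  ultimately have "Inl ` (topspace X - K) \<union> fst Z \<subseteq> topspace X'" using openin_subset by blast
  then show "space' \<subseteq> topspace X'" unfolding fst_Z space'_def by blast
qed

lemma Z_openin: "openin X' (fst Z)" using openin_zeta[of UNIV] by simp

lemma Z_chart: "chart_on X' Z"
proof (rule chart_onI)
  show "open (snd Z ` U)" if "openin X' U" "U \<subseteq> fst Z" for U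
    using that openin_X' by (metis inf.absorb1)
qed (use Z_openin Z_inj openin_zeta in auto)

lemma cc_chart: assumes "d \<in> A" shows "chart_on X' (cc d)"
proof (rule chart_onI)
  show "openin X' (fst (cc d))"
    unfolding fst_cc by (rule openin_Inl) (use openin_minus_K chart_openin[OF charts[OF assms]] in auto)
  show "inj_on (snd (cc d)) (fst (cc d))"
    unfolding fst_cc using chart_inj[OF charts[OF assms]] by (auto simp: inj_on_def)
  show "open (snd (cc d) ` U)" if U: "openin X' U" "U \<subseteq> fst (cc d)" for U
  proof -
    have "snd (cc d) ` U = snd d ` (Inl -` U)" using U(2) unfolding fst_cc by force
    moreover have "openin X (Inl -` U)" "Inl -` U \<subseteq> fst d" using U openin_X' unfolding fst_cc by auto
    ultimately show ?thesis using chart_open_image[OF charts[OF assms]] by metis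
  qed
  show "openin X' {p \<in> fst (cc d). snd (cc d) p \<in> V}" if "open V" for V
  proof -
    have "{p \<in> fst (cc d). snd (cc d) p \<in> V} = Inl ` ({p \<in> fst d. snd d p \<in> V} - K)"
      unfolding fst_cc by auto
    then show ?thesis
      using openin_Inl[of "{p \<in> fst d. snd d p \<in> V} - K"] openin_minus_K
        chart_openin_preimage[OF charts[OF assms] that] by auto
  qed
qed

text \<open>Compactness of the cut leaves a collar between it and the rim of the disc. The collar
  separates the filling from points outside the disc and allows the new space to be covered by two
  compact pieces.\<close>

lemma inner_radius: obtains r where "r < \<rho>" "\<Sigma> \<subseteq> ball 0 r" "0 < r"
proof -
  obtain w where w: "w \<in> \<Sigma>" "\<And>v. v \<in> \<Sigma> \<Longrightarrow> cmod v \<le> cmod w"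
    using continuous_attains_sup[OF Sig_compact Sig_ne continuous_on_norm_id] by (metis id_apply)
  then have "cmod w < \<rho>" using Sig_ball by auto
  show thesis
  proof (rule that)
    show "(cmod w + \<rho>) / 2 < \<rho>" using \<open>cmod w < \<rho>\<close> by simp
    show "0 < (cmod w + \<rho>) / 2" using le_less_trans[OF norm_ge_zero \<open>cmod w < \<rho>\<close>] by (simp add: add_nonneg_pos)
    show "\<Sigma> \<subseteq> ball 0 ((cmod w + \<rho>) / 2)"
    proof
      fix v assume "v \<in> \<Sigma>"
      then show "v \<in> ball 0 ((cmod w + \<rho>) / 2)" using w(2)[of v] \<open>cmod w < \<rho>\<close> by simp
    qed
  qed
qed

text \<open>Closedness comes by complementation: the rest of the \<zeta>-plane is the image, under
  an open map, of the outside of the closed disc.\<close>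

lemma inner_part_compact:
  assumes "r < \<rho>" "\<Sigma> \<subseteq> ball 0 r"
  shows "compact (f ` (cball 0 r - \<Sigma>) \<union> J)" "f ` (cball 0 r - \<Sigma>) \<union> J \<subseteq> W"
proof -
  have "open (f ` (- cball 0 r))" by (rule f_open_map) (use assms(2) in auto)
  moreover have "f ` (cball 0 r - \<Sigma>) \<union> J = - f ` (- cball 0 r)"
  proof -
    have u: "f ` (cball 0 r - \<Sigma>) \<union> f ` (- cball 0 r) = - J"
      unfolding f_img[symmetric] image_Un[symmetric] using assms(2) by (intro arg_cong[of _ _ "image f"]) auto
    have "f ` (cball 0 r - \<Sigma>) \<inter> f ` (- cball 0 r) = f ` ((cball 0 r - \<Sigma>) \<inter> - cball 0 r)"
      by (rule inj_on_image_Int[OF f_inj, symmetric]) (use assms(2) in auto)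
    then have "f ` (cball 0 r - \<Sigma>) \<inter> f ` (- cball 0 r) = {}" by auto
    moreover have "S \<union> U = - T" if "S \<union> T = - U" "S \<inter> T = {}" for S T U :: "complex set"
      using that by blast
    ultimately show ?thesis using u by metis
  qed
  ultimately have "closed (f ` (cball 0 r - \<Sigma>) \<union> J)" by (metis closed_Compl)
  moreover have "bounded (f ` (cball 0 r - \<Sigma>) \<union> J)"
  proof -
    have "cball 0 r \<subseteq> ball 0 \<rho>" using assms(1) by auto
    then show ?thesis
      using fill_bounded[of \<rho>] J_compact by (auto simp: compact_imp_bounded intro: bounded_subset)
  qed
  ultimately show "compact (f ` (cball 0 r - \<Sigma>) \<union> J)" by (simp add: compact_eq_bounded_closed)
  show "f ` (cball 0 r - \<Sigma>) \<union> J \<subseteq> W" unfolding W_def using assms(1) by auto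
qed

lemma continuous_Inl: "continuous_map (subtopology X (topspace X - K)) X' Inl"
  unfolding continuous_map_def
proof (intro conjI allI impI)
  fix V assume "openin X' V"
  then have "openin X (Inl -` V)" "V \<subseteq> space'" using openin_X' by auto
  moreover have "{x \<in> topspace (subtopology X (topspace X - K)). Inl x \<in> V} = Inl -` V"
    using \<open>V \<subseteq> space'\<close> unfolding space'_def by auto
  moreover have "Inl -` V \<subseteq> topspace X - K" using \<open>V \<subseteq> space'\<close> unfolding space'_def by auto
  ultimately show "openin (subtopology X (topspace X - K)) {x \<in> topspace (subtopology X (topspace X - K)). Inl x \<in> V}"
    using openin_open_subtopology[OF openin_minus_K[OF openin_topspace]] by metis
qed (auto simp: topspace_X' space'_def)

text \<open>The closed coordinate disc is compact, hence closed in the whole of \<open>X\<close>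
  because \<open>X\<close> is Hausdorff.\<close>

lemma openin_far:
  assumes "r < \<rho>" "\<Sigma> \<subseteq> ball 0 r"
  shows "openin X (topspace X - {p \<in> fst c. snd c p \<in> cball 0 r})"
    "(topspace X - {p \<in> fst c. snd c p \<in> cball 0 r}) \<inter> K = {}"
proof -
  have "cball 0 r \<subseteq> snd c ` fst c" using disc assms(1) by (auto simp: subset_iff)
  then have "closedin X {p \<in> fst c. snd c p \<in> cball 0 r}"
    using compactin_imp_closedin[OF X_Hausdorff chart_compactin_preimage[OF c_chart compact_cball]] by blast
  then show "openin X (topspace X - {p \<in> fst c. snd c p \<in> cball 0 r})" by blast
  show "(topspace X - {p \<in> fst c. snd c p \<in> cball 0 r}) \<inter> K = {}"
    using assms(2) by (auto simp: cut_def subset_iff less_imp_le)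
qed

lemma Hausdorff_X': "Hausdorff_space X'"
  unfolding Hausdorff_space_def topspace_X'
proof (intro allI impI, elim conjE)
  have zeta: "\<exists>U V. openin X' U \<and> openin X' V \<and> x \<in> U \<and> y \<in> V \<and> disjnt U V"
    if "x \<in> fst Z" "y \<in> fst Z" "x \<noteq> y" for x y
  proof -
    have "snd Z x \<noteq> snd Z y" using inj_onD[OF Z_inj] that by blast
    then obtain U V where UV: "open U" "open V" "snd Z x \<in> U" "snd Z y \<in> V" "U \<inter> V = {}"
      using hausdorff by metis
    show ?thesis
      by (rule exI[of _ "{x \<in> fst Z. snd Z x \<in> U}"], rule exI[of _ "{x \<in> fst Z. snd Z x \<in> V}"])
        (use UV that openin_zeta in \<open>auto simp: disjnt_def\<close>)
  qed
  obtain r where r: "r < \<rho>" "\<Sigma> \<subseteq> ball 0 r" "0 < r" by (rule inner_radius)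
  \<comment> \<open>The one kind of pair that neither the \<zeta> chart nor the old surface
    separates: a point of the filling and a point outside the disc. The circle of radius r separates
    them.\<close>
  have far: "\<exists>U V. openin X' U \<and> openin X' V \<and> x \<in> U \<and> y \<in> V \<and> disjnt U V"
    if x: "x \<in> space' - fst Z" and y: "y \<in> Inr ` J" for x y
  proof -
    let ?U = "Inl ` (topspace X - {p \<in> fst c. snd c p \<in> cball 0 r})"
    let ?V = "{x \<in> fst Z. snd Z x \<in> f ` (ball 0 r - \<Sigma>) \<union> J}"
    have "openin X' ?U" by (intro openin_Inl openin_far r)
    moreover have "openin X' ?V" by (intro openin_zeta fill_open r)
    moreover have "x \<in> ?U" using x r unfolding space'_def fst_Z by (auto simp: coord_disc_def)
    moreover have "y \<in> ?V" using y unfolding fst_Z by auto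
    moreover have "disjnt ?U ?V"
    proof -
      have "snd c p \<in> ball 0 r" if in_D: "p \<in> D - K" and f_p: "f (snd c p) \<in> f ` (ball 0 r - \<Sigma>) \<union> J" for p
      proof -
        have p: "snd c p \<notin> \<Sigma>" using in_D D_sub D_K_Sig by blast
        then obtain w where "w \<in> ball 0 r - \<Sigma>" "f (snd c p) = f w" using f_p f_notin by blast
        then show ?thesis using inj_onD[OF f_inj, of "snd c p" w] p by auto
      qed
      then show ?thesis unfolding disjnt_iff fst_Z using D_sub by fastforce
    qed
    ultimately show ?thesis by blast
  qed
  fix x y assume xy: "x \<in> space'" "y \<in> space'" "x \<noteq> y"
  show "\<exists>U V. openin X' U \<and> openin X' V \<and> x \<in> U \<and> y \<in> V \<and> disjnt U V"
  proof (cases "x \<in> Inr ` J \<or> y \<in> Inr ` J")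
    case True
    have J_sub: "Inr ` J \<subseteq> fst Z" unfolding fst_Z by blast
    consider "x \<in> fst Z" "y \<in> fst Z" | "x \<in> space' - fst Z" "y \<in> Inr ` J" | "y \<in> space' - fst Z" "x \<in> Inr ` J"
      using True J_sub xy by blast
    then show ?thesis
    proof cases
      case 3
      then show ?thesis using far[OF 3] by (metis disjnt_sym)
    qed (use zeta far xy in auto)
  next
    case False
    then obtain p q where pq: "x = Inl p" "y = Inl q" "p \<in> topspace X - K" "q \<in> topspace X - K" "p \<noteq> q"
      using xy unfolding space'_def by blast
    then obtain U V where UV: "openin X U" "openin X V" "p \<in> U" "q \<in> V" "disjnt U V"
      using X_Hausdorff unfolding Hausdorff_space_def by blast
    show ?thesis
      by (rule exI[of _ "Inl ` (U - K)"], rule exI[of _ "Inl ` (V - K)"])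
        (use UV pq openin_Inl openin_minus_K in \<open>auto simp: disjnt_iff\<close>)
  qed
qed

lemma compact_X': "compact_space X'"
  unfolding compact_space_def topspace_X'
proof -
  obtain r where r: "r < \<rho>" "\<Sigma> \<subseteq> ball 0 r" "0 < r" by (rule inner_radius)
  \<comment> \<open>One compact piece is the old surface outside the open disc of radius r; the
    other is the closed refilled disc, seen in the \<zeta> chart.\<close>
  let ?C = "topspace X - {p \<in> fst c. snd c p \<in> ball 0 r}"
  have "closedin X ?C" using chart_openin_preimage[OF c_chart open_ball] by blast
  then have "compactin X ?C" using X_compact closedin_compact_space by blast
  moreover have "?C \<subseteq> topspace X - K" using r by (auto simp: cut_def)
  ultimately have "compactin (subtopology X (topspace X - K)) ?C" by (simp add: compactin_subtopology)
  then have 1: "compactin X' (Inl ` ?C)" by (rule image_compactin[OF _ continuous_Inl])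
  let ?B = "f ` (cball 0 r - \<Sigma>) \<union> J"
  have 2: "compactin X' {x \<in> fst Z. snd Z x \<in> ?B}"
    by (rule chart_compactin_preimage[OF Z_chart]) (use inner_part_compact[OF r(1,2)] Z_img in auto)
  have "space' = Inl ` ?C \<union> {x \<in> fst Z. snd Z x \<in> ?B}"
  proof
    show "Inl ` ?C \<union> {x \<in> fst Z. snd Z x \<in> ?B} \<subseteq> space'"
      using compactin_subset_topspace[OF 1] compactin_subset_topspace[OF 2] topspace_X' by blast
    show "space' \<subseteq> Inl ` ?C \<union> {x \<in> fst Z. snd Z x \<in> ?B}"
    proof
      fix x assume x: "x \<in> space'"
      show "x \<in> Inl ` ?C \<union> {x \<in> fst Z. snd Z x \<in> ?B}"
      proof (cases "x \<in> Inl ` ?C")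
        case False
        show ?thesis
        proof (cases x)
          case (Inl p)
          then have p: "p \<in> fst c" "snd c p \<in> ball 0 r" "p \<notin> K" using x False unfolding space'_def by auto
          then have "p \<in> D - K" using r(1) by (auto simp: coord_disc_def)
          moreover have "snd c p \<in> cball 0 r - \<Sigma>" using p by (auto simp: cut_def)
          ultimately show ?thesis unfolding Inl fst_Z by auto
        next
          case (Inr j)
          then show ?thesis using x unfolding space'_def fst_Z by auto
        qed
      qed blast
    qed
  qed
  then show "compactin X' space'" using compactin_Un[OF 1 2] by simp
qed

lemma W_connected: "connected W"
proof (rule open_connected_if_dense_part[OF W_open J_negligible])
  have "W - J = f ` (ball 0 \<rho> - \<Sigma>)" unfolding W_def using f_notin by blast
  moreover have "continuous_on (ball 0 \<rho> - \<Sigma>) f"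
    by (rule continuous_on_subset[OF holomorphic_on_imp_continuous_on[OF f_hol]]) auto
  ultimately show "connected (W - J)" using connected_continuous_image Sig_connected by metis
qed

text \<open>\<open>X - K\<close> need not be shown connected: a clopen partition of \<open>X'\<close> has the connected
  set \<open>fst Z\<close> on one side, and refilling the disc there gives a clopen partition of \<open>X\<close>.\<close>

lemma connected_X': "connected_space X'"
  unfolding connected_space_def topspace_X'
proof (rule notI, elim exE conjE)
  fix V1 V2 assume V: "openin X' V1" "openin X' V2" "space' \<subseteq> V1 \<union> V2" "V1 \<inter> V2 = {}" "V1 \<noteq> {}" "V2 \<noteq> {}"
  have no: False
    if "openin X' U1" "openin X' U2" "space' \<subseteq> U1 \<union> U2" "U1 \<inter> U2 = {}" "U2 \<noteq> {}" "fst Z \<subseteq> U1" for U1 U2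
  proof -
    have sub: "U2 \<subseteq> space'" using that(2) openin_X' by blast
    have "openin X (Inl -` U1 \<union> D)" using that(1) D_open openin_X' by blast
    moreover have "openin X (Inl -` U2)" using that(2) openin_X' by blast
    moreover have "topspace X \<subseteq> (Inl -` U1 \<union> D) \<union> Inl -` U2"
      using that(3) K_sub_D unfolding space'_def by blast
    moreover have "(Inl -` U1 \<union> D) \<inter> Inl -` U2 = {}"
      using that(4,6) sub unfolding fst_Z space'_def by blast
    moreover have "Inl -` U1 \<union> D \<noteq> {}"
      using Sig_ne Sig_ball c_D by blast
    moreover have "Inl -` U2 \<noteq> {}"
    proof -
      obtain x where x: "x \<in> U2" using \<open>U2 \<noteq> {}\<close> by blast
      then have "x \<in> space'" "x \<notin> fst Z" using that(4,6) sub by blast+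
      then obtain p where "x = Inl p" unfolding space'_def fst_Z by blast
      then show ?thesis using x by blast
    qed
    ultimately show False using X_connected unfolding connected_space_def by blast
  qed
  have Z_sub: "fst Z \<subseteq> space'" using openin_subset[OF Z_openin] topspace_X' by simp
  have "fst Z \<subseteq> V1 \<or> fst Z \<subseteq> V2"
  proof (rule ccontr)
    assume "\<not> (fst Z \<subseteq> V1 \<or> fst Z \<subseteq> V2)"
    then have ne: "V1 \<inter> fst Z \<noteq> {}" "V2 \<inter> fst Z \<noteq> {}" using Z_sub V(3) by blast+
    define T1 where "T1 = snd Z ` (V1 \<inter> fst Z)"
    define T2 where "T2 = snd Z ` (V2 \<inter> fst Z)"
    have "open T1" "open T2" using V(1,2) openin_X' by (auto simp: T1_def T2_def)
    moreover have "T1 \<inter> T2 = {}"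
      using inj_on_image_Int[OF Z_inj, of "V1 \<inter> fst Z" "V2 \<inter> fst Z"] V(4) unfolding T1_def T2_def by blast
    moreover have "W = T1 \<union> T2"
      unfolding Z_img[symmetric] T1_def T2_def image_Un[symmetric] using Z_sub V(3)
      by (intro arg_cong[of _ _ "image (snd Z)"]) blast
    moreover have "T1 \<noteq> {}" "T2 \<noteq> {}" using ne by (simp_all add: T1_def T2_def)
    ultimately show False using connectedD[OF W_connected, of T1 T2] by auto
  qed
  then show False
  proof
    assume "fst Z \<subseteq> V1"
    then show False by (intro no[of V1 V2]) (use V in auto)
  next
    assume "fst Z \<subseteq> V2"
    then show False by (intro no[of V2 V1]) (use V in auto)
  qed
qed


definition "g = inv_into (- \<Sigma>) f"

lemma g_f: "w \<notin> \<Sigma> \<Longrightarrow> g (f w) = w"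
  using f_inj by (simp add: g_def)

lemma g_hol: "g holomorphic_on - J"
  unfolding g_def by (rule inv_into_holomorphic[OF f_hol Sig_open f_bij])

lemma deriv_f_g: assumes "w \<notin> \<Sigma>" shows "deriv f w * deriv g (f w) = 1"
proof -
  have fd: "f field_differentiable at w"
    using f_hol Sig_open assms by (intro holomorphic_on_imp_differentiable_at) auto
  have gd: "g field_differentiable at (f w)"
    using g_hol J_open f_notin[OF assms] by (intro holomorphic_on_imp_differentiable_at) auto
  have "deriv (g \<circ> f) w = deriv (\<lambda>z. z) w"
  proof (rule complex_derivative_transform_within_open[OF _ _ Sig_open])
    show "(g \<circ> f) holomorphic_on - \<Sigma>"
      by (rule holomorphic_transform[OF holomorphic_on_ident]) (simp add: g_f)
  qed (use assms g_f in auto)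
  then show ?thesis using deriv_chain[OF fd gd] by (simp add: mult.commute)
qed

lemma transition_at:
  assumes "chart_on Y d1" "p \<in> fst d1" shows "transition d1 d2 (snd d1 p) = snd d2 p"
  using chart_inverse[OF assms] by (simp add: transition_def)

lemma Z_trans: assumes "p \<in> D - K" shows "transition Z e (f (snd c p)) = snd e (Inl p)"
proof -
  have "Inl p \<in> fst Z" using assms by (auto simp: fst_Z)
  from transition_at[OF Z_chart this] show ?thesis by simp
qed

lemma cc_trans: assumes "d \<in> A" "p \<in> fst d - K" shows "transition (cc d) e (snd d p) = snd e (Inl p)"
proof -
  have "Inl p \<in> fst (cc d)" using assms(2) by (auto simp: fst_cc)
  from transition_at[OF cc_chart[OF assms(1)] this] show ?thesis by simp
qed

lemma cc_image: "snd (cc d) ` fst (cc d) = snd d ` (fst d - K)"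
  by (force simp: fst_cc)

lemma open_chart_minus_K:
  assumes "d \<in> A" "openin X U" "U \<subseteq> fst d" shows "open (snd d ` (U - K))"
  by (rule chart_open_image[OF charts[OF assms(1)]]) (use assms openin_minus_K in auto)

lemma overlap_cc_cc: "snd (cc d) ` (fst (cc d) \<inter> fst (cc e)) = snd d ` (fst d \<inter> fst e - K)"
  by (force simp: fst_cc)

lemma overlap_cc_Z: "snd (cc d) ` (fst (cc d) \<inter> fst Z) = snd d ` (fst d \<inter> D - K)"
  by (force simp: fst_cc fst_Z)

lemma overlap_Z_cc: "snd Z ` (fst Z \<inter> fst (cc e)) = f ` snd c ` (fst e \<inter> D - K)"
  by (force simp: fst_cc fst_Z image_iff)

lemma open_overlap: assumes "d \<in> A"
  shows "e \<in> A \<Longrightarrow> open (snd d ` (fst d \<inter> fst e - K))" "open (snd d ` (fst d \<inter> D - K))"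
    "open (snd c ` (fst d \<inter> D - K))" "open (f ` snd c ` (fst d \<inter> D - K))"
proof -
  have o: "openin X (fst d)" if "d \<in> A" for d using chart_openin[OF charts[OF that]] .
  show "open (snd d ` (fst d \<inter> fst e - K))" if "e \<in> A"
    by (rule open_chart_minus_K[OF assms openin_Int[OF o[OF assms] o[OF that]]]) simp
  show "open (snd d ` (fst d \<inter> D - K))"
    by (rule open_chart_minus_K[OF assms openin_Int[OF o[OF assms] D_open]]) simp
  show *: "open (snd c ` (fst d \<inter> D - K))"
    by (rule open_chart_minus_K[OF c_in]) (use o[OF assms] D_open D_sub in auto)
  show "open (f ` snd c ` (fst d \<inter> D - K))"
    by (rule f_open_map[OF *]) (use D_sub D_K_Sig in blast)
qed

lemma open_chart_Int: assumes "d \<in> A" "e \<in> A" shows "open (snd d ` (fst d \<inter> fst e))"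
  by (rule chart_open_image[OF charts[OF assms(1)]
        openin_Int[OF chart_openin[OF charts[OF assms(1)]] chart_openin[OF charts[OF assms(2)]]]]) simp

lemma trans_cc_cc: assumes "d \<in> A" "e \<in> A" "z \<in> snd d ` (fst d \<inter> fst e - K)"
  shows "transition (cc d) (cc e) z = transition d e z"
proof -
  obtain p where p: "p \<in> fst d \<inter> fst e - K" "z = snd d p" using assms(3) by blast
  then show ?thesis using cc_trans[OF assms(1), of p "cc e"] transition_at[OF charts[OF assms(1)], of p e] by simp
qed

lemma trans_cc_Z: assumes "d \<in> A" "z \<in> snd d ` (fst d \<inter> D - K)"
  shows "transition (cc d) Z z = (f \<circ> transition d c) z"
proof -
  obtain p where p: "p \<in> fst d \<inter> D - K" "z = snd d p" using assms(2) by blast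
  then show ?thesis using cc_trans[OF assms(1), of p Z] transition_at[OF charts[OF assms(1)], of p c] by simp
qed

lemma trans_Z_cc: assumes "e \<in> A" "z \<in> f ` snd c ` (fst e \<inter> D - K)"
  shows "transition Z (cc e) z = (transition c e \<circ> g) z"
proof -
  obtain p where p: "p \<in> fst e \<inter> D - K" "z = f (snd c p)" using assms(2) by blast
  have "p \<in> fst c - K" using p D_sub by blast
  then have "g z = snd c p" using p(2) g_f D_K_Sig by simp
  then show ?thesis using p \<open>p \<in> fst c - K\<close> Z_trans[of p "cc e"] transition_at[OF c_chart, of p e] by simp
qed

lemma trans_Z_Z: "z \<in> W \<Longrightarrow> transition Z Z z = z"
  unfolding Z_img[symmetric] using transition_at[OF Z_chart, of _ Z] by blast

lemma f_trans_hol: assumes "d \<in> A" shows "(f \<circ> transition d c) holomorphic_on snd d ` (fst d \<inter> D - K)"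
proof (rule holomorphic_on_compose_gen[OF _ f_hol])
  show "transition d c holomorphic_on snd d ` (fst d \<inter> D - K)"
    by (rule holomorphic_on_subset[OF trans_hol[OF assms c_in]]) (use D_sub in blast)
  show "transition d c ` snd d ` (fst d \<inter> D - K) \<subseteq> - \<Sigma>"
    using transition_at[OF charts[OF assms], of _ c] D_sub D_K_Sig by auto
qed

lemma trans_g_hol: assumes "e \<in> A" shows "(transition c e \<circ> g) holomorphic_on f ` snd c ` (fst e \<inter> D - K)"
proof (rule holomorphic_on_compose_gen[OF holomorphic_on_subset[OF g_hol] trans_hol[OF c_in assms]])
  have sig: "snd c p \<notin> \<Sigma>" if "p \<in> fst e \<inter> D - K" for p using that D_sub D_K_Sig by blast
  then show "f ` snd c ` (fst e \<inter> D - K) \<subseteq> - J" using f_notin by blast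
  show "g ` f ` snd c ` (fst e \<inter> D - K) \<subseteq> snd c ` (fst c \<inter> fst e)"
    using g_f[OF sig] D_sub by auto
qed

lemma riemann_surface_X': "riemann_surface X' A'"
  unfolding riemann_surface_def
proof (intro conjI ballI)
  show "topspace X' \<noteq> {}" using J_ne by (auto simp: topspace_X' space'_def)
  show "(\<Union>d\<in>A'. fst d) = topspace X'"
  proof -
    have "(\<Union>d\<in>A'. fst d) = fst Z \<union> (\<Union>d\<in>A. fst (cc d))" by (simp add: deformed_atlas_def)
    also have "(\<Union>d\<in>A. fst (cc d)) = Inl ` (topspace X - K)" unfolding fst_cc X_cover[symmetric] by blast
    also have "fst Z \<union> \<dots> = space'"
      unfolding fst_Z space'_def using D_sub chart_subset[OF c_chart] by blast
    finally show ?thesis by (simp add: topspace_X')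
  qed
  show "chart_on X' d" if "d \<in> A'" for d
    using that Z_chart cc_chart by (auto simp: deformed_atlas_def)
  fix d' e' assume "d' \<in> A'" "e' \<in> A'"
  \<comment> \<open>The new transitions are the identity, the old transitions off the cut, and old
    transitions composed with \<open>f\<close> or with its inverse \<open>g\<close>.\<close>
  then consider "d' = Z" "e' = Z" | e where "d' = Z" "e \<in> A" "e' = cc e" | d where "d' = cc d" "d \<in> A" "e' = Z"
    | d e where "d' = cc d" "e' = cc e" "d \<in> A" "e \<in> A" by (auto simp: deformed_atlas_def)
  then show "transition d' e' holomorphic_on snd d' ` (fst d' \<inter> fst e')"
  proof cases
    case 1
    have "(\<lambda>z. z) holomorphic_on W" by (rule holomorphic_on_ident)
    then have "transition Z Z holomorphic_on W" by (rule holomorphic_transform) (simp add: trans_Z_Z)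
    then show ?thesis using 1 Z_img by simp
  next
    case 2
    show ?thesis unfolding 2 overlap_Z_cc
      by (rule holomorphic_transform[OF trans_g_hol[OF 2(2)]]) (simp add: trans_Z_cc 2)
  next
    case 3
    show ?thesis unfolding 3 overlap_cc_Z
      by (rule holomorphic_transform[OF f_trans_hol[OF 3(2)]]) (simp add: trans_cc_Z 3)
  next
    case 4
    have "transition d e holomorphic_on snd d ` (fst d \<inter> fst e - K)"
      by (rule holomorphic_on_subset[OF trans_hol[OF 4(3,4)]]) blast
    then show ?thesis unfolding 4 overlap_cc_cc
      by (rule holomorphic_transform) (simp add: trans_cc_cc 4)
  qed
qed (rule Hausdorff_X' connected_X')+

lemma compact_riemann_surface_X': "compact_riemann_surface X' A'"
  using riemann_surface_X' compact_X' by (simp add: compact_riemann_surface_def)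

text \<open>Points of \<open>J\<close> lie in the \<zeta> chart and in no cut chart. This makes a
  definition of differentials by cases on the chart consistent.\<close>

lemma Z_ne_cc: "Z \<noteq> cc d"
proof
  assume "Z = cc d"
  then have "fst Z = fst (cc d)" by simp
  then show False using J_ne unfolding fst_Z fst_cc by blast
qed

end

section \<open>The differential on the reglued surface\<close>

locale surgery_differential = surgery +
  fixes \<omega> :: "'a differential" and F :: "complex \<Rightarrow> complex"
  assumes omega: "holomorphic_differential A \<omega>" and F_hol: "F holomorphic_on W"
    and F_eq: "\<And>w. w \<in> ball 0 \<rho> - \<Sigma> \<Longrightarrow> \<omega> c w = F (f w) * deriv f w"
begin

lemma omega_hol: "d \<in> A \<Longrightarrow> \<omega> d holomorphic_on snd d ` fst d"
  and omega_trans: "d \<in> A \<Longrightarrow> e \<in> A \<Longrightarrow> p \<in> fst d \<inter> fst e \<Longrightarrow>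
    \<omega> d (snd d p) = \<omega> e (snd e p) * deriv (transition d e) (snd d p)"
  using omega unfolding holomorphic_differential_def by blast+

text \<open>Distinct charts of \<open>A\<close> may coincide once the cut is removed from their
  domains. Their coordinate functions then agree, the transition is the identity, and so the
  coefficient attached to a cut chart is well defined.\<close>

lemma same_cut_chart:
  assumes "d \<in> A" "e \<in> A" "cc d = cc e" "z \<in> snd d ` (fst d - K)"
  shows "\<omega> d z = \<omega> e z"
proof -
  obtain p where p: "p \<in> fst d - K" "z = snd d p" using assms(4) by blast
  have eq: "fst d - K = fst e - K" using arg_cong[OF assms(3), of fst] unfolding fst_cc by blast
  have snd_eq: "snd e q = snd d q" for q using arg_cong[OF assms(3), of "\<lambda>x. snd x (Inl q)"] by simp
  have int: "fst d - K = fst d \<inter> fst e - K" using eq by blast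
  have "deriv (transition d e) z = deriv (\<lambda>w. w) z"
  proof (rule complex_derivative_transform_within_open)
    show "transition d e holomorphic_on snd d ` (fst d - K)"
      by (rule holomorphic_on_subset[OF trans_hol[OF assms(1,2)]]) (use int in blast)
    show "open (snd d ` (fst d - K))" using open_overlap(1)[OF assms(1,2)] int by simp
    show "transition d e w = w" if "w \<in> snd d ` (fst d - K)" for w
      using that transition_at[OF charts[OF assms(1)], of _ e] snd_eq by auto
  qed (use assms(4) in \<open>auto intro: holomorphic_on_ident\<close>)
  moreover have "p \<in> fst d \<inter> fst e" using p eq by blast
  ultimately show ?thesis using omega_trans[OF assms(1,2), of p] p(2) snd_eq[of p] by simp
qed

text \<open>An old chart behind each new one; the \<zeta> chart gets \<open>c\<close>, whose
  coordinate it reparametrises. Besides indexing coefficients, it later carries pieces back in the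
  comparison of norms.\<close>

definition "source_chart e = (if e = Z then c else SOME d. d \<in> A \<and> e = cc d)"

lemma source_chart_in: assumes "e \<in> A'" shows "source_chart e \<in> A" "e \<noteq> Z \<Longrightarrow> cc (source_chart e) = e"
proof -
  have "source_chart e \<in> A \<and> e = cc (source_chart e)" if "e \<noteq> Z"
    unfolding source_chart_def using that assms someI_ex[of "\<lambda>d. d \<in> A \<and> e = cc d"]
    by (auto simp: deformed_atlas_def)
  then show "source_chart e \<in> A" "e \<noteq> Z \<Longrightarrow> cc (source_chart e) = e" using c_in by (auto simp: source_chart_def)
qed

definition "filled_diff e = (if e = Z then F else \<omega> (source_chart e))"

lemma filled_diff_cc: assumes "d \<in> A" "z \<in> snd d ` (fst d - K)" shows "filled_diff (cc d) z = \<omega> d z"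
proof -
  have "cc d \<in> A'" using assms(1) by (simp add: deformed_atlas_def)
  then have "source_chart (cc d) \<in> A" "cc (source_chart (cc d)) = cc d" using source_chart_in Z_ne_cc by metis+
  then show ?thesis using same_cut_chart[OF assms(1) _ _ assms(2)] Z_ne_cc Z_ne_cc[symmetric] by (simp add: filled_diff_def)
qed

lemma is_deformed_filled_diff: "is_deformed_differential A \<omega> c \<rho> \<Sigma> J f filled_diff"
  unfolding is_deformed_differential_def
proof (intro conjI ballI)
  show "filled_diff (cc d) z = \<omega> d z" if "d \<in> A" "z \<in> snd d ` (fst d - K)" for d z
    by (rule filled_diff_cc[OF that])
  show "holomorphic_differential A' filled_diff"
    unfolding holomorphic_differential_def
  proof (intro conjI ballI)
    fix d' assume "d' \<in> A'"
    then consider "d' = Z" | d where "d' = cc d" "d \<in> A" by (auto simp: deformed_atlas_def)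
    then show "filled_diff d' holomorphic_on snd d' ` fst d'"
    proof cases
      case 1 then show ?thesis using F_hol Z_img by (simp add: filled_diff_def)
    next
      case 2
      have "\<omega> d holomorphic_on snd d ` (fst d - K)"
        by (rule holomorphic_on_subset[OF omega_hol[OF 2(2)]]) blast
      then show ?thesis unfolding 2 cc_image
        by (rule holomorphic_transform) (simp add: filled_diff_cc[OF 2(2)])
    qed
  next
    fix d' e' x assume "d' \<in> A'" "e' \<in> A'" and x: "x \<in> fst d' \<inter> fst e'"
    then consider "d' = Z" "e' = Z" | e where "d' = Z" "e \<in> A" "e' = cc e" | d where "d' = cc d" "d \<in> A" "e' = Z"
      | d e where "d' = cc d" "e' = cc e" "d \<in> A" "e \<in> A" by (auto simp: deformed_atlas_def)
    then show "filled_diff d' (snd d' x) = filled_diff e' (snd e' x) * deriv (transition d' e') (snd d' x)"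
    proof cases
      case 1
      have "deriv (transition Z Z) (snd Z x) = deriv (\<lambda>z. z) (snd Z x)"
      proof (rule complex_derivative_transform_within_open[OF _ _ W_open])
        show "transition Z Z holomorphic_on W"
          by (rule holomorphic_transform[OF holomorphic_on_ident]) (simp add: trans_Z_Z)
        show "snd Z x \<in> W" using x 1 Z_img by blast
      qed (auto simp: trans_Z_Z)
      then show ?thesis using 1 by simp
    next
      case 2
      obtain p where p: "p \<in> fst e \<inter> D - K" "x = Inl p" using x unfolding 2 fst_cc fst_Z by blast
      have sig: "snd c p \<notin> \<Sigma>" and pc: "p \<in> fst c \<inter> fst e" and ball: "snd c p \<in> ball 0 \<rho> - \<Sigma>"
        using p D_sub D_K_Sig c_D_K by blast+
      let ?z = "f (snd c p)"
      have z: "?z \<in> f ` snd c ` (fst e \<inter> D - K)" using p by blast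
      have "deriv (transition Z (cc e)) ?z = deriv (transition c e \<circ> g) ?z"
      proof (rule complex_derivative_transform_within_open[OF _ _ open_overlap(4)[OF 2(2)] z])
        show "transition Z (cc e) holomorphic_on f ` snd c ` (fst e \<inter> D - K)"
          by (rule holomorphic_transform[OF trans_g_hol[OF 2(2)]]) (simp add: trans_Z_cc 2)
      qed (use trans_g_hol 2 trans_Z_cc in auto)
      also have "\<dots> = deriv (transition c e) (g ?z) * deriv g ?z"
      proof (rule deriv_chain)
        show "g field_differentiable at ?z"
          using g_hol J_open f_notin[OF sig] by (auto intro: holomorphic_on_imp_differentiable_at)
        show "transition c e field_differentiable at (g ?z)"
          using open_chart_Int[OF c_in 2(2)] trans_hol[OF c_in 2(2)] pc unfolding g_f[OF sig]
          by (intro holomorphic_on_imp_differentiable_at) auto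
      qed
      finally have d: "deriv (transition Z (cc e)) ?z = deriv (transition c e) (snd c p) * deriv g ?z"
        by (simp add: g_f[OF sig])
      \<comment> \<open>The derivatives of \<open>f\<close> and \<open>g\<close> are reciprocal,
        which turns the pullback identity \<open>F_eq\<close> into its pushforward form.\<close>
      have "deriv f (snd c p) * deriv g ?z = 1"
        using deriv_f_g[OF sig] by simp
      then have "F ?z = \<omega> c (snd c p) * deriv g ?z" using F_eq[OF ball] by (simp add: mult.assoc)
      also have "\<dots> = \<omega> e (snd e p) * deriv (transition Z (cc e)) ?z"
        using omega_trans[OF c_in 2(2) pc] d by (simp add: mult.assoc)
      finally show ?thesis using 2 p filled_diff_cc[OF 2(2), of "snd e p"] by (simp add: filled_diff_def)
    next
      case 3
      obtain p where p: "p \<in> fst d \<inter> D - K" "x = Inl p" using x unfolding 3 fst_cc fst_Z by blast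
      have sig: "snd c p \<notin> \<Sigma>" and pc: "p \<in> fst d \<inter> fst c" and ball: "snd c p \<in> ball 0 \<rho> - \<Sigma>"
        using p D_sub D_K_Sig c_D_K by blast+
      have z: "snd d p \<in> snd d ` (fst d \<inter> D - K)" using p by blast
      have tr: "transition d c (snd d p) = snd c p" using transition_at[OF charts[OF 3(2)]] p by blast
      have "deriv (transition (cc d) Z) (snd d p) = deriv (f \<circ> transition d c) (snd d p)"
      proof (rule complex_derivative_transform_within_open[OF _ _ open_overlap(2)[OF 3(2)] z])
        show "transition (cc d) Z holomorphic_on snd d ` (fst d \<inter> D - K)"
          by (rule holomorphic_transform[OF f_trans_hol[OF 3(2)]]) (simp add: trans_cc_Z 3)
      qed (use f_trans_hol 3 trans_cc_Z in auto)
      also have "\<dots> = deriv f (transition d c (snd d p)) * deriv (transition d c) (snd d p)"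
      proof (rule deriv_chain)
        show "transition d c field_differentiable at (snd d p)"
          using open_chart_Int[OF 3(2) c_in] trans_hol[OF 3(2) c_in] pc by (intro holomorphic_on_imp_differentiable_at) auto
        show "f field_differentiable at (transition d c (snd d p))"
          unfolding tr using f_hol Sig_open sig by (intro holomorphic_on_imp_differentiable_at) auto
      qed
      finally have dv: "deriv (transition (cc d) Z) (snd d p) = deriv f (snd c p) * deriv (transition d c) (snd d p)"
        by (simp add: tr)
      have "\<omega> d (snd d p) = F (f (snd c p)) * deriv (transition (cc d) Z) (snd d p)"
        using omega_trans[OF 3(2) c_in pc] F_eq[OF ball] dv by (simp add: mult.assoc)
      then show ?thesis using 3 p filled_diff_cc[OF 3(2), of "snd d p"] by (simp add: filled_diff_def)
    next
      case 4
      obtain p where p: "p \<in> fst d \<inter> fst e - K" "x = Inl p" using x unfolding 4 fst_cc by blast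
      have "deriv (transition (cc d) (cc e)) (snd d p) = deriv (transition d e) (snd d p)"
      proof (rule complex_derivative_transform_within_open[OF _ _ open_overlap(1)[OF 4(3,4)]])
        show h: "transition d e holomorphic_on snd d ` (fst d \<inter> fst e - K)"
          by (rule holomorphic_on_subset[OF trans_hol[OF 4(3,4)]]) blast
        show "transition (cc d) (cc e) holomorphic_on snd d ` (fst d \<inter> fst e - K)"
          by (rule holomorphic_transform[OF h]) (simp add: trans_cc_cc 4)
      qed (use 4 p trans_cc_cc in auto)
      then show ?thesis
        using 4 p filled_diff_cc[OF 4(3), of "snd d p"] filled_diff_cc[OF 4(4), of "snd e p"] omega_trans[OF 4(3,4), of p]
        by simp
    qed
  qed
qed

end

section \<open>Periods and norm under regluing\<close>

lemma nn_set_integral_cong_null: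
  assumes "N \<in> null_sets lborel" "\<And>x. x \<notin> N \<Longrightarrow> x \<in> S \<longleftrightarrow> x \<in> T"
    and "\<And>x. x \<in> S \<inter> T \<Longrightarrow> h x = k x"
  shows "(\<integral>\<^sup>+x\<in>S. h x \<partial>lborel) = (\<integral>\<^sup>+x\<in>T. k x \<partial>lborel)"
proof (rule nn_integral_cong_AE)
  show "AE x in lborel. h x * indicator S x = k x * indicator T x"
    by (rule AE_I'[OF assms(1)]) (use assms(2,3) in \<open>auto simp: indicator_def split: if_splits\<close>)
qed

lemma null_sets_lborel_negligible: "negligible N \<Longrightarrow> N \<in> sets borel \<Longrightarrow> N \<in> null_sets lborel"
  by (simp add: negligible_iff_null_sets null_sets_completion_iff)

abbreviation piece_norm :: "'b differential \<Rightarrow> 'b chart \<times> 'b set \<Rightarrow> ennreal" where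
  "piece_norm \<omega> \<equiv> (\<lambda>(c, E). \<integral>\<^sup>+z\<in>snd c ` E. ennreal ((cmod (\<omega> c z))\<^sup>2) \<partial>lborel)"

context surgery
begin

lemma piecewise_C1_path_Inl:
  assumes "piecewise_C1_path X A \<gamma>" and far: "\<gamma> ` {0..1} \<inter> D = {}"
  shows "piecewise_C1_path X' A' (Inl \<circ> \<gamma>)"
  unfolding piecewise_C1_path_def
proof (intro conjI ballI allI impI)
  have "pathin X \<gamma>" using assms(1) by (simp add: piecewise_C1_path_def)
  then have cont: "continuous_map (top_of_set {0..1}) X \<gamma>" by (simp add: pathin_def)
  then have "\<gamma> ` {0..1} \<subseteq> topspace X" using continuous_map_image_subset_topspace by fastforce
  then have "continuous_map (top_of_set {0..1}) (subtopology X (topspace X - K)) \<gamma>"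
    using cont far K_sub_D unfolding continuous_map_in_subtopology by auto
  then show "pathin X' (Inl \<circ> \<gamma>)"
    unfolding pathin_def by (rule continuous_map_compose[OF _ continuous_Inl])
  fix e a b assume e: "e \<in> A'" and ab: "0 \<le> a \<and> a \<le> b \<and> b \<le> 1 \<and> (Inl \<circ> \<gamma>) ` {a..b} \<subseteq> fst e"
  have "e \<noteq> Z"
  proof
    assume "e = Z"
    then have "Inl (\<gamma> a) \<in> fst Z" using ab by auto
    then have "\<gamma> a \<in> D" unfolding fst_Z by auto
    moreover have "a \<in> {0..1}" using ab by simp
    ultimately show False using far by blast
  qed
  then obtain d where d: "d \<in> A" "e = cc d" using e by (auto simp: deformed_atlas_def)
  have "\<gamma> ` {a..b} \<subseteq> fst d"
  proof (rule image_subsetI)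
    fix x assume "x \<in> {a..b}"
    then have "(Inl \<circ> \<gamma>) x \<in> fst e" using ab by blast
    then show "\<gamma> x \<in> fst d" using d(2) by (auto simp: fst_cc)
  qed
  then have "(snd d \<circ> \<gamma>) piecewise_C1_differentiable_on {a..b}"
    using assms(1) d(1) ab unfolding piecewise_C1_path_def by blast
  moreover have "snd e \<circ> (Inl \<circ> \<gamma>) = snd d \<circ> \<gamma>" using d(2) by (simp add: fun_eq_iff)
  ultimately show "(snd e \<circ> (Inl \<circ> \<gamma>)) piecewise_C1_differentiable_on {a..b}" by simp
qed

lemma one_cycle_Inl:
  assumes C: "one_cycle X A C" and far: "\<forall>(k, \<gamma>)\<in>set C. \<gamma> ` {0..1} \<inter> D = {}"
  shows "one_cycle X' A' (map (\<lambda>(k, \<gamma>). (k, Inl \<circ> \<gamma>)) C)"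
  unfolding one_cycle_def
proof (intro conjI allI)
  show "\<forall>(k, \<gamma>)\<in>set (map (\<lambda>(k, \<gamma>). (k, Inl \<circ> \<gamma>)) C). piecewise_C1_path X' A' \<gamma>"
    using C far piecewise_C1_path_Inl unfolding one_cycle_def by fastforce
  fix x :: "'a + complex"
  show "(\<Sum>(k, \<gamma>)\<leftarrow>map (\<lambda>(k, \<gamma>). (k, Inl \<circ> \<gamma>)) C. k * (of_bool (\<gamma> 1 = x) - of_bool (\<gamma> 0 = x))) = 0"
  proof (cases x)
    case (Inl p)
    have "(\<Sum>(k, \<gamma>)\<leftarrow>C. k * (of_bool (\<gamma> 1 = p) - of_bool (\<gamma> 0 = p))) = 0"
      using C unfolding one_cycle_def by blast
    then show ?thesis by (simp add: Inl o_def case_prod_unfold)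
  next
    case (Inr j)
    then show ?thesis by (simp add: o_def case_prod_unfold sum_list_0)
  qed
qed

lemma subdivision_in_unit_interval:
  assumes "t 0 = (0::real)" "t N = 1" "\<forall>i<N. t i \<le> t (Suc i)" "i < N"
  shows "{t i..t (Suc i)} \<subseteq> {0..1}"
proof -
  have "t i \<le> t j" if "i \<le> j" "j \<le> N" for i j
    using that by (induction j rule: dec_induct) (use assms(3) in \<open>auto intro: order_trans\<close>)
  from this[of 0 i] this[of "Suc i" N] show ?thesis using assms by auto
qed

text \<open>The relations themselves agree, so that \<^const>\<open>line_integral\<close>, a definite description,
  agrees without any appeal to uniqueness of the integral.\<close>

lemma has_line_integral_Inl:
  assumes far: "\<gamma> ` {0..1} \<inter> D = {}"
    and om': "\<And>d z. d \<in> A \<Longrightarrow> z \<in> snd d ` (fst d - K) \<Longrightarrow> \<omega>' (cc d) z = \<omega> d z"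
  shows "has_line_integral A' \<omega>' (Inl \<circ> \<gamma>) I \<longleftrightarrow> has_line_integral A \<omega> \<gamma> I"
proof
  have piece: "(\<omega>' (cc d) has_contour_integral J) (subpath u v (snd (cc d) \<circ> (Inl \<circ> \<gamma>)))
      \<longleftrightarrow> (\<omega> d has_contour_integral J) (subpath u v (snd d \<circ> \<gamma>))"
    if d: "d \<in> A" "u \<le> v" "\<gamma> ` {u..v} \<subseteq> fst d - K" for d u v J
  proof -
    have eq: "snd (cc d) \<circ> (Inl \<circ> \<gamma>) = snd d \<circ> \<gamma>" by (simp add: fun_eq_iff)
    have "\<omega>' (cc d) z = \<omega> d z" if "z \<in> path_image (subpath u v (snd d \<circ> \<gamma>))" for z
    proof (rule om'[OF d(1)])
      have "z \<in> (snd d \<circ> \<gamma>) ` {u..v}" using that d(2) by (simp add: path_image_subpath)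
      then show "z \<in> snd d ` (fst d - K)" using d(3) by auto
    qed
    then show ?thesis unfolding eq by (metis has_contour_integral_eq)
  qed
  {
    assume "has_line_integral A' \<omega>' (Inl \<circ> \<gamma>) I"
    then obtain N :: nat and t e J where h: "t 0 = 0" "t N = 1"
      "\<forall>i<N. t i \<le> t (Suc i) \<and> e i \<in> A' \<and> (Inl \<circ> \<gamma>) ` {t i..t (Suc i)} \<subseteq> fst (e i) \<and>
        (\<omega>' (e i) has_contour_integral J i) (subpath (t i) (t (Suc i)) (snd (e i) \<circ> (Inl \<circ> \<gamma>)))"
      "I = (\<Sum>i<N. J i)"
      unfolding has_line_integral_def by blast
    have "\<exists>d. d \<in> A \<and> e i = cc d" if "i < N" for i
    proof -
      \<comment> \<open>The left end of a subinterval is mapped outside \<open>D\<close>, which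
        already excludes the \<zeta> chart.\<close>
      have t: "t i \<in> {t i..t (Suc i)}" using h(3) that by auto
      then have "t i \<in> {0..1}" using subdivision_in_unit_interval[OF h(1,2) _ that] h(3) by blast
      then have "\<gamma> (t i) \<notin> D" using far by blast
      moreover have "Inl (\<gamma> (t i)) \<in> fst (e i)" using h(3) that t by (auto simp: image_subset_iff)
      ultimately have "e i \<noteq> Z" using fst_Z by auto
      moreover have "e i \<in> insert Z (cc ` A)" using h(3) that unfolding deformed_atlas_def by blast
      ultimately show ?thesis by blast
    qed
    then obtain d where d: "\<And>i. i < N \<Longrightarrow> d i \<in> A \<and> e i = cc (d i)" by metis
    have img: "\<gamma> ` {t i..t (Suc i)} \<subseteq> fst (d i) - K" if "i < N" for i
    proof (rule image_subsetI)
      fix x assume "x \<in> {t i..t (Suc i)}"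
      then have "(Inl \<circ> \<gamma>) x \<in> fst (e i)" using h(3) that by blast
      then show "\<gamma> x \<in> fst (d i) - K" using d[OF that] by (auto simp: fst_cc)
    qed
    show "has_line_integral A \<omega> \<gamma> I"
      unfolding has_line_integral_def
    proof (intro exI[of _ N] exI[of _ t] exI[of _ d] exI[of _ J] conjI h allI impI)
      fix i assume i: "i < N"
      show "t i \<le> t (Suc i)" "d i \<in> A" using h(3) d i by auto
      show "\<gamma> ` {t i..t (Suc i)} \<subseteq> fst (d i)" using img[OF i] by blast
      have "(\<omega>' (cc (d i)) has_contour_integral J i) (subpath (t i) (t (Suc i)) (snd (cc (d i)) \<circ> (Inl \<circ> \<gamma>)))"
        using h(3) d[OF i] i by metis
      then show "(\<omega> (d i) has_contour_integral J i) (subpath (t i) (t (Suc i)) (snd (d i) \<circ> \<gamma>))"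
        using piece[OF _ _ img[OF i]] h(3) d[OF i] i by blast
    qed
  }
  {
    assume "has_line_integral A \<omega> \<gamma> I"
    then obtain N :: nat and t d J where h: "t 0 = 0" "t N = 1"
      "\<forall>i<N. t i \<le> t (Suc i) \<and> d i \<in> A \<and> \<gamma> ` {t i..t (Suc i)} \<subseteq> fst (d i) \<and>
        (\<omega> (d i) has_contour_integral J i) (subpath (t i) (t (Suc i)) (snd (d i) \<circ> \<gamma>))"
      "I = (\<Sum>i<N. J i)"
      unfolding has_line_integral_def by blast
    have img: "\<gamma> ` {t i..t (Suc i)} \<subseteq> fst (d i) - K" if "i < N" for i
    proof -
      have "\<gamma> ` {t i..t (Suc i)} \<subseteq> \<gamma> ` {0..1}"
        using subdivision_in_unit_interval[OF h(1,2) _ that] h(3) by (intro image_mono) auto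
      then show ?thesis using h(3) that far K_sub_D by blast
    qed
    show "has_line_integral A' \<omega>' (Inl \<circ> \<gamma>) I"
      unfolding has_line_integral_def
    proof (intro exI[of _ N] exI[of _ t] exI[of _ "\<lambda>i. cc (d i)"] exI[of _ J] conjI h allI impI)
      fix i assume i: "i < N"
      show "t i \<le> t (Suc i)" "cc (d i) \<in> A'" using h(3) i by (auto simp: deformed_atlas_def)
      show "(Inl \<circ> \<gamma>) ` {t i..t (Suc i)} \<subseteq> fst (cc (d i))"
        unfolding fst_cc image_comp[symmetric] using img[OF i] by (rule image_mono)
      show "(\<omega>' (cc (d i)) has_contour_integral J i) (subpath (t i) (t (Suc i)) (snd (cc (d i)) \<circ> (Inl \<circ> \<gamma>)))"
        using piece[OF _ _ img[OF i]] h(3) i by blast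
    qed
  }
qed

lemma period_Inl:
  assumes far: "\<forall>(k, \<gamma>)\<in>set C. \<gamma> ` {0..1} \<inter> D = {}"
    and om': "\<And>d z. d \<in> A \<Longrightarrow> z \<in> snd d ` (fst d - K) \<Longrightarrow> \<omega>' (cc d) z = \<omega> d z"
  shows "period A' \<omega>' (map (\<lambda>(k, \<gamma>). (k, Inl \<circ> \<gamma>)) C) = period A \<omega> C"
proof -
  have li: "line_integral A' \<omega>' (Inl \<circ> \<gamma>) = line_integral A \<omega> \<gamma>" if "(k, \<gamma>) \<in> set C" for k \<gamma>
  proof -
    have "\<gamma> ` {0..1} \<inter> D = {}" using far that by blast
    then have "has_line_integral A' \<omega>' (Inl \<circ> \<gamma>) = has_line_integral A \<omega> \<gamma>"
      by (intro ext has_line_integral_Inl om')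
    then show ?thesis unfolding line_integral_def by simp
  qed
  have "map ((\<lambda>(k, \<gamma>). of_int k * line_integral A' \<omega>' \<gamma>) \<circ> (\<lambda>(k, \<gamma>). (k, Inl \<circ> \<gamma>))) C
      = map (\<lambda>(k, \<gamma>). of_int k * line_integral A \<omega> \<gamma>) C"
    by (rule map_cong[OF refl]) (use li in auto)
  then show ?thesis unfolding period_def map_map by (rule arg_cong)
qed

text \<open>In \<open>c\<close> the cut is the null set \<Sigma>; transitions are differentiable, so
  it remains null in every other chart.\<close>

lemma negligible_cut_image: assumes "d \<in> A" shows "snd d ` fst d - snd d ` (fst d - K) \<in> null_sets lborel"
proof (rule null_sets_lborel_negligible)
  have "negligible (transition c d ` (\<Sigma> \<inter> snd c ` (fst c \<inter> fst d)))"
  proof (rule negligible_differentiable_image_negligible)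
    show "negligible (\<Sigma> \<inter> snd c ` (fst c \<inter> fst d))" using Sig_negligible by (rule negligible_subset) simp
    have "transition c d differentiable_on snd c ` (fst c \<inter> fst d)"
      using trans_hol[OF c_in assms] open_chart_Int[OF c_in assms]
      by (simp add: holomorphic_on_imp_differentiable_on)
    then show "transition c d differentiable_on \<Sigma> \<inter> snd c ` (fst c \<inter> fst d)"
      by (rule differentiable_on_subset) simp
  qed simp
  then show "negligible (snd d ` fst d - snd d ` (fst d - K))"
  proof (rule negligible_subset)
    show "snd d ` fst d - snd d ` (fst d - K) \<subseteq> transition c d ` (\<Sigma> \<inter> snd c ` (fst c \<inter> fst d))"
    proof
      fix z assume "z \<in> snd d ` fst d - snd d ` (fst d - K)"
      then obtain p where p: "p \<in> fst d" "p \<in> K" "z = snd d p" by blast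
      then have "p \<in> fst c" "snd c p \<in> \<Sigma>" by (auto simp: cut_def)
      moreover have "transition c d (snd c p) = z" using transition_at[OF c_chart \<open>p \<in> fst c\<close>] p by simp
      ultimately show "z \<in> transition c d ` (\<Sigma> \<inter> snd c ` (fst c \<inter> fst d))" using p by (auto intro!: rev_image_eqI[of "snd c p"])
    qed
  qed
  have "open (snd d ` (fst d - K))"
    by (rule open_chart_minus_K[OF assms chart_openin[OF charts[OF assms]]]) simp
  then show "snd d ` fst d - snd d ` (fst d - K) \<in> sets borel"
    using chart_open[OF charts[OF assms]] by (intro sets.Diff) auto
qed

end

context surgery_differential
begin

lemma deformed_cc:
  assumes "is_deformed_differential A \<omega> c \<rho> \<Sigma> J f \<omega>'" "d \<in> A" "z \<in> snd d ` (fst d - K)"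
  shows "\<omega>' (cc d) z = \<omega> d z"
  using assms unfolding is_deformed_differential_def by blast

text \<open>Compatibility with the cut chart of \<open>c\<close> forces the \<zeta> coefficient off
  \<open>J\<close>. The norm comparison thus covers every deformed differential and not only
  \<open>filled_diff\<close>.\<close>

lemma deformed_Z:
  assumes "is_deformed_differential A \<omega> c \<rho> \<Sigma> J f \<omega>'" "p \<in> D - K"
  shows "\<omega>' Z (f (snd c p)) = \<omega> c (snd c p) * deriv g (f (snd c p))"
proof -
  have pc: "p \<in> fst c - K" using assms(2) D_sub by blast
  let ?z = "f (snd c p)"
  have hd: "holomorphic_differential A' \<omega>'" using assms(1) by (simp add: is_deformed_differential_def)
  have x: "Inl p \<in> fst Z \<inter> fst (cc c)" using assms(2) pc unfolding fst_Z fst_cc by blast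
  have "Z \<in> A'" "cc c \<in> A'" using c_in by (auto simp: deformed_atlas_def)
  then have "\<omega>' Z (snd Z (Inl p)) = \<omega>' (cc c) (snd (cc c) (Inl p)) * deriv (transition Z (cc c)) (snd Z (Inl p))"
    using hd x unfolding holomorphic_differential_def by blast
  moreover have "\<omega>' (cc c) (snd c p) = \<omega> c (snd c p)" by (rule deformed_cc[OF assms(1) c_in]) (use pc in blast)
  moreover have "deriv (transition Z (cc c)) ?z = deriv g ?z"
  proof (rule complex_derivative_transform_within_open[OF _ _ open_overlap(4)[OF c_in]])
    have eq: "(transition c c \<circ> g) z = g z" if z_in: "z \<in> f ` snd c ` (fst c \<inter> D - K)" for z
    proof -
      obtain q where q: "q \<in> fst c - K" "z = f (snd c q)" using z_in by blast
      then show ?thesis using g_f[OF D_K_Sig[OF q(1)]] transition_at[OF c_chart, of q c] by simp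
    qed
    show "g holomorphic_on f ` snd c ` (fst c \<inter> D - K)"
      by (rule holomorphic_transform[OF trans_g_hol[OF c_in] eq])
    show "transition Z (cc c) holomorphic_on f ` snd c ` (fst c \<inter> D - K)"
      by (rule holomorphic_transform[OF trans_g_hol[OF c_in]]) (simp add: trans_Z_cc c_in)
    show "transition Z (cc c) z = g z" if "z \<in> f ` snd c ` (fst c \<inter> D - K)" for z
      using trans_Z_cc[OF c_in that] eq[OF that] by simp
    show "?z \<in> f ` snd c ` (fst c \<inter> D - K)" using assms(2) pc by blast
  qed
  ultimately show ?thesis by simp
qed

lemma integral_norm_le:
  assumes def: "is_deformed_differential A \<omega> c \<rho> \<Sigma> J f \<omega>'"
  shows "integral_norm A \<omega> \<le> integral_norm A' \<omega>'"
  unfolding integral_norm_def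
proof (rule SUP_least)
  fix P assume "P \<in> Collect (chart_pieces A)"
  then have P: "finite P" "disjoint_family_on snd P"
    "\<And>d E. (d, E) \<in> P \<Longrightarrow> d \<in> A \<and> E \<subseteq> fst d \<and> snd d ` E \<in> sets borel"
    by (auto simp: chart_pieces_def)
  \<comment> \<open>Each piece stays in its own chart and loses only its part in the cut, a null
    set.\<close>
  define h :: "'a chart \<times> 'a set \<Rightarrow> ('a + complex) chart \<times> ('a + complex) set"
    where "h = (\<lambda>(d, E). (cc d, Inl ` (E - K)))"
  have img: "snd (cc d) ` Inl ` (E - K) = snd d ` E \<inter> snd d ` (fst d - K)" if "(d, E) \<in> P" for d E
  proof -
    have "snd d ` E \<inter> snd d ` (fst d - K) = snd d ` (E \<inter> (fst d - K))"
      by (rule inj_on_image_Int[OF chart_inj[OF charts], symmetric]) (use P(3)[OF that] in auto)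
    also have "E \<inter> (fst d - K) = E - K" using P(3)[OF that] by blast
    finally show ?thesis by (simp add: image_image)
  qed
  have "chart_pieces A' (h ` P)"
    unfolding chart_pieces_def
  proof (intro conjI)
    show "finite (h ` P)" using P(1) by simp
    show "disjoint_family_on snd (h ` P)"
      unfolding disjoint_family_on_def
    proof (intro ballI impI)
      fix x y assume "x \<in> h ` P" "y \<in> h ` P" "x \<noteq> y"
      then obtain u v where uv: "u \<in> P" "v \<in> P" "x = h u" "y = h v" "u \<noteq> v" by blast
      then have "snd u \<inter> snd v = {}" using P(2) by (auto simp: disjoint_family_on_def)
      then show "snd x \<inter> snd y = {}" using uv by (auto simp: h_def split: prod.splits)
    qed
    have "cc d \<in> A' \<and> Inl ` (E - K) \<subseteq> fst (cc d) \<and> snd (cc d) ` Inl ` (E - K) \<in> sets borel" if dE: "(d, E) \<in> P" for d E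
    proof (intro conjI)
      have d: "d \<in> A" using P(3)[OF dE] by simp
      then show "cc d \<in> A'" by (simp add: deformed_atlas_def)
      show "Inl ` (E - K) \<subseteq> fst (cc d)" using P(3)[OF dE] unfolding fst_cc by blast
      have "open (snd d ` (fst d - K))"
        by (rule open_chart_minus_K[OF d chart_openin[OF charts[OF d]]]) simp
      then show "snd (cc d) ` Inl ` (E - K) \<in> sets borel"
        unfolding img[OF dE] using P(3)[OF dE] by (intro sets.Int) auto
    qed
    note pieces = this
    show "\<forall>(d, E)\<in>h ` P. d \<in> A' \<and> E \<subseteq> fst d \<and> snd d ` E \<in> sets borel"
    proof
      fix y assume "y \<in> h ` P"
      then obtain d E where "(d, E) \<in> P" "y = (cc d, Inl ` (E - K))" unfolding h_def by auto
      then show "case y of (d, E) \<Rightarrow> d \<in> A' \<and> E \<subseteq> fst d \<and> snd d ` E \<in> sets borel"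
        using pieces by simp
    qed
  qed
  moreover have "sum (piece_norm \<omega>) P = sum (piece_norm \<omega>') (h ` P)"
  proof -
    have "sum (piece_norm \<omega>) P = sum (piece_norm \<omega>' \<circ> h) P"
    proof (rule sum.cong[OF refl])
      fix x assume "x \<in> P"
      then obtain d E where x: "x = (d, E)" and dE: "(d, E) \<in> P" by (cases x) auto
      have d: "d \<in> A" "E \<subseteq> fst d" using P(3)[OF dE] by auto
      have "(\<integral>\<^sup>+z\<in>snd d ` E. ennreal ((cmod (\<omega> d z))\<^sup>2) \<partial>lborel)
          = (\<integral>\<^sup>+z\<in>snd (cc d) ` Inl ` (E - K). ennreal ((cmod (\<omega>' (cc d) z))\<^sup>2) \<partial>lborel)"
      proof (rule nn_set_integral_cong_null[OF negligible_cut_image[OF d(1)]])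
        show "z \<in> snd d ` E \<longleftrightarrow> z \<in> snd (cc d) ` Inl ` (E - K)" if "z \<notin> snd d ` fst d - snd d ` (fst d - K)" for z
          unfolding img[OF dE] using that d(2) by blast
      qed (unfold img[OF dE], simp add: deformed_cc[OF def d(1)])
      then show "piece_norm \<omega> x = (piece_norm \<omega>' \<circ> h) x" by (simp add: x h_def)
    qed
    also have "\<dots> = sum (piece_norm \<omega>') (h ` P)"
    \<comment> \<open>Two different pieces with the same image are disjoint, so that image is empty
      and contributes 0.\<close>
    proof (rule sum.reindex_nontrivial[OF P(1), symmetric])
      fix x y assume xy: "x \<in> P" "y \<in> P" "x \<noteq> y" "h x = h y"
      then have "snd x \<inter> snd y = {}" using P(2) by (auto simp: disjoint_family_on_def)
      then have "snd (h x) = {}" using xy(4) by (auto simp: h_def split: prod.splits)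
      then show "piece_norm \<omega>' (h x) = 0" by (simp add: case_prod_unfold)
    qed
    finally show ?thesis .
  qed
  ultimately show "sum (piece_norm \<omega>) P \<le> (SUP P \<in> Collect (chart_pieces A'). sum (piece_norm \<omega>') P)"
    by (auto intro!: SUP_upper)
qed

text \<open>Pieces of the \<zeta> chart, without the null set \<open>J\<close>, are moved to the w
  coordinate by \<open>g\<close>; its Jacobian is exactly the factor by which the squared
  coefficients differ. The globally continuous \<open>coef\<close> stands in for
  \<open>\<omega> c\<close>, which is arbitrary outside the chart range.\<close>

lemma norm_piece_zeta:
  assumes def: "is_deformed_differential A \<omega> c \<rho> \<Sigma> J f \<omega>'"
    and cont: "continuous_on UNIV coef" and om0: "\<And>w. w \<in> ball 0 \<rho> \<Longrightarrow> \<omega> c w = coef w"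
    and E: "E \<subseteq> fst Z" "snd Z ` E \<in> sets borel"
  shows "snd c ` (Inl -` E) \<in> sets borel"
    and "(\<integral>\<^sup>+z\<in>snd Z ` E. ennreal ((cmod (\<omega>' Z z))\<^sup>2) \<partial>lborel)
       = (\<integral>\<^sup>+z\<in>snd c ` (Inl -` E). ennreal ((cmod (\<omega> c z))\<^sup>2) \<partial>lborel)"
proof -
  let ?T = "snd c ` (Inl -` E)"
  have EDK: "Inl -` E \<subseteq> D - K" using E(1) unfolding fst_Z by blast
  have T_sub: "?T \<subseteq> ball 0 \<rho> - \<Sigma>" using EDK c_D_K by blast
  have S_eq: "f ` ?T = snd Z ` E - J"
  proof
    show "f ` ?T \<subseteq> snd Z ` E - J"
    proof (rule image_subsetI)
      fix w assume "w \<in> ?T"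
      then obtain p where p: "Inl p \<in> E" "w = snd c p" by blast
      then have "f w = snd Z (Inl p)" by simp
      moreover have "f w \<notin> J" using \<open>w \<in> ?T\<close> T_sub f_notin by blast
      ultimately show "f w \<in> snd Z ` E - J" using p(1) by blast
    qed
    show "snd Z ` E - J \<subseteq> f ` ?T"
    proof
      fix z assume "z \<in> snd Z ` E - J"
      then obtain x where x: "x \<in> E" "z = snd Z x" "z \<notin> J" by blast
      then obtain p where "x = Inl p" using E(1) unfolding fst_Z by auto
      then show "z \<in> f ` ?T" using x by auto
    qed
  qed
  have J_borel: "J \<in> sets borel" using J_compact by (simp add: compact_imp_closed borel_closed)
  have S: "f ` ?T \<in> sets borel" unfolding S_eq using E(2) J_borel by (rule sets.Diff)
  have gfT: "g ` f ` ?T = ?T"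
    using T_sub g_f by (force simp: image_image subset_iff)
  have f_cont: "continuous_on (- \<Sigma>) f" by (rule holomorphic_on_imp_continuous_on[OF f_hol])
  show "?T \<in> sets borel"
  proof -
    have "?T = f -` (f ` ?T) \<inter> (- \<Sigma>)" using T_sub inj_onD[OF f_inj] by (auto simp: subset_iff)
    moreover have "f \<in> borel_measurable (restrict_space borel (- \<Sigma>))"
      by (rule borel_measurable_continuous_on_restrict[OF f_cont])
    then have "f -` (f ` ?T) \<inter> (- \<Sigma>) \<in> sets borel"
      using measurable_sets[of f "restrict_space borel (- \<Sigma>)" borel "f ` ?T"] S Sig_open
      by (simp add: space_restrict_space sets_restrict_space_iff)
    ultimately show ?thesis by simp
  qed
  have "(\<integral>\<^sup>+z\<in>snd Z ` E. ennreal ((cmod (\<omega>' Z z))\<^sup>2) \<partial>lborel)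
      = (\<integral>\<^sup>+z\<in>f ` ?T. ennreal ((cmod (deriv g z))\<^sup>2 * (cmod (coef (g z)))\<^sup>2) \<partial>lborel)"
  proof (rule nn_set_integral_cong_null[OF null_sets_lborel_negligible[OF J_negligible J_borel]])
    show "z \<in> snd Z ` E \<longleftrightarrow> z \<in> f ` ?T" if "z \<notin> J" for z using that S_eq by blast
    fix z assume "z \<in> snd Z ` E \<inter> f ` ?T"
    then obtain p where p: "p \<in> D - K" "z = f (snd c p)" using EDK by blast
    have b: "snd c p \<in> ball 0 \<rho> - \<Sigma>" using p(1) c_D_K by blast
    have "\<omega>' Z z = coef (g z) * deriv g z"
      unfolding p(2) deformed_Z[OF def p(1)] using om0 b g_f by simp
    then show "ennreal ((cmod (\<omega>' Z z))\<^sup>2) = ennreal ((cmod (deriv g z))\<^sup>2 * (cmod (coef (g z)))\<^sup>2)"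
      by (simp add: norm_mult power_mult_distrib mult.commute)
  qed
  also have "\<dots> = (\<integral>\<^sup>+w\<in>g ` f ` ?T. ennreal ((cmod (coef w))\<^sup>2) \<partial>lborel)"
  proof (rule nn_integral_change_of_variables_holomorphic[OF S _ J_open g_hol, symmetric])
    show "f ` ?T \<subseteq> - J" unfolding S_eq by blast
    show "inj_on g (- J)" unfolding f_img[symmetric] by (rule inj_onI) (use g_f in auto)
    show "bounded (g ` f ` ?T)" unfolding gfT using T_sub by (intro bounded_subset[OF bounded_ball[of 0 \<rho>]]) auto
  qed (use cont in \<open>auto intro!: continuous_intros\<close>)
  also have "\<dots> = (\<integral>\<^sup>+z\<in>?T. ennreal ((cmod (\<omega> c z))\<^sup>2) \<partial>lborel)"
    unfolding gfT
  proof (rule nn_integral_cong)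
    fix w
    have "\<omega> c w = coef w" if "w \<in> ?T" using that T_sub om0 by blast
    then show "ennreal ((cmod (coef w))\<^sup>2) * indicator ?T w = ennreal ((cmod (\<omega> c w))\<^sup>2) * indicator ?T w"
      by (simp add: indicator_def)
  qed
  finally show "(\<integral>\<^sup>+z\<in>snd Z ` E. ennreal ((cmod (\<omega>' Z z))\<^sup>2) \<partial>lborel)
       = (\<integral>\<^sup>+z\<in>?T. ennreal ((cmod (\<omega> c z))\<^sup>2) \<partial>lborel)" .
qed

lemma integral_norm_ge:
  assumes def: "is_deformed_differential A \<omega> c \<rho> \<Sigma> J f \<omega>'"
    and cont: "continuous_on UNIV coef" and om0: "\<And>w. w \<in> ball 0 \<rho> \<Longrightarrow> \<omega> c w = coef w"
  shows "integral_norm A' \<omega>' \<le> integral_norm A \<omega>"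
  unfolding integral_norm_def
proof (rule SUP_least)
  fix P assume "P \<in> Collect (chart_pieces A')"
  then have P: "finite P" "disjoint_family_on snd P"
    "\<And>e E. (e, E) \<in> P \<Longrightarrow> e \<in> A' \<and> E \<subseteq> fst e \<and> snd e ` E \<in> sets borel"
    by (auto simp: chart_pieces_def)
  \<comment> \<open>Pieces return along \<open>source_chart\<close>: those of the \<zeta> chart go
    to \<open>c\<close> and lose their part in \<open>J\<close>, the others keep their
    coordinates.\<close>
  define h :: "('a + complex) chart \<times> ('a + complex) set \<Rightarrow> 'a chart \<times> 'a set"
    where "h = (\<lambda>(e, E). (source_chart e, Inl -` E))"
  have piece: "source_chart e \<in> A \<and> Inl -` E \<subseteq> fst (source_chart e) \<and> snd (source_chart e) ` (Inl -` E) \<in> sets borel \<and>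
      piece_norm \<omega>' (e, E) = piece_norm \<omega> (source_chart e, Inl -` E)" if "(e, E) \<in> P" for e E
  proof (cases "e = Z")
    case True
    have E: "E \<subseteq> fst Z" "snd Z ` E \<in> sets borel" using P(3)[OF that] True by auto
    have "Inl -` E \<subseteq> fst c" using E(1) D_sub unfolding fst_Z by blast
    then show ?thesis
      using norm_piece_zeta[OF def cont om0 E] c_in True by (simp add: source_chart_def)
  next
    case False
    let ?d = "source_chart e"
    have d: "?d \<in> A" "cc ?d = e" using source_chart_in P(3)[OF that] False by auto
    have E: "E \<subseteq> Inl ` (fst ?d - K)" "snd e ` E \<in> sets borel" using P(3)[OF that] d(2) fst_cc by metis+
    then have E_eq: "E = Inl ` (Inl -` E)" by blast
    have img: "snd e ` E = snd ?d ` (Inl -` E)"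
    proof -
      have "snd (cc ?d) ` (Inl ` T) = snd ?d ` T" for T by (simp add: image_image)
      then show ?thesis using E_eq d(2) by metis
    qed
    have sub: "Inl -` E \<subseteq> fst ?d - K" using E(1) by blast
    have "piece_norm \<omega>' (e, E) = piece_norm \<omega> (?d, Inl -` E)"
      unfolding prod.case img
    proof (rule nn_integral_cong)
      fix z
      have "\<omega>' e z = \<omega> ?d z" if "z \<in> snd ?d ` (Inl -` E)"
        using deformed_cc[OF def d(1), of z] that sub d(2) by auto
      then show "ennreal ((cmod (\<omega>' e z))\<^sup>2) * indicator (snd ?d ` (Inl -` E)) z
          = ennreal ((cmod (\<omega> ?d z))\<^sup>2) * indicator (snd ?d ` (Inl -` E)) z"
        by (simp add: indicator_def)
    qed
    then show ?thesis using d(1) sub E(2) img by auto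
  qed
  have "chart_pieces A (h ` P)"
    unfolding chart_pieces_def
  proof (intro conjI)
    show "finite (h ` P)" using P(1) by simp
    show "disjoint_family_on snd (h ` P)"
      unfolding disjoint_family_on_def
    proof (intro ballI impI)
      fix x y assume "x \<in> h ` P" "y \<in> h ` P" "x \<noteq> y"
      then obtain u v where uv: "u \<in> P" "v \<in> P" "x = h u" "y = h v" "u \<noteq> v" by blast
      then have "snd u \<inter> snd v = {}" using P(2) by (auto simp: disjoint_family_on_def)
      then show "snd x \<inter> snd y = {}" using uv by (auto simp: h_def split: prod.splits)
    qed
    show "\<forall>(d, E)\<in>h ` P. d \<in> A \<and> E \<subseteq> fst d \<and> snd d ` E \<in> sets borel"
    proof
      fix y assume "y \<in> h ` P"
      then obtain e E where "(e, E) \<in> P" "y = (source_chart e, Inl -` E)" unfolding h_def by auto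
      then show "case y of (d, E) \<Rightarrow> d \<in> A \<and> E \<subseteq> fst d \<and> snd d ` E \<in> sets borel"
        using piece by simp
    qed
  qed
  moreover have "sum (piece_norm \<omega>') P = sum (piece_norm \<omega>) (h ` P)"
  proof -
    have eq: "piece_norm \<omega>' x = (piece_norm \<omega> \<circ> h) x" if "x \<in> P" for x
      using piece[of "fst x" "snd x"] that by (simp add: h_def case_prod_unfold)
    have "sum (piece_norm \<omega>') P = sum (piece_norm \<omega> \<circ> h) P" by (rule sum.cong[OF refl eq])
    also have "\<dots> = sum (piece_norm \<omega>) (h ` P)"
    proof (rule sum.reindex_nontrivial[OF P(1), symmetric])
      fix x y assume xy: "x \<in> P" "y \<in> P" "x \<noteq> y" "h x = h y"
      then have "snd x \<inter> snd y = {}" using P(2) by (auto simp: disjoint_family_on_def)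
      then have "snd (h x) = {}" using xy(4) by (auto simp: h_def split: prod.splits)
      then show "piece_norm \<omega> (h x) = 0" by (simp add: case_prod_unfold)
    qed
    finally show ?thesis .
  qed
  ultimately show "sum (piece_norm \<omega>') P \<le> (SUP P \<in> Collect (chart_pieces A). sum (piece_norm \<omega>) P)"
    by (auto intro!: SUP_upper)
qed

end

section \<open>The theorem\<close>

context slit_map
begin

lemma surgery_slit:
  assumes "compact_riemann_surface X A" "holomorphic_differential A \<omega>" "c \<in> A"
    "ball 0 \<rho> \<subseteq> snd c ` fst c" "\<Sigma> \<subseteq> ball 0 \<rho>" "\<And>w. w \<in> ball 0 \<rho> \<Longrightarrow> \<omega> c w = - (w ^ (n - 1))"
  shows "surgery_differential X A c \<rho> \<Sigma> (image_slit \<epsilon>) f \<omega> F"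
proof -
  \<comment> \<open>A slit tip has modulus \<open>l\<close> and lies in the disc.\<close>
  have "l < \<rho>"
  proof -
    have "of_real l * cis \<alpha> \<in> \<Sigma>" unfolding slits_eq two_slits_def using l_pos by auto
    then have "cmod (of_real l * cis \<alpha>) < \<rho>" using assms(5) by auto
    then show ?thesis using l_pos by (simp add: norm_mult)
  qed
  show ?thesis
  proof unfold_locales
    show "connected (ball 0 \<rho> - \<Sigma>)"
      unfolding slits_eq using connected_ball_minus_two_slits l_pos \<open>l < \<rho>\<close> by simp
    show "compact \<Sigma>" "negligible \<Sigma>" "\<Sigma> \<noteq> {}"
      using compact_two_slits negligible_two_slits zero_in_two_slits[of l \<alpha>] l_pos by (auto simp: slits_eq)
    show "compact (image_slit \<epsilon>)" "negligible (image_slit \<epsilon>)" "image_slit \<epsilon> \<noteq> {}"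
      unfolding image_slit_eq_segment by (simp_all add: negligible_closed_segment)
    show "\<omega> c w = F (f w) * deriv f w" if "w \<in> ball 0 \<rho> - \<Sigma>" for w
      using that assms(6) F_pullback by simp
    show "F holomorphic_on surgery.W \<rho> \<Sigma> (image_slit \<epsilon>) f"
      using holomorphic_F by (rule holomorphic_on_subset) simp
  qed (use assms holomorphic_f bij_f f_fills_disc bounded_f in auto)
qed

end


theorem mainTheorem9:
  fixes m n :: nat and \<epsilon> :: real
  assumes "0 < m" and "m < n" and "0 < \<epsilon>"
  shows
    "\<comment> \<open>the slit maps\<close>
     Q_eps m n \<epsilon> holomorphic_on exterior \<epsilon> \<and> inj_on (Q_eps m n \<epsilon>) (exterior \<epsilon>) \<and>
     S_eps \<epsilon> holomorphic_on exterior \<epsilon> \<and> bij_betw (S_eps \<epsilon>) (exterior \<epsilon>) (- image_slit \<epsilon>) \<and>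
     \<comment> \<open>the pushforward of the local differential\<close>
     (\<exists>l \<mu> F.
        0 < l \<and> slits m n \<epsilon> = two_slits (pi * m / n) l \<and>
        - 2 * \<epsilon> < \<mu> \<and> \<mu> < 2 * \<epsilon> \<and>
        (regluing_map m n \<epsilon> \<longlongrightarrow> of_real (- 2 * \<epsilon>)) (at 0 within left_sector (pi * m / n)) \<and>
        (regluing_map m n \<epsilon> \<longlongrightarrow> of_real \<mu>) (at (of_real l * cis (pi * m / n)) within - slits m n \<epsilon>) \<and>
        (regluing_map m n \<epsilon> \<longlongrightarrow> of_real \<mu>) (at (of_real l * cis (- (pi * m / n))) within - slits m n \<epsilon>) \<and>
        (regluing_map m n \<epsilon> \<longlongrightarrow> of_real (2 * \<epsilon>)) (at 0 within right_sector (pi * m / n)) \<and>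
        F holomorphic_on UNIV \<and>
        (\<forall>\<zeta>\<in>- image_slit \<epsilon>.
           F \<zeta> = pushforward (- slits m n \<epsilon>) (regluing_map m n \<epsilon>) (\<lambda>w. - (w ^ (n - 1))) \<zeta>) \<and>
        has_zero_of_order F (of_real (- 2 * \<epsilon>)) (n - m - 1) \<and>
        has_zero_of_order F (of_real \<mu>) 1 \<and>
        has_zero_of_order F (of_real (2 * \<epsilon>)) (m - 1)) \<and>
     \<comment> \<open>the construction on a compact Riemann surface\<close>
     (\<forall>(X :: 'a topology) A c \<rho> \<omega>.
        compact_riemann_surface X A \<and> holomorphic_differential A \<omega> \<and>
        c \<in> A \<and> ball 0 \<rho> \<subseteq> snd c ` fst c \<and> slits m n \<epsilon> \<subseteq> ball 0 \<rho> \<and>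
        (\<forall>w\<in>ball 0 \<rho>. \<omega> c w = - (w ^ (n - 1)))
        \<longrightarrow>
        (let X' = deformed_topology X c \<rho> (slits m n \<epsilon>) (image_slit \<epsilon>) (regluing_map m n \<epsilon>);
             A' = deformed_atlas A c \<rho> (slits m n \<epsilon>) (image_slit \<epsilon>) (regluing_map m n \<epsilon>);
             deformed = is_deformed_differential A \<omega> c \<rho> (slits m n \<epsilon>) (image_slit \<epsilon>) (regluing_map m n \<epsilon>)
         in compact_riemann_surface X' A' \<and>
            (\<exists>\<omega>'. deformed \<omega>') \<and>
            (\<forall>\<omega>'. deformed \<omega>' \<longrightarrow>
               (\<forall>C. one_cycle X A C \<and> (\<forall>(k, \<gamma>)\<in>set C. \<gamma> ` {0..1} \<inter> coord_disc c \<rho> = {})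
                  \<longrightarrow> one_cycle X' A' (map (\<lambda>(k, \<gamma>). (k, Inl \<circ> \<gamma>)) C) \<and>
                      period A' \<omega>' (map (\<lambda>(k, \<gamma>). (k, Inl \<circ> \<gamma>)) C) = period A \<omega> C) \<and>
               integral_norm A' \<omega>' = integral_norm A \<omega>)))"
proof -
  interpret slit_map m n \<epsilon> by unfold_locales (rule assms)+
  have "l > 0 \<and> slits m n \<epsilon> = two_slits \<alpha> l \<and>
      - 2 * \<epsilon> < \<mu> \<and> \<mu> < 2 * \<epsilon> \<and>
      (f \<longlongrightarrow> of_real (- 2 * \<epsilon>)) (at 0 within left_sector \<alpha>) \<and>
      (f \<longlongrightarrow> of_real \<mu>) (at (of_real l * cis \<alpha>) within - \<Sigma>) \<and>
      (f \<longlongrightarrow> of_real \<mu>) (at (of_real l * cis (- \<alpha>)) within - \<Sigma>) \<and>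
      (f \<longlongrightarrow> of_real (2 * \<epsilon>)) (at 0 within right_sector \<alpha>) \<and>
      F holomorphic_on UNIV \<and>
      (\<forall>\<zeta>\<in>- image_slit \<epsilon>. F \<zeta> = pushforward (- \<Sigma>) f (\<lambda>w. - (w ^ (n - 1))) \<zeta>) \<and>
      has_zero_of_order F (of_real (- 2 * \<epsilon>)) (n - m - 1) \<and>
      has_zero_of_order F (of_real \<mu>) 1 \<and>
      has_zero_of_order F (of_real (2 * \<epsilon>)) (m - 1)"
  proof (intro conjI ballI)
    have tip: "of_real l * cis \<beta> \<in> two_slits \<alpha> l" "cmod (of_real l * cis \<beta>) = l"
      if "\<beta> = \<alpha> \<or> \<beta> = - \<alpha>" for \<beta>
      using that l_pos unfolding two_slits_def by (auto simp: norm_mult simp del: cis_cnj)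
    show "(f \<longlongrightarrow> of_real \<mu>) (at (of_real l * cis \<alpha>) within - \<Sigma>)"
      "(f \<longlongrightarrow> of_real \<mu>) (at (of_real l * cis (- \<alpha>)) within - \<Sigma>)"
      by (rule f_tip; use tip in blast)+
  qed (use l_pos slits_eq mu_bounds f_left_vertex f_right_vertex holomorphic_F pushforward_eq F_zeros in auto)
  moreover have "compact_riemann_surface (deformed_topology X c \<rho> \<Sigma> (image_slit \<epsilon>) f)
        (deformed_atlas A c \<rho> \<Sigma> (image_slit \<epsilon>) f) \<and>
      (\<exists>\<omega>'. is_deformed_differential A \<omega> c \<rho> \<Sigma> (image_slit \<epsilon>) f \<omega>') \<and>
      (\<forall>\<omega>'. is_deformed_differential A \<omega> c \<rho> \<Sigma> (image_slit \<epsilon>) f \<omega>' \<longrightarrow>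
        (\<forall>C. one_cycle X A C \<and> (\<forall>(k, \<gamma>)\<in>set C. \<gamma> ` {0..1} \<inter> coord_disc c \<rho> = {}) \<longrightarrow>
          one_cycle (deformed_topology X c \<rho> \<Sigma> (image_slit \<epsilon>) f) (deformed_atlas A c \<rho> \<Sigma> (image_slit \<epsilon>) f)
            (map (\<lambda>(k, \<gamma>). (k, Inl \<circ> \<gamma>)) C) \<and>
          period (deformed_atlas A c \<rho> \<Sigma> (image_slit \<epsilon>) f) \<omega>' (map (\<lambda>(k, \<gamma>). (k, Inl \<circ> \<gamma>)) C) = period A \<omega> C) \<and>
        integral_norm (deformed_atlas A c \<rho> \<Sigma> (image_slit \<epsilon>) f) \<omega>' = integral_norm A \<omega>)"
    if "compact_riemann_surface X A \<and> holomorphic_differential A \<omega> \<and>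
        c \<in> A \<and> ball 0 \<rho> \<subseteq> snd c ` fst c \<and> slits m n \<epsilon> \<subseteq> ball 0 \<rho> \<and>
        (\<forall>w\<in>ball 0 \<rho>. \<omega> c w = - (w ^ (n - 1)))"
    for X :: "'a topology" and A c \<rho> \<omega>
  proof -
    interpret reglued: surgery_differential X A c \<rho> \<Sigma> "image_slit \<epsilon>" f \<omega> F
      by (rule surgery_slit) (use that in auto)
    have norm: "integral_norm (deformed_atlas A c \<rho> \<Sigma> (image_slit \<epsilon>) f) \<omega>' = integral_norm A \<omega>"
      if def: "is_deformed_differential A \<omega> c \<rho> \<Sigma> (image_slit \<epsilon>) f \<omega>'" for \<omega>'
    proof (rule antisym)
      show "integral_norm (deformed_atlas A c \<rho> \<Sigma> (image_slit \<epsilon>) f) \<omega>' \<le> integral_norm A \<omega>"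
        \<comment> \<open>In this direction the \<zeta> chart must be compared with
          \<open>c\<close>; the normal form provides a polynomial coefficient, continuous on the
          whole plane.\<close>
        by (rule reglued.integral_norm_ge[OF def, where coef = "\<lambda>w. - (w ^ (n - 1))"])
          (use \<open>compact_riemann_surface X A \<and> _\<close> in \<open>auto intro!: continuous_intros\<close>)
      show "integral_norm A \<omega> \<le> integral_norm (deformed_atlas A c \<rho> \<Sigma> (image_slit \<epsilon>) f) \<omega>'"
        by (rule reglued.integral_norm_le[OF def])
    qed
    have periods: "period (deformed_atlas A c \<rho> \<Sigma> (image_slit \<epsilon>) f) \<omega>' (map (\<lambda>(k, \<gamma>). (k, Inl \<circ> \<gamma>)) C) = period A \<omega> C"
      if "is_deformed_differential A \<omega> c \<rho> \<Sigma> (image_slit \<epsilon>) f \<omega>'"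
        "\<forall>(k, \<gamma>)\<in>set C. \<gamma> ` {0..1} \<inter> coord_disc c \<rho> = {}" for \<omega>' C
      by (rule reglued.period_Inl[OF that(2)]) (rule reglued.deformed_cc[OF that(1)])
    show ?thesis
      using reglued.compact_riemann_surface_X' reglued.is_deformed_filled_diff norm periods
        reglued.one_cycle_Inl by blast
  qed
  ultimately show ?thesis
    unfolding Let_def using holomorphic_Q inj_Q holomorphic_S bij_S by blast
qed

end
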